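(* Let $M\in\mathbb{N}^*$ be a positive integer. There exists a $G$-function which cannot be written as a polynomial with coefficients in $\overline{\mathbb{Q}}$ of $G$-functions of the form $\mu(x)\cdot{}_pF_{p-1}[a_1,\dots,a_p;b_1,\dots,b_{p-1};\lambda(x)]$, with $p\ge1$, $a_j\in\mathbb{Q}$, $b_j\in\mathbb{Q}\setminus\mathbb{Z}_{\le0}$, $\lambda,\mu\in\overline{\mathbb{Q}}[[x]]$, $\mu$ algebraic over $\overline{\mathbb{Q}}(x)$, and $\lambda\in\overline{\mathbb{Q}}(x)\setminus\overline{\mathbb{Q}}$ with numerator and denominator of degree less than $M$ and $\lambda(0)=0$. (Here $p$, the parameters $a_j,b_j$, $\mu$ and $\lambda$ may vary among the functions occurring in the polynomial.)
   Context: $\overline{\mathbb{Q}}\subset\mathbb{C}$ is the field of algebraic numbers. A $G$-function is a power series $F(x)=\sum_{n\ge0}a_nx^n\in\overline{\mathbb{Q}}[[x]]$ such that: (i) $F$ is a solution of a non-zero linear differential equation with coefficients in $\overline{\mathbb{Q}}(x)$; (ii) there is $C>0$ such that $|\sigma(a_n)|\le C^{n+1}$ for all $\sigma\in\mathrm{Gal}(\overline{\mathbb{Q}}/\mathbb{Q})$ and $n\ge0$; (iii) there are $D>0$ and integers $d_n$ with $1\le d_n\le D^{n+1}$ such that $d_na_m$ is an algebraic integer for all $m\le n$. The generalized hypergeometric series is $${}_pF_{p-1}[a_1,\dots,a_p;b_1,\dots,b_{p-1};x]=\sum_{n=0}^\infty\frac{(a_1)_n\cdots(a_p)_n}{(1)_n(b_1)_n\cdots(b_{p-1})_n}x^n,$$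 where $(a)_0=1$ and $(a)_n=a(a+1)\cdots(a+n-1)$ for $n\ge1$; empty products equal $1$. *)

theory Defs
  imports
    "HOL-Computational_Algebra.Formal_Laurent_Series"
    "HOL-Computational_Algebra.Polynomial"
    "HOL-Library.Nonpos_Ints"
    "HOL-Library.Poly_Mapping"
    Complex_Main
begin

definition Qbar :: "complex set" where
  "Qbar = {z. algebraic z}"

text \<open>The Galois group of \<open>Qbar\<close> over the rationals. Its elements are represented by total
  functions on the complex numbers; only their values on \<^const>\<open>Qbar\<close> matter.\<close>

definition Gal_Qbar :: "(complex \<Rightarrow> complex) set" where
  "Gal_Qbar = {\<sigma>. bij_betw \<sigma> Qbar Qbar \<and>
     (\<forall>x\<in>Qbar. \<forall>y\<in>Qbar. \<sigma> (x + y) = \<sigma> x + \<sigma> y \<and> \<sigma> (x * y) = \<sigma> x * \<sigma> y) \<and>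
     (\<forall>q\<in>\<rat>. \<sigma> q = q)}"

definition Qbar_poly :: "complex poly set" where
  "Qbar_poly = {P. \<forall>i. poly.coeff P i \<in> Qbar}"

definition Qbar_fps :: "complex fps set" where
  "Qbar_fps = {F. \<forall>n. fps_nth F n \<in> Qbar}"

abbreviation fls_of_poly :: "complex poly \<Rightarrow> complex fls" where
  "fls_of_poly P \<equiv> fps_to_fls (fps_of_poly P)"

text \<open>The field of rational functions over \<^const>\<open>Qbar\<close>, embedded in the field of formal
  Laurent series by expansion at \<open>0\<close>.\<close>

definition Qbar_ratfun :: "complex fls set" where
  "Qbar_ratfun = {fls_of_poly P / fls_of_poly Q | P Q.
     P \<in> Qbar_poly \<and> Q \<in> Qbar_poly \<and> Q \<noteq> 0}"

definition satisfies_linear_ode :: "complex fps \<Rightarrow> bool" where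
  "satisfies_linear_ode F \<longleftrightarrow>
     (\<exists>r. \<exists>c :: nat \<Rightarrow> complex fls.
        (\<forall>i\<le>r. c i \<in> Qbar_ratfun) \<and> (\<exists>i\<le>r. c i \<noteq> 0) \<and>
        (\<Sum>i\<le>r. c i * (fls_deriv ^^ i) (fps_to_fls F)) = 0)"

definition G_function :: "complex fps \<Rightarrow> bool" where
  "G_function F \<longleftrightarrow>
     F \<in> Qbar_fps \<and>
     satisfies_linear_ode F \<and>
     (\<exists>C>0::real. \<forall>\<sigma>\<in>Gal_Qbar. \<forall>n. norm (\<sigma> (fps_nth F n)) \<le> C ^ (n + 1)) \<and>
     (\<exists>D>0::real. \<exists>d :: nat \<Rightarrow> int. \<forall>n. 1 \<le> d n \<and> real_of_int (d n) \<le> D ^ (n + 1) \<and>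
        (\<forall>m\<le>n. algebraic_int (of_int (d n) * fps_nth F m)))"

definition algebraic_over_ratfun :: "complex fps \<Rightarrow> bool" where
  "algebraic_over_ratfun F \<longleftrightarrow>
     (\<exists>p :: complex fls poly. p \<noteq> 0 \<and> (\<forall>i. poly.coeff p i \<in> Qbar_ratfun) \<and>
        poly p (fps_to_fls F) = 0)"

text \<open>The non-constant rational functions over \<^const>\<open>Qbar\<close> which vanish at \<open>0\<close> and whose
  numerator and denominator (in lowest terms) have degree less than \<open>M\<close>.\<close>

definition admissible_arg :: "nat \<Rightarrow> complex fps \<Rightarrow> bool" where
  "admissible_arg M f \<longleftrightarrow>
     f \<in> Qbar_fps \<and>
     (\<exists>P\<in>Qbar_poly. \<exists>Q\<in>Qbar_poly. Q \<noteq> 0 \<and> coprime P Q \<and>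
        Polynomial.degree P < M \<and> Polynomial.degree Q < M \<and>
        fps_to_fls f = fls_of_poly P / fls_of_poly Q) \<and>
     (\<forall>c\<in>Qbar. f \<noteq> fps_const c) \<and>
     fps_nth f 0 = 0"

text \<open>In \<^const>\<open>fps_hypergeo\<close> the factor \<open>(1)\<^sub>n = n!\<close> of the denominator is built in, so the
  second list holds only \<open>b\<^sub>1, \<dots>, b\<^sub>p\<^sub>-\<^sub>1\<close>.\<close>

definition hypergeometric_form :: "nat \<Rightarrow> complex fps \<Rightarrow> bool" where
  "hypergeometric_form M F \<longleftrightarrow>
     (\<exists>p\<ge>1. \<exists>a b :: complex list. \<exists>\<mu> f :: complex fps.
        length a = p \<and> length b = p - 1 \<and>
        set a \<subseteq> \<rat> \<and> set b \<subseteq> \<rat> - \<int>\<^sub>\<le>\<^sub>0 \<and>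
        \<mu> \<in> Qbar_fps \<and> algebraic_over_ratfun \<mu> \<and>
        admissible_arg M f \<and>
        F = \<mu> * (fps_hypergeo a b 1 oo f))"

text \<open>Values of polynomials over \<^const>\<open>Qbar\<close> in finitely many variables at elements of \<open>S\<close>.
  A polynomial in the variables \<open>X\<^sub>0, \<dots>, X\<^sub>n\<^sub>-\<^sub>1\<close> is a finitely supported map from exponent
  vectors (supported on \<open>{..<n}\<close>) to coefficients.\<close>

definition Qbar_polynomials_in :: "complex fps set \<Rightarrow> complex fps set" where
  "Qbar_polynomials_in S =
     {F. \<exists>n. \<exists>P :: (nat \<Rightarrow>\<^sub>0 nat) \<Rightarrow>\<^sub>0 complex. \<exists>g :: nat \<Rightarrow> complex fps.
        (\<forall>e. Poly_Mapping.lookup P e \<in> Qbar) \<and>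
        (\<forall>e\<in>Poly_Mapping.keys P. Poly_Mapping.keys e \<subseteq> {..<n}) \<and>
        (\<forall>i<n. g i \<in> S) \<and>
        F = (\<Sum>e\<in>Poly_Mapping.keys P. fps_const (Poly_Mapping.lookup P e) *
               (\<Prod>i<n. g i ^ Poly_Mapping.lookup e i))}"

end

theory Submission
  imports Defs "HOL-Complex_Analysis.Complex_Analysis"
begin

text \<open>
  The function that is not of hypergeometric type is the iterated integral of the forms
  \<open>dx / (x - t\<^sub>j)\<close>, \<open>j = 0, \<dots>, N - 1\<close>, with \<open>t\<^sub>j = 1 / (j + 1)\<close> and \<open>N = 3 M\<close>. Let \<open>\<gamma>\<^sub>j\<close> denote
  analytic continuation around \<open>t\<^sub>j\<close> and \<open>w = [\<gamma>\<^sub>0\<^sup>k, [\<gamma>\<^sub>1\<^sup>k, \<dots>, \<gamma>\<^sub>N\<^sub>-\<^sub>1\<^sup>k]]\<close>. Then \<open>w\<close> adds a non-zero constant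
  to the iterated integral. On the other hand, a series \<open>\<mu> \<cdot> F(\<lambda>)\<close> with \<open>F\<close> hypergeometric and
  \<open>\<mu>\<close> algebraic has infinite local monodromy at most over \<open>\<lambda>\<^sup>-\<^sup>1 {0, 1, \<infinity>}\<close>, hence at most at
  \<open>3 (M - 1)\<close> points. So for a suitable exponent \<open>k\<close> one of the \<open>\<gamma>\<^sub>j\<^sup>k\<close> acts trivially on all its
  branches, and then so does the commutator \<open>w\<close>. As \<open>w\<close> acts by ring automorphisms, it fixes every
  polynomial in such series.
\<close>

section \<open>Linear differential equations on star-shaped domains\<close>

text \<open>Monodromy acts on iterated integrals by unipotent triangular matrices. A nested
  commutator kills all entries but the last, which is, up to sign, the product of the N entries
  2\<pi>ik of the single logarithms; so any k > 0 may be used. For H = \<mu> F(\<lambda>), \<mu>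
  itself is never continued. H solves a linear equation because it is a G-function, and so does G =
  F(\<lambda>). Multiplied by G^n, the equation of \<mu> = H / G becomes a homogeneous relation
  between H and G. Around a point where the system of G is regular, G does not change and the
  branches of H are roots of one polynomial of degree n, so n! turns act trivially. The equation of
  H may have many more singular points; they have to be cut out, but do not count against N. Since
  \<lambda>(0) = 0, the point 0 is a pole of the system of G; hence the base point is a generic c
  near 0. Cutting along half-lines that point away from c leaves a star-shaped domain, and a loop
  becomes the crossing of one half-line, which replaces paths and homotopies. The points 1 / (j + 1)
  are rational and non-zero: the series at 0 have rational coefficients, on which Galois conjugation
  is trivial.\<close>

lemma segment_primitive_bound:
  fixes f g :: "complex \<Rightarrow> complex"
  assumes g: "\<And>x. x \<in> closed_segment a z \<Longrightarrow> (g has_field_derivative f x) (at x)"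
    and "g a = 0"
    and f: "\<And>x. x \<in> closed_segment a z \<Longrightarrow> norm (f x) \<le> C * norm (x - a) ^ m"
  shows "norm (g z) \<le> C * norm (z - a) ^ Suc m / Suc m"
proof -
  define p where "p = (\<lambda>t::real. a + of_real t * (z - a))"
  have p: "p t \<in> closed_segment a z" if "t \<in> {0..1}" for t
    using that unfolding p_def closed_segment_def
    by (auto intro!: exI[of _ t] simp: scaleR_conv_of_real algebra_simps)
  have pd: "((\<lambda>t. g (p t)) has_vector_derivative (z - a) * f (p t)) (at t within A)" if "t \<in> {0..1}" for t A
  proof -
    have "(p has_vector_derivative (z - a)) (at t within A)"
      unfolding p_def by (auto intro!: derivative_eq_intros)
    moreover have "(g has_field_derivative f (p t)) (at (p t) within p ` A)"
      by (rule has_field_derivative_at_within[OF g[OF p[OF that]]])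
    ultimately show ?thesis
      using field_vector_diff_chain_within[of p "z - a" t A g "f (p t)"] by (simp add: o_def)
  qed
  let ?\<phi> = "\<lambda>t::real. C * norm (z - a) ^ Suc m * t ^ Suc m / Suc m"
  have "norm (g (p 1) - g (p 0)) \<le> ?\<phi> 1 - ?\<phi> 0"
  proof (rule differentiable_bound_general)
    show "continuous_on {0..1} (\<lambda>t. g (p t))"
      by (rule continuous_on_vector_derivative) (rule pd)
    show "continuous_on {0..1} ?\<phi>" by (intro continuous_intros) auto
    show "((\<lambda>t. g (p t)) has_vector_derivative (z - a) * f (p t)) (at t)" if "0 < t" "t < 1" for t
      using that by (intro pd) auto
    show "(?\<phi> has_vector_derivative C * norm (z - a) ^ Suc m * t ^ m) (at t)" for t
      unfolding has_real_derivative_iff_has_vector_derivative[symmetric]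
      by (auto intro!: derivative_eq_intros simp del: power_Suc)
    show "norm ((z - a) * f (p t)) \<le> C * norm (z - a) ^ Suc m * t ^ m" if "0 < t" "t < 1" for t
    proof -
      have "norm (f (p t)) \<le> C * norm (p t - a) ^ m" using that by (intro f p) auto
      also have "norm (p t - a) = t * norm (z - a)" using that by (simp add: p_def norm_mult)
      finally show ?thesis
        using mult_left_mono[of "norm (f (p t))" "C * (t * norm (z - a)) ^ m" "norm (z - a)"]
        by (simp add: norm_mult power_mult_distrib mult_ac)
    qed
  qed auto
  thus ?thesis using \<open>g a = 0\<close> by (simp add: p_def)
qed

text \<open>A neighbourhood of a segment is the Minkowski sum of the segment and a disc, hence
  convex. The closed one is a compact set, star-shaped about \<open>a\<close>, on which coefficients
  are bounded; the open one serves to carry a solution from one end of a segment to the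
  other.\<close>

lemma segment_nbhd:
  fixes a z :: complex
  assumes "open T" "closed_segment a z \<subseteq> T"
  obtains e where "e > 0" "(\<Union>x\<in>closed_segment a z. cball x e) \<subseteq> T"
    "compact (\<Union>x\<in>closed_segment a z. cball x e)" "convex (\<Union>x\<in>closed_segment a z. cball x e)"
    "convex (\<Union>x\<in>closed_segment a z. ball x e)"
proof -
  obtain e where e: "e > 0" "(\<Union>x\<in>closed_segment a z. cball x e) \<subseteq> T"
    using compact_subset_open_imp_cball_epsilon_subset assms by (metis compact_segment)
  have 1: "(\<Union>x\<in>closed_segment a z. cball x e) = (\<Union>x\<in>closed_segment a z. \<Union>y\<in>cball 0 e. {x + y})" (is "?A = ?B")
  proof safe
    fix x y assume "x \<in> closed_segment a z" "y \<in> cball x e"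
    thus "y \<in> ?B"
      by (intro UN_I[of x] UN_I[of "y - x"]) (auto simp: dist_norm norm_minus_commute)
  qed (auto simp: dist_norm intro!: bexI)
  have 2: "(\<Union>x\<in>closed_segment a z. ball x e) = (\<Union>x\<in>closed_segment a z. \<Union>y\<in>ball 0 e. {x + y})" (is "?C = ?D")
  proof safe
    fix x y assume "x \<in> closed_segment a z" "y \<in> ball x e"
    thus "y \<in> ?D"
      by (intro UN_I[of x] UN_I[of "y - x"]) (auto simp: dist_norm norm_minus_commute)
  qed (auto simp: dist_norm intro!: bexI)
  have "convex ?A" unfolding 1 by (intro convex_sums convex_closed_segment convex_cball)
  have "convex ?C" unfolding 2 by (intro convex_sums convex_closed_segment convex_ball)
  have "?A = {x + y |x y. x \<in> closed_segment a z \<and> y \<in> cball 0 e}" unfolding 1 by blast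
  hence "compact ?A" using compact_sums[OF compact_segment compact_cball, of a z 0 e] by metis
  show ?thesis by (rule that) (use e \<open>convex ?A\<close> \<open>compact ?A\<close> \<open>convex ?C\<close> in auto)
qed

definition ode_sol :: "nat \<Rightarrow> (nat \<Rightarrow> nat \<Rightarrow> complex \<Rightarrow> complex) \<Rightarrow> complex set \<Rightarrow> (nat \<Rightarrow> complex \<Rightarrow> complex) \<Rightarrow> bool" where
  "ode_sol n B T Y \<longleftrightarrow>
     (\<forall>i<n. \<forall>x\<in>T. (Y i has_field_derivative (\<Sum>j<n. B i j x * Y j x)) (at x))"

lemma ode_sol_subset: "ode_sol n B T Y \<Longrightarrow> T' \<subseteq> T \<Longrightarrow> ode_sol n B T' Y"
  by (auto simp: ode_sol_def)

lemma ode_sol_holomorphic: "ode_sol n B T Y \<Longrightarrow> open T \<Longrightarrow> i < n \<Longrightarrow> Y i holomorphic_on T"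
  by (auto simp: ode_sol_def holomorphic_on_open)

lemma coefficient_bound:
  fixes n :: nat
  assumes "compact K" "\<And>i j. i < n \<Longrightarrow> j < n \<Longrightarrow> continuous_on K (B i j :: complex \<Rightarrow> complex)"
  obtains b where "b \<ge> 0" "\<And>i x. i < n \<Longrightarrow> x \<in> K \<Longrightarrow> (\<Sum>j<n. norm (B i j x)) \<le> b"
proof -
  have "continuous_on K (\<lambda>x. \<Sum>i<n. \<Sum>j<n. norm (B i j x))"
    using assms(2) by (intro continuous_intros) auto
  hence "bounded ((\<lambda>x. \<Sum>i<n. \<Sum>j<n. norm (B i j x)) ` K)"
    using assms(1) by (intro compact_imp_bounded compact_continuous_image)
  then obtain b where b: "b > 0" "\<And>x. x \<in> K \<Longrightarrow> norm (\<Sum>i<n. \<Sum>j<n. norm (B i j x)) \<le> b"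
    by (auto simp: bounded_pos)
  show ?thesis
  proof (rule that[of b])
    fix i x assume "i < n" "x \<in> K"
    have "(\<Sum>j<n. norm (B i j x)) \<le> (\<Sum>i<n. \<Sum>j<n. norm (B i j x))"
      using \<open>i < n\<close> by (intro member_le_sum[where f = "\<lambda>i. \<Sum>j<n. norm (B i j x)"]) (auto intro!: sum_nonneg)
    thus "(\<Sum>j<n. norm (B i j x)) \<le> b" using b(2)[OF \<open>x \<in> K\<close>] by (simp add: abs_le_iff)
  qed (use b in auto)
qed

text \<open>By \<open>segment_primitive_bound\<close>, each integration from \<open>a\<close> gains
  a power of the distance and a denominator, whence the factorial. \<open>E\<close> is used in two
  ways: as the increments of the Picard iteration, and as a constant sequence, because a solution
  that vanishes at \<open>a\<close> is its own successor.\<close>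

lemma picard_bound:
  fixes E :: "nat \<Rightarrow> nat \<Rightarrow> complex \<Rightarrow> complex"
  assumes star: "\<And>z. z \<in> K \<Longrightarrow> closed_segment a z \<subseteq> K"
    and E0: "\<And>i x. i < n \<Longrightarrow> x \<in> K \<Longrightarrow> norm (E 0 i x) \<le> C"
    and Ea: "\<And>m i. i < n \<Longrightarrow> E (Suc m) i a = 0"
    and Ed: "\<And>m i x. i < n \<Longrightarrow> x \<in> K \<Longrightarrow>
       (E (Suc m) i has_field_derivative (\<Sum>j<n. B i j x * E m j x)) (at x)"
    and b: "b \<ge> 0" "\<And>i x. i < n \<Longrightarrow> x \<in> K \<Longrightarrow> (\<Sum>j<n. norm (B i j x)) \<le> b"
    and i: "i < n" "x \<in> K"
  shows "norm (E m i x) \<le> C * (b * norm (x - a)) ^ m / fact m"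
  using i
proof (induction m arbitrary: i x)
  case (Suc m)
  have "norm (E (Suc m) i x) \<le> (C * b ^ Suc m / fact m) * norm (x - a) ^ Suc m / Suc m"
  proof (rule segment_primitive_bound)
    fix y assume "y \<in> closed_segment a x"
    hence y: "y \<in> K" using star Suc.prems by auto
    thus "(E (Suc m) i has_field_derivative (\<Sum>j<n. B i j y * E m j y)) (at y)"
      using Ed Suc.prems by auto
    have C: "0 \<le> C" using E0[OF Suc.prems] norm_ge_zero order_trans by blast
    have "norm (\<Sum>j<n. B i j y * E m j y) \<le> (\<Sum>j<n. norm (B i j y) * (C * (b * norm (y - a)) ^ m / fact m))"
      by (intro sum_norm_le) (use Suc.IH y in \<open>simp add: norm_mult mult_left_mono del: times_divide_eq_right\<close>)
    also have "\<dots> = (\<Sum>j<n. norm (B i j y)) * (C * (b * norm (y - a)) ^ m / fact m)"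
      by (rule sum_distrib_right[symmetric])
    also have "\<dots> \<le> b * (C * (b * norm (y - a)) ^ m / fact m)"
      using b(2)[OF Suc.prems(1) y] b(1) C by (intro mult_right_mono) auto
    also have "\<dots> = C * b ^ Suc m / fact m * norm (y - a) ^ m"
      by (simp add: power_mult_distrib)
    finally show "norm (\<Sum>j<n. B i j y * E m j y) \<le> C * b ^ Suc m / fact m * norm (y - a) ^ m" .
  qed (use Ea Suc.prems in auto)
  also have "\<dots> = C * (b * norm (x - a)) ^ Suc m / fact (Suc m)"
    by (simp add: power_mult_distrib field_simps)
  finally show ?case .
qed (use E0 in auto)

lemma ode_sol_unique:
  assumes "open T" "a \<in> T" and star: "\<And>z. z \<in> T \<Longrightarrow> closed_segment a z \<subseteq> T"
    and B: "\<And>i j. i < n \<Longrightarrow> j < n \<Longrightarrow> B i j holomorphic_on T"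
    and Y: "ode_sol n B T Y" and Z: "ode_sol n B T Z"
    and eq: "\<And>i. i < n \<Longrightarrow> Y i a = Z i a"
    and i: "i < n" "x \<in> T"
  shows "Y i x = Z i x"
proof -
  let ?K = "closed_segment a x"
  have K: "?K \<subseteq> T" using star i by auto
  have cB: "\<And>i j. i < n \<Longrightarrow> j < n \<Longrightarrow> continuous_on ?K (B i j)"
    using B K holomorphic_on_imp_continuous_on continuous_on_subset by blast
  obtain b where b: "b \<ge> 0" "\<And>i x. i < n \<Longrightarrow> x \<in> ?K \<Longrightarrow> (\<Sum>j<n. norm (B i j x)) \<le> b"
    using coefficient_bound[of ?K n B] cB by (metis compact_segment)
  define D where "D = (\<lambda>i x. Y i x - Z i x)"
  have D': "ode_sol n B T D"
    using Y Z unfolding ode_sol_def D_def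
    by (auto intro!: derivative_eq_intros simp: algebra_simps sum_subtractf)
  have cD: "continuous_on ?K (D j)" if "j < n" for j
    using ode_sol_holomorphic[OF D' \<open>open T\<close> that] K holomorphic_on_imp_continuous_on continuous_on_subset by blast
  \<comment> \<open>\<open>coefficient_bound\<close> is applied to the matrix whose rows are all
    equal to \<open>D\<close>; this bounds the vector \<open>D\<close>.\<close>
  obtain C where C: "\<And>i y. i < n \<Longrightarrow> y \<in> ?K \<Longrightarrow> (\<Sum>j<n. norm (D j y)) \<le> C"
    using coefficient_bound[of ?K n "\<lambda>i. D"] cD by (metis compact_segment)
  have le: "norm (D i x) \<le> C * (b * norm (x - a)) ^ m / fact m" for m
  proof (rule picard_bound[where E = "\<lambda>m. D" and K = ?K and n = n and B = B])
    fix j y assume j: "j < n" "y \<in> ?K"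
    have "norm (D j y) \<le> (\<Sum>j<n. norm (D j y))" using j by (intro member_le_sum) auto
    thus "norm (D j y) \<le> C" using C[OF j] by simp
    show "(D j has_field_derivative (\<Sum>k<n. B j k y * D k y)) (at y)"
      using D' j K by (auto simp: ode_sol_def)
  qed (use i eq b K in \<open>auto simp: D_def closed_segment_subset\<close>)
  have "(\<lambda>m. C * ((b * norm (x - a)) ^ m / fact m)) \<longlonglongrightarrow> C * 0"
    using summable_LIMSEQ_zero[OF summable_exp_generic[of "b * norm (x - a)"]]
    by (intro tendsto_intros) (simp add: divide_inverse mult.commute)
  hence "norm (D i x) \<le> 0"
    using le by (intro LIMSEQ_le_const) auto
  thus ?thesis by (simp add: D_def)
qed

text \<open>For a linear system, Picard iteration converges on the whole star-shaped domain, where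
  every holomorphic function has a primitive. \<open>E\<close> consists of the increments, so the
  solution is their sum.\<close>

lemma ode_sol_exists:
  fixes v :: "nat \<Rightarrow> complex"
  assumes "open T" "a \<in> T" and star: "\<And>z. z \<in> T \<Longrightarrow> closed_segment a z \<subseteq> T"
    and B: "\<And>i j. i < n \<Longrightarrow> j < n \<Longrightarrow> B i j holomorphic_on T"
  obtains Y where "ode_sol n B T Y" "\<And>i. i < n \<Longrightarrow> Y i a = v i"
proof -
  have ex: "\<exists>g. g a = 0 \<and> (\<forall>x\<in>T. (g has_field_derivative f x) (at x))" if "f holomorphic_on T" for f
  proof -
    have "\<exists>g. \<forall>x\<in>T. (g has_field_derivative f x) (at x)"
      using that assms
      by (intro holomorphic_starlike_primitive[where k = "{}"])
        (auto simp: starlike_def holomorphic_on_imp_continuous_on holomorphic_on_imp_differentiable_at)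
    then obtain g where "\<forall>x\<in>T. (g has_field_derivative f x) (at x)" ..
    thus ?thesis by (intro exI[of _ "\<lambda>x. g x - g a"]) (auto intro!: derivative_eq_intros)
  qed
  define P where "P = (\<lambda>f. SOME g. g a = 0 \<and> (\<forall>x\<in>T. (g has_field_derivative f x) (at x)))"
  have P: "P f a = 0" "x \<in> T \<Longrightarrow> (P f has_field_derivative f x) (at x)" if "f holomorphic_on T" for f x
    using someI_ex[OF ex[OF that]] unfolding P_def by auto
  define E where "E = rec_nat (\<lambda>i x. v i) (\<lambda>m e i. P (\<lambda>x. \<Sum>j<n. B i j x * e j x))"
  have E_0: "E 0 i x = v i" and E_Suc: "E (Suc m) i = P (\<lambda>x. \<Sum>j<n. B i j x * E m j x)" for i x m
    by (auto simp: E_def)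
  have hol: "E m i holomorphic_on T" if "i < n" for m i
    using that
  proof (induction m arbitrary: i)
    case 0 thus ?case by (simp add: E_def)
  next
    case (Suc m)
    have "(\<lambda>x. \<Sum>j<n. B i j x * E m j x) holomorphic_on T"
      using Suc B by (intro holomorphic_intros) auto
    from P(2)[OF this] show ?case using \<open>open T\<close> by (auto simp: E_Suc holomorphic_on_open)
  qed
  have rh: "(\<lambda>x. \<Sum>j<n. B i j x * E m j x) holomorphic_on T" if "i < n" for i m
    using that hol B by (intro holomorphic_intros) auto
  have Ed: "(E (Suc m) i has_field_derivative (\<Sum>j<n. B i j x * E m j x)) (at x)"
    and Ea: "E (Suc m) i a = 0" if "i < n" "x \<in> T" for m i x
    using P[OF rh[OF that(1)]] that(2) by (auto simp: E_Suc)
  \<comment> \<open>Differentiating the series needs uniform convergence only on some disc about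
    each \<open>z\<close>. The bounds hold on a compact convex neighbourhood \<open>K\<close> of the
    segment from \<open>a\<close> to \<open>z\<close>, which contains such a disc.\<close>
  have unif: "\<exists>d>0. cball z d \<subseteq> T \<and> (\<forall>i<n. uniform_limit (cball z d) (\<lambda>k x. \<Sum>m<k. E m i x) (\<lambda>x. suminf (\<lambda>m. E m i x)) sequentially)
     \<and> (\<forall>i<n. \<forall>x\<in>cball z d. summable (\<lambda>m. E m i x))"
    if z: "z \<in> T" for z
  proof -
    obtain e where e: "e > 0" "(\<Union>x\<in>closed_segment a z. cball x e) \<subseteq> T"
      "compact (\<Union>x\<in>closed_segment a z. cball x e)" "convex (\<Union>x\<in>closed_segment a z. cball x e)"
      using segment_nbhd[OF \<open>open T\<close> star[OF z]] by metis
    define K where "K = (\<Union>x\<in>closed_segment a z. cball x e)"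
    have aK: "a \<in> K" and zK: "cball z e \<subseteq> K" using \<open>e > 0\<close> by (auto simp: K_def intro: bexI[of _ a] bexI[of _ z])
    have sK: "closed_segment a x \<subseteq> K" if "x \<in> K" for x
      using that aK e(4) by (simp add: K_def closed_segment_subset)
    have KT: "K \<subseteq> T" using e by (simp add: K_def)
    have cB: "\<And>i j. i < n \<Longrightarrow> j < n \<Longrightarrow> continuous_on K (B i j)"
      using B KT holomorphic_on_imp_continuous_on continuous_on_subset by blast
    obtain b where b: "b \<ge> 0" "\<And>i x. i < n \<Longrightarrow> x \<in> K \<Longrightarrow> (\<Sum>j<n. norm (B i j x)) \<le> b"
      using coefficient_bound[of K n B] cB e(3) K_def by metis
    obtain R where R': "R > 0" "K \<subseteq> ball a R"
      using bounded_subset_ballD[OF compact_imp_bounded[OF e(3)]] unfolding K_def by blast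
    hence R: "norm (x - a) \<le> R" if "x \<in> K" for x
      using that by (force simp: dist_norm norm_minus_commute)
    define C where "C = (\<Sum>i<n. norm (v i))"
    have C: "norm (v i) \<le> C" if "i < n" for i using that unfolding C_def by (intro member_le_sum) auto
    have le: "norm (E m i x) \<le> C * ((b * R) ^ m / fact m)" if "i < n" "x \<in> K" for m i x
    proof -
      have "norm (E m i x) \<le> C * (b * norm (x - a)) ^ m / fact m"
        by (rule picard_bound[where K = K and n = n and B = B])
          (use that C b sK KT Ed Ea \<open>a \<in> T\<close> in \<open>auto simp: E_0\<close>)
      also have "\<dots> \<le> C * (b * R) ^ m / fact m"
        using R[OF that(2)] R'(1) b(1) C[OF that(1)]
        by (intro divide_right_mono mult_left_mono power_mono) (auto intro: order_trans[OF norm_ge_zero])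
      finally show ?thesis by simp
    qed
    have s: "summable (\<lambda>m. C * ((b * R) ^ m / fact m))"
      using summable_exp_generic[of "b * R"] by (intro summable_mult) (simp add: divide_inverse mult.commute)
    show ?thesis
    proof (intro exI[of _ e] conjI allI impI ballI)
      show "uniform_limit (cball z e) (\<lambda>k x. \<Sum>m<k. E m i x) (\<lambda>x. suminf (\<lambda>m. E m i x)) sequentially" if "i < n" for i
        using le[OF that] zK by (intro Weierstrass_m_test[OF _ s]) blast
      show "summable (\<lambda>m. E m i x)" if "i < n" "x \<in> cball z e" for i x
        using le[OF that(1)] zK that(2) by (intro summable_comparison_test[OF _ s]) blast
    qed (use e zK KT in auto)
  qed
  define Y where "Y = (\<lambda>i x. suminf (\<lambda>m. E m i x))"
  have "ode_sol n B T Y"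
    unfolding ode_sol_def
  proof safe
    fix i x assume i: "i < n" "x \<in> T"
    \<comment> \<open>The term-by-term derivative: the first increment is constant and contributes
      0, each later one contributes the matrix applied to its predecessor. Hence the shift by one in
      the limit below.\<close>
    define F where "F = (\<lambda>k x. \<Sum>m<k. case m of 0 \<Rightarrow> 0 | Suc l \<Rightarrow> \<Sum>j<n. B i j x * E l j x)"
    have "\<exists>g'. \<forall>x\<in>T. (Y i has_field_derivative g' x) (at x) \<and> ((\<lambda>k. F k x) \<longlonglongrightarrow> g' x)"
    proof (rule has_complex_derivative_uniform_sequence[OF \<open>open T\<close>, where f = "\<lambda>k x. \<Sum>m<k. E m i x"])
      show "((\<lambda>x. \<Sum>m<k. E m i x) has_field_derivative F k x) (at x)" if "x \<in> T" for k x
        unfolding F_def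
      proof (rule DERIV_sum)
        fix m show "(E m i has_field_derivative (case m of 0 \<Rightarrow> 0 | Suc l \<Rightarrow> \<Sum>j<n. B i j x * E l j x)) (at x)"
          using Ed[OF i(1) that] by (cases m) (auto simp: E_def)
      qed
      show "\<exists>d>0. cball z d \<subseteq> T \<and> uniform_limit (cball z d) (\<lambda>k x. \<Sum>m<k. E m i x) (Y i) sequentially"
        if "z \<in> T" for z using unif[OF that] i(1) unfolding Y_def by blast
    qed
    then obtain g' where g': "(Y i has_field_derivative g' x) (at x)" "(\<lambda>k. F k x) \<longlonglongrightarrow> g' x"
      using i by blast
    have "(\<lambda>k. F (Suc k) x) = (\<lambda>k. \<Sum>j<n. B i j x * (\<Sum>m<k. E m j x))"
      unfolding F_def sum.lessThan_Suc_shift by (simp add: sum_distrib_left sum.swap[of _ "{..<n}"])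
    moreover have "(\<lambda>k. \<Sum>j<n. B i j x * (\<Sum>m<k. E m j x)) \<longlonglongrightarrow> (\<Sum>j<n. B i j x * Y j x)"
      unfolding Y_def using unif[OF i(2)]
      by (intro tendsto_intros summable_LIMSEQ) force
    ultimately have "g' x = (\<Sum>j<n. B i j x * Y j x)"
      using LIMSEQ_Suc[OF g'(2)] LIMSEQ_unique by metis
    thus "(Y i has_field_derivative (\<Sum>j<n. B i j x * Y j x)) (at x)" using g' by simp
  qed
  moreover have "Y i a = v i" if "i < n" for i
  proof -
    have "(\<lambda>m. E m i a) = (\<lambda>m. if m = 0 then v i else 0)"
      using Ea[OF that \<open>a \<in> T\<close>] by (auto simp: E_0 fun_eq_iff gr0_conv_Suc)
    thus ?thesis unfolding Y_def using sums_unique[OF sums_single[of 0 "\<lambda>m. v i"]] by simp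
  qed
  ultimately show ?thesis by (rule that)
qed

section \<open>Analytic continuation on a slit plane\<close>

text \<open>By \<open>generic\<close>, no two points of \<open>Sing\<close> lie on the same ray from
  the base point \<open>c\<close>. So the slits, which run from each \<open>s\<close> to infinity
  away from \<open>c\<close>, are disjoint, and each can be crossed without meeting another.\<close>

locale slit_plane =
  fixes Sing :: "complex set" and c :: complex
  assumes finite_Sing: "finite Sing" and c_notin: "c \<notin> Sing"
    and generic: "\<And>s s' r. s \<in> Sing \<Longrightarrow> s' \<in> Sing \<Longrightarrow> r > 0 \<Longrightarrow>
      s' - c = of_real r * (s - c) \<Longrightarrow> s' = s"
begin

definition ray :: "complex \<Rightarrow> complex set" where
  "ray s = {x. Im ((x - c) / (s - c)) = 0 \<and> Re ((x - c) / (s - c)) \<ge> 1}"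

text \<open>A subset of \<open>Sing\<close> is allowed as argument because a solution that is
  regular at \<open>s\<close> lives on \<open>slit (Sing - {s})\<close>.\<close>

definition slit :: "complex set \<Rightarrow> complex set" where
  "slit A = - (\<Union>s\<in>A. ray s)"

abbreviation \<Omega> :: "complex set" where "\<Omega> \<equiv> slit Sing"

lemma in_rayE:
  assumes "x \<in> ray s" "s \<in> Sing"
  obtains r where "r \<ge> 1" "x - c = of_real r * (s - c)"
proof (rule that[of "Re ((x - c) / (s - c))"])
  have "(x - c) / (s - c) = of_real (Re ((x - c) / (s - c)))"
    using assms by (auto simp: ray_def complex_eq_iff)
  thus "x - c = of_real (Re ((x - c) / (s - c))) * (s - c)"
    using assms c_notin by (metis eq_iff_diff_eq_0 nonzero_eq_divide_eq)
qed (use assms in \<open>auto simp: ray_def\<close>)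

lemma in_rayI:
  assumes "r \<ge> 1" "x - c = of_real r * (s - c)" "s \<in> Sing"
  shows "x \<in> ray s"
proof -
  have "s - c \<noteq> 0" using assms c_notin by auto
  thus ?thesis unfolding ray_def using assms by simp
qed

lemma ray_disjoint: "s \<in> Sing \<Longrightarrow> s' \<in> Sing \<Longrightarrow> x \<in> ray s \<Longrightarrow> x \<in> ray s' \<Longrightarrow> s = s'"
proof -
  assume s: "s \<in> Sing" "s' \<in> Sing" "x \<in> ray s" "x \<in> ray s'"
  from s obtain r where r: "r \<ge> 1" "x - c = of_real r * (s - c)" by (auto elim: in_rayE)
  from s obtain r' where r': "r' \<ge> 1" "x - c = of_real r' * (s' - c)" by (auto elim: in_rayE)
  have "s' - c = of_real (r / r') * (s - c)"
    using r r' by (simp add: field_simps)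
  thus "s = s'" using generic[OF s(1,2), of "r / r'"] r r' by auto
qed

lemma in_own_ray: "s \<in> Sing \<Longrightarrow> s \<in> ray s"
  by (rule in_rayI[of 1]) auto

lemma closed_ray: "s \<in> Sing \<Longrightarrow> closed (ray s)"
proof -
  assume "s \<in> Sing"
  hence "s \<noteq> c" using c_notin by auto
  have "ray s = {x. Im ((x - c) / (s - c)) = 0} \<inter> {x. 1 \<le> Re ((x - c) / (s - c))}"
    by (auto simp: ray_def)
  thus ?thesis
    using \<open>s \<noteq> c\<close> by (auto intro!: closed_Int closed_Collect_eq closed_Collect_le continuous_intros)
qed

lemma open_slit: "A \<subseteq> Sing \<Longrightarrow> open (slit A)"
  unfolding slit_def using finite_Sing closed_ray
  by (intro open_Compl closed_UN) (auto intro: finite_subset)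

lemma c_in_slit: "A \<subseteq> Sing \<Longrightarrow> c \<in> slit A"
  by (auto simp: slit_def ray_def)

lemma slit_star: "A \<subseteq> Sing \<Longrightarrow> z \<in> slit A \<Longrightarrow> closed_segment c z \<subseteq> slit A"
proof
  fix w assume A: "A \<subseteq> Sing" "z \<in> slit A" "w \<in> closed_segment c z"
  then obtain u where u: "0 \<le> u" "u \<le> 1" "w - c = of_real u * (z - c)"
    by (auto simp: in_segment scaleR_conv_of_real algebra_simps)
  show "w \<in> slit A"
  proof (rule ccontr)
    assume "w \<notin> slit A"
    then obtain s where s: "s \<in> A" "w \<in> ray s" by (auto simp: slit_def)
    then obtain r where r: "r \<ge> 1" "w - c = of_real r * (s - c)" using A by (auto elim: in_rayE)
    have "u \<noteq> 0" using u r s A c_notin by auto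
    hence "z - c = of_real (r / u) * (s - c)" using u r by (simp add: field_simps)
    moreover have "r / u \<ge> 1" using u r \<open>u \<noteq> 0\<close> by (simp add: field_simps)
    ultimately have "z \<in> ray s" using s A by (intro in_rayI) auto
    thus False using A s by (auto simp: slit_def)
  qed
qed

lemma slit_subset_Compl: "A \<subseteq> Sing \<Longrightarrow> slit A \<subseteq> - A"
  using in_own_ray by (auto simp: slit_def)

lemma slit_antimono: "A \<subseteq> B \<Longrightarrow> slit B \<subseteq> slit A"
  by (auto simp: slit_def)

lemma connected_slit: "A \<subseteq> Sing \<Longrightarrow> connected (slit A)"
  by (intro starlike_imp_connected) (metis slit_star c_in_slit starlike_def)

lemma open_\<Omega>: "open \<Omega>" and c_in_\<Omega>: "c \<in> \<Omega>" and connected_\<Omega>: "connected \<Omega>"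
  by (auto intro: open_slit c_in_slit connected_slit)

text \<open>A disc \<open>disc s\<close> centred beyond \<open>s\<close> on its ray; the ray cuts it into \<open>half 1 s\<close> and
  \<open>half (-1) s\<close>.\<close>

definition centre :: "complex \<Rightarrow> complex" where
  "centre s = c + 2 * (s - c)"

text \<open>The bound by \<open>norm (s - c)\<close> keeps the disc strictly beyond \<open>s\<close>
  (this is \<open>disc_Re\<close>); the inclusion keeps it off the other slits.\<close>

definition radius :: "complex \<Rightarrow> real" where
  "radius s = (SOME e. e > 0 \<and> e \<le> norm (s - c) \<and> ball (centre s) e \<subseteq> slit (Sing - {s}))"

definition disc :: "complex \<Rightarrow> complex set" where
  "disc s = ball (centre s) (radius s)"

definition half :: "real \<Rightarrow> complex \<Rightarrow> complex set" where
  "half b s = {x \<in> disc s. b * Im ((x - c) / (s - c)) > 0}"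

lemma radius:
  assumes "s \<in> Sing"
  shows "radius s > 0" "radius s \<le> norm (s - c)" "disc s \<subseteq> slit (Sing - {s})"
proof -
  have "centre s \<in> ray s" using assms by (intro in_rayI[of 2]) (auto simp: centre_def)
  hence "centre s \<in> slit (Sing - {s})"
    using ray_disjoint assms by (auto simp: slit_def)
  then obtain e where e: "e > 0" "ball (centre s) e \<subseteq> slit (Sing - {s})"
    using open_slit[of "Sing - {s}"] openE by blast
  have "s \<noteq> c" using assms c_notin by auto
  hence "\<exists>e. e > 0 \<and> e \<le> norm (s - c) \<and> ball (centre s) e \<subseteq> slit (Sing - {s})"
    using e by (intro exI[of _ "min e (norm (s - c))"]) auto
  from someI_ex[OF this] show "radius s > 0" "radius s \<le> norm (s - c)" "disc s \<subseteq> slit (Sing - {s})"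
    by (auto simp: radius_def disc_def)
qed

lemma disc_Int_\<Omega>:
  assumes "s \<in> Sing" "x \<in> disc s" "Im ((x - c) / (s - c)) \<noteq> 0"
  shows "x \<in> \<Omega>"
  using radius(3)[OF assms(1)] assms by (auto simp: slit_def ray_def)

lemma half_subset: "half b s \<subseteq> disc s"
  by (auto simp: half_def)

lemma half_subset_\<Omega>: "s \<in> Sing \<Longrightarrow> half b s \<subseteq> \<Omega>"
  using disc_Int_\<Omega> by (force simp: half_def)

lemma disc_Re:
  assumes "s \<in> Sing" "x \<in> disc s"
  shows "Re ((x - c) / (s - c)) > 1"
proof -
  have "s \<noteq> c" using assms c_notin by auto
  have "norm (x - centre s) < norm (s - c)"
    using assms radius(2)[OF assms(1)] by (auto simp: disc_def dist_norm norm_minus_commute)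
  moreover have "(x - c) / (s - c) - 2 = (x - centre s) / (s - c)"
    using \<open>s \<noteq> c\<close> by (simp add: centre_def field_simps)
  ultimately have "norm ((x - c) / (s - c) - 2) < 1"
    using \<open>s \<noteq> c\<close> by (simp add: norm_divide)
  hence "\<bar>Re ((x - c) / (s - c) - 2)\<bar> < 1"
    using abs_Re_le_cmod le_less_trans by blast
  thus ?thesis by simp
qed

lemma disc_Int_Sing: "s \<in> Sing \<Longrightarrow> disc s \<subseteq> - Sing"
proof
  fix x assume "s \<in> Sing" "x \<in> disc s"
  show "x \<in> - Sing"
  proof
    assume "x \<in> Sing"
    show False
    proof (cases "x = s")
      case True
      have "s \<noteq> c" using \<open>s \<in> Sing\<close> c_notin by auto
      thus False using disc_Re[OF \<open>s \<in> Sing\<close> \<open>x \<in> disc s\<close>] True by simp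
    next
      case False
      thus False using radius(3)[OF \<open>s \<in> Sing\<close>] \<open>x \<in> disc s\<close> in_own_ray[OF \<open>x \<in> Sing\<close>] \<open>x \<in> Sing\<close>
        by (auto simp: slit_def)
    qed
  qed
qed

lemma open_disc: "open (disc s)" and convex_disc: "convex (disc s)"
  by (auto simp: disc_def)

lemma open_half: "s \<in> Sing \<Longrightarrow> open (half b s)"
proof -
  assume "s \<in> Sing"
  hence "s \<noteq> c" using c_notin by auto
  have "half b s = disc s \<inter> {x. 0 < b * Im ((x - c) / (s - c))}" by (auto simp: half_def)
  thus ?thesis
    using \<open>s \<noteq> c\<close> open_disc by (auto intro!: open_Int open_Collect_less continuous_intros)
qed

lemma Im_of_real_mult: "Im (of_real u * z) = u * Im z"
  by simp

lemma convex_half: "convex (half b s)"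
proof -
  have "half b s = disc s \<inter> {x. 0 < b * Im ((x - c) / (s - c))}" by (auto simp: half_def)
  moreover have "convex {x. 0 < b * Im ((x - c) / (s - c))}"
  proof (rule convexI)
    fix x y :: complex and u v :: real
    assume xy: "x \<in> {x. 0 < b * Im ((x - c) / (s - c))}" "y \<in> {x. 0 < b * Im ((x - c) / (s - c))}"
      and uv: "0 \<le> u" "0 \<le> v" "u + v = 1"
    have "u *\<^sub>R x + v *\<^sub>R y - c = of_real u * (x - c) + of_real v * (y - c)"
      using uv by (auto simp: scaleR_conv_of_real algebra_simps simp flip: of_real_add distrib_left)
    hence "(u *\<^sub>R x + v *\<^sub>R y - c) / (s - c) = of_real u * ((x - c) / (s - c)) + of_real v * ((y - c) / (s - c))"
      by (simp add: add_divide_distrib)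
    hence eq: "b * Im ((u *\<^sub>R x + v *\<^sub>R y - c) / (s - c)) = u * (b * Im ((x - c) / (s - c))) + v * (b * Im ((y - c) / (s - c)))"
      by (simp only: plus_complex.sel Im_of_real_mult) (simp only: algebra_simps)
    have "\<dots> > 0"
    proof (cases "u = 0")
      case True thus ?thesis using xy uv by auto
    next
      case False thus ?thesis using xy uv by (intro add_pos_nonneg) auto
    qed
    thus "u *\<^sub>R x + v *\<^sub>R y \<in> {x. 0 < b * Im ((x - c) / (s - c))}" using eq by simp
  qed
  ultimately show ?thesis using convex_disc by (simp add: convex_Int)
qed

lemma half_nonempty:
  assumes "s \<in> Sing" "b \<in> {1, -1}"
  obtains q where "q \<in> half b s"
proof -
  have sc: "s - c \<noteq> 0" using assms c_notin by auto
  define e where "e = radius s / (2 * norm (s - c))"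
  have e: "e > 0" using radius[OF assms(1)] sc by (auto simp: e_def)
  define q where "q = centre s + of_real (b * e) * \<i> * (s - c)"
  have "dist (centre s) q = e * norm (s - c)"
    using e assms by (auto simp: q_def dist_norm norm_mult)
  also have "\<dots> < radius s" using radius[OF assms(1)] sc by (auto simp: e_def)
  finally have "q \<in> disc s" by (auto simp: disc_def)
  moreover have "(q - c) / (s - c) = 2 + of_real (b * e) * \<i>"
    using sc by (simp add: q_def centre_def field_simps)
  ultimately have "q \<in> half b s" using e assms(2) by (auto simp: half_def)
  thus ?thesis by (rule that)
qed

text \<open>\<open>cross b s f g\<close> says that \<open>g\<close> is the continuation of \<open>f\<close> across the ray of \<open>s\<close>, beyond \<open>s\<close>,
  in the direction from \<open>half (- b) s\<close> to \<open>half b s\<close>.\<close>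

definition cross :: "real \<Rightarrow> complex \<Rightarrow> (complex \<Rightarrow> complex) \<Rightarrow> (complex \<Rightarrow> complex) \<Rightarrow> bool" where
  "cross b s f g \<longleftrightarrow> (\<exists>h. h holomorphic_on disc s \<and> (\<forall>x\<in>half (-b) s. h x = f x) \<and> (\<forall>x\<in>half b s. h x = g x))"

lemma cross_sym: "cross b s f g \<longleftrightarrow> cross (-b) s g f"
  by (auto simp: cross_def)

text \<open>Solving the system in the disc, with the values of \<open>Y\<close> at a point of one
  half, continues \<open>Y\<close> across the slit. On the other half the local solution is the
  restriction of a solution on \<open>\<Omega>\<close>, because a solution is determined by its
  values at one point.\<close>

lemma ode_cross:
  assumes A: "A \<subseteq> Sing" and B: "\<And>i j. i < n \<Longrightarrow> j < n \<Longrightarrow> B i j holomorphic_on - A"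
    and Y: "ode_sol n B \<Omega> Y" and s: "s \<in> Sing" and b: "b \<in> {1, -1}"
  obtains Z where "ode_sol n B \<Omega> Z" "\<And>i. i < n \<Longrightarrow> cross b s (Y i) (Z i)"
proof -
  have hB: "B i j holomorphic_on T" if "i < n" "j < n" "T \<subseteq> - A" for i j T
    using B that holomorphic_on_subset by blast
  have \<Omega>A: "\<Omega> \<subseteq> - A" using slit_subset_Compl A by blast
  have dA: "disc s \<subseteq> - A" using disc_Int_Sing[OF s] A by blast
  have hA: "half b s \<subseteq> -A" for b using dA half_subset by blast
  obtain q where q: "q \<in> half (-b) s" using half_nonempty[OF s, of "-b"] b by auto
  obtain q' where q': "q' \<in> half b s" using half_nonempty[OF s b] by auto
  obtain h where h: "ode_sol n B (disc s) h" "\<And>i. i < n \<Longrightarrow> h i q = Y i q"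
    using ode_sol_exists[of "disc s" q n B "\<lambda>i. Y i q"] open_disc convex_disc q half_subset hB[OF _ _ dA]
    by (metis closed_segment_subset in_mono)
  have hY: "h i x = Y i x" if "i < n" "x \<in> half (-b) s" for i x
  proof (rule ode_sol_unique[of "half (-b) s" q n B h Y])
    show "closed_segment q z \<subseteq> half (-b) s" if "z \<in> half (-b) s" for z
      using q that convex_half by (simp add: closed_segment_subset)
  qed (use h q open_half[OF s] hB[OF _ _ hA] that ode_sol_subset[OF h(1) half_subset]
         ode_sol_subset[OF Y half_subset_\<Omega>[OF s]] in auto)
  have q'\<Omega>: "q' \<in> \<Omega>" using q' half_subset_\<Omega>[OF s] by auto
  \<comment> \<open>Existence on \<open>\<Omega>\<close> takes its initial values at the star centre
    \<open>c\<close>, so the values at \<open>q'\<close> are carried to \<open>c\<close> inside a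
    convex neighbourhood \<open>T\<close> of the segment.\<close>
  obtain e where e: "e > 0" "(\<Union>x\<in>closed_segment c q'. cball x e) \<subseteq> \<Omega>" "convex (\<Union>x\<in>closed_segment c q'. ball x e)"
    using segment_nbhd[OF open_\<Omega> slit_star[OF order_refl q'\<Omega>]] by metis
  define T where "T = (\<Union>x\<in>closed_segment c q'. ball x e)"
  have T: "open T" "convex T" "c \<in> T" "q' \<in> T" using e by (auto simp: T_def intro: bexI[of _ c] bexI[of _ q'])
  have T\<Omega>: "T \<subseteq> \<Omega>" using e(2) by (force simp: T_def)
  hence TA: "T \<subseteq> - A" using \<Omega>A by auto
  obtain y where y: "ode_sol n B T y" "\<And>i. i < n \<Longrightarrow> y i q' = h i q'"
    using ode_sol_exists[of T q' n B "\<lambda>i. h i q'"] T hB[OF _ _ TA] by (metis closed_segment_subset)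
  obtain Z where Z: "ode_sol n B \<Omega> Z" "\<And>i. i < n \<Longrightarrow> Z i c = y i c"
    using ode_sol_exists[of \<Omega> c n B "\<lambda>i. y i c"] open_\<Omega> c_in_\<Omega> slit_star[OF order_refl] hB[OF _ _ \<Omega>A] by metis
  have "Z i q' = y i q'" if "i < n" for i
    by (rule ode_sol_unique[of T c n B Z y])
      (use T y Z hB[OF _ _ TA] that ode_sol_subset[OF Z(1) T\<Omega>] closed_segment_subset[OF T(3) _ T(2)] in auto)
  hence Zq': "Z i q' = h i q'" if "i < n" for i using y that by simp
  have hZ: "h i x = Z i x" if "i < n" "x \<in> half b s" for i x
  proof (rule ode_sol_unique[of "half b s" q' n B h Z])
    show "closed_segment q' z \<subseteq> half b s" if "z \<in> half b s" for z
      using q' that convex_half by (simp add: closed_segment_subset)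
  qed (use Zq' q' open_half[OF s] hB[OF _ _ hA] that ode_sol_subset[OF h(1) half_subset]
         ode_sol_subset[OF Z(1) half_subset_\<Omega>[OF s]] in auto)
  show ?thesis
  proof (rule that[OF Z(1)])
    show "cross b s (Y i) (Z i)" if "i < n" for i
      unfolding cross_def
      using hY hZ that ode_sol_holomorphic[OF h(1) open_disc that] by blast
  qed
qed

text \<open>If \<open>s\<close> is no pole of the system, the solutions extend over the slit of
  \<open>s\<close>, because \<open>slit (Sing - {s})\<close> is star-shaped about \<open>c\<close>
  as well.\<close>

lemma ode_cross_trivial:
  assumes A: "A \<subseteq> Sing" and B: "\<And>i j. i < n \<Longrightarrow> j < n \<Longrightarrow> B i j holomorphic_on - A"
    and Y: "ode_sol n B \<Omega> Y" and s: "s \<in> Sing" "s \<notin> A" and i: "i < n"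
  shows "cross b s (Y i) (Y i)"
proof -
  let ?T = "slit (Sing - {s})"
  have TA: "?T \<subseteq> - A" using slit_subset_Compl[of "Sing - {s}"] s A by blast
  have \<Omega>T: "\<Omega> \<subseteq> ?T" by (rule slit_antimono) auto
  have hB: "B i j holomorphic_on T" if "i < n" "j < n" "T \<subseteq> - A" for i j T
    using B that holomorphic_on_subset by blast
  obtain h where h: "ode_sol n B ?T h" "\<And>i. i < n \<Longrightarrow> h i c = Y i c"
    using ode_sol_exists[of ?T c n B "\<lambda>i. Y i c"] open_slit c_in_slit slit_star[of "Sing - {s}"] hB[OF _ _ TA]
    by (metis Diff_subset)
  have "h i x = Y i x" if "i < n" "x \<in> \<Omega>" for i x
    by (rule ode_sol_unique[of \<Omega> c n B h Y])
      (use open_\<Omega> c_in_\<Omega> h Y that slit_star[OF order_refl] hB \<Omega>T TA in \<open>auto intro: ode_sol_subset[OF h(1)]\<close>)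
  moreover have "h i holomorphic_on disc s"
    using ode_sol_holomorphic[OF h(1) open_slit i] radius(3)[OF s(1)] holomorphic_on_subset by blast
  ultimately show ?thesis
    unfolding cross_def using i half_subset_\<Omega>[OF s(1)] by blast
qed

lemma ode_extend:
  assumes A: "A \<subseteq> Sing" and B: "\<And>i j. i < n \<Longrightarrow> j < n \<Longrightarrow> B i j holomorphic_on - A"
    and y: "ode_sol n B (ball c r) y" and r: "r > 0" "ball c r \<subseteq> \<Omega>"
  obtains Y where "ode_sol n B \<Omega> Y" "\<And>i x. i < n \<Longrightarrow> x \<in> ball c r \<Longrightarrow> Y i x = y i x"
proof -
  have hB: "B i j holomorphic_on T" if "i < n" "j < n" "T \<subseteq> \<Omega>" for i j T
    using B that holomorphic_on_subset slit_subset_Compl[of Sing] A by (metis Compl_anti_mono order_refl subset_trans)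
  obtain Y where Y: "ode_sol n B \<Omega> Y" "\<And>i. i < n \<Longrightarrow> Y i c = y i c"
    using ode_sol_exists[of \<Omega> c n B "\<lambda>i. y i c"] open_\<Omega> c_in_\<Omega> slit_star[OF order_refl] hB by (metis order_refl)
  have "Y i x = y i x" if "i < n" "x \<in> ball c r" for i x
    by (rule ode_sol_unique[of "ball c r" c n B Y y])
      (use r y Y that hB ode_sol_subset[OF Y(1) r(2)] in
        \<open>auto simp del: mem_ball dest: closed_segment_subset[OF centre_in_ball[THEN iffD2, OF r(1)] _ convex_ball, THEN subsetD]\<close>)
  thus ?thesis using Y that by blast
qed

text \<open>Values outside \<open>\<Omega>\<close> are normalised to 0, so that branches which agree
  on \<open>\<Omega>\<close> are equal as functions and continuation can be a map on
  functions.\<close>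

definition holo :: "(complex \<Rightarrow> complex) set" where
  "holo = {f. f holomorphic_on \<Omega> \<and> (\<forall>x. x \<notin> \<Omega> \<longrightarrow> f x = 0)}"

definition res :: "(complex \<Rightarrow> complex) \<Rightarrow> complex \<Rightarrow> complex" where
  "res f = (\<lambda>x. if x \<in> \<Omega> then f x else 0)"

lemma res_in_holo: "f holomorphic_on \<Omega> \<Longrightarrow> res f \<in> holo"
  by (auto simp: holo_def res_def intro: holomorphic_transform[of f])

lemma holo_add: "f \<in> holo \<Longrightarrow> g \<in> holo \<Longrightarrow> (\<lambda>x. f x + g x) \<in> holo"
  and holo_diff: "f \<in> holo \<Longrightarrow> g \<in> holo \<Longrightarrow> (\<lambda>x. f x - g x) \<in> holo"
  and holo_mult: "f \<in> holo \<Longrightarrow> g \<in> holo \<Longrightarrow> (\<lambda>x. f x * g x) \<in> holo"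
  by (auto simp: holo_def intro!: holomorphic_intros)

lemma holo_eqI:
  assumes "f \<in> holo" "g \<in> holo" "open U" "U \<noteq> {}" "U \<subseteq> \<Omega>" "\<And>x. x \<in> U \<Longrightarrow> f x = g x"
  shows "f = g"
proof
  fix x
  show "f x = g x"
  proof (cases "x \<in> \<Omega>")
    case True
    show ?thesis
      by (rule analytic_continuation_open[of U \<Omega>])
        (use assms True open_\<Omega> connected_\<Omega> in \<open>auto simp: holo_def\<close>)
  qed (use assms in \<open>auto simp: holo_def\<close>)
qed

text \<open>The identity theorem, first on the disc and then on the connected set
  \<open>\<Omega>\<close>.\<close>

lemma cross_unique:
  assumes s: "s \<in> Sing" and b: "b \<in> {1, -1}" and g: "g \<in> holo" "g' \<in> holo"
    and c: "cross b s f g" "cross b s f g'"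
  shows "g = g'"
proof -
  obtain h where h: "h holomorphic_on disc s" "\<forall>x\<in>half (-b) s. h x = f x" "\<forall>x\<in>half b s. h x = g x"
    using c(1) by (auto simp: cross_def)
  obtain h' where h': "h' holomorphic_on disc s" "\<forall>x\<in>half (-b) s. h' x = f x" "\<forall>x\<in>half b s. h' x = g' x"
    using c(2) by (auto simp: cross_def)
  have ne: "half (-b) s \<noteq> {}" "half b s \<noteq> {}"
    using half_nonempty[OF s] b by (metis empty_iff insert_iff minus_minus)+
  have "h x = h' x" if "x \<in> disc s" for x
    by (rule analytic_continuation_open[of "half (-b) s" "disc s"])
      (use open_half[OF s] open_disc ne half_subset h h' convex_disc that in \<open>auto intro: convex_connected\<close>)
  hence "g x = g' x" if "x \<in> half b s" for x
    using h(3) h'(3) half_subset that by (metis subsetD)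
  thus ?thesis
    using holo_eqI[OF g open_half[OF s] ne(2) half_subset_\<Omega>[OF s]] by blast
qed

lemma cross_add: "cross b s f g \<Longrightarrow> cross b s f' g' \<Longrightarrow> cross b s (\<lambda>x. f x + f' x) (\<lambda>x. g x + g' x)"
  unfolding cross_def by safe (rule_tac x = "\<lambda>x. h x + ha x" in exI, auto intro!: holomorphic_intros)

lemma cross_mult: "cross b s f g \<Longrightarrow> cross b s f' g' \<Longrightarrow> cross b s (\<lambda>x. f x * f' x) (\<lambda>x. g x * g' x)"
  unfolding cross_def by safe (rule_tac x = "\<lambda>x. h x * ha x" in exI, auto intro!: holomorphic_intros)

definition slit_deriv :: "(complex \<Rightarrow> complex) \<Rightarrow> complex \<Rightarrow> complex" where
  "slit_deriv f = res (deriv f)"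

lemma slit_deriv_in_holo: "f \<in> holo \<Longrightarrow> slit_deriv f \<in> holo"
  unfolding slit_deriv_def by (intro res_in_holo holomorphic_deriv open_\<Omega>) (auto simp: holo_def)

lemma cross_slit_deriv:
  assumes "s \<in> Sing" "cross b s f g"
  shows "cross b s (slit_deriv f) (slit_deriv g)"
proof -
  obtain h where h: "h holomorphic_on disc s" "\<forall>x\<in>half (-b) s. h x = f x" "\<forall>x\<in>half b s. h x = g x"
    using assms by (auto simp: cross_def)
  have "deriv h x = deriv k x" if "\<forall>x\<in>half b s. h x = k x" "x \<in> half b s" for x k b
    by (rule deriv_cong_ev) (use that open_half[OF assms(1), of b] in \<open>auto simp: eventually_nhds\<close>)
  thus ?thesis
    unfolding cross_def using h half_subset_\<Omega>[OF assms(1)]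
    by (intro exI[of _ "deriv h"]) (auto simp: slit_deriv_def res_def open_disc subset_iff intro: holomorphic_deriv)
qed

lemma cross_res:
  assumes "s \<in> Sing" "R holomorphic_on - Sing"
  shows "cross b s (res R) (res R)"
  unfolding cross_def using half_subset_\<Omega>[OF assms(1)] disc_Int_Sing[OF assms(1)] assms(2)
  by (intro exI[of _ R]) (auto simp: res_def intro: holomorphic_on_subset)

lemma cross_cong:
  assumes "s \<in> Sing" "cross b s f g" "\<And>x. x \<in> \<Omega> \<Longrightarrow> f x = f' x" "\<And>x. x \<in> \<Omega> \<Longrightarrow> g x = g' x"
  shows "cross b s f' g'"
  using assms(2-4) half_subset_\<Omega>[OF assms(1)] unfolding cross_def by (metis in_mono)

lemma res_cross: "s \<in> Sing \<Longrightarrow> cross b s f g \<Longrightarrow> cross b s (res f) (res g)"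
  by (erule (1) cross_cong) (auto simp: res_def)

section \<open>Stable sets of branches and the automorphisms that act on them\<close>

definition stable :: "(complex \<Rightarrow> complex) set \<Rightarrow> bool" where
  "stable V \<longleftrightarrow> V \<subseteq> holo \<and> (\<forall>f\<in>V. \<forall>s\<in>Sing. \<forall>b\<in>{1, -1}. \<exists>g\<in>V. cross b s f g)"

text \<open>The largest stable set. Membership means that slits can be crossed successively in every
  order and direction, and is expressed without words or paths.\<close>

definition continuable :: "(complex \<Rightarrow> complex) set" where
  "continuable = \<Union>{V. stable V}"

lemma stable_continuable: "stable continuable"
  unfolding stable_def continuable_def by blast

lemma stable_subset_continuable: "stable V \<Longrightarrow> V \<subseteq> continuable"
  by (auto simp: continuable_def)

lemma continuable_holo: "f \<in> continuable \<Longrightarrow> f \<in> holo"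
  using stable_continuable by (auto simp: stable_def)

text \<open>The functions \<open>p f g\<close> with continuable \<open>f\<close> and
  \<open>g\<close> form a stable set.\<close>

lemma stable_binop:
  assumes "\<And>f g. f \<in> holo \<Longrightarrow> g \<in> holo \<Longrightarrow> p f g \<in> holo"
    and "\<And>b s f g f' g'. s \<in> Sing \<Longrightarrow> cross b s f g \<Longrightarrow> cross b s f' g' \<Longrightarrow> cross b s (p f f') (p g g')"
  shows "f \<in> continuable \<Longrightarrow> g \<in> continuable \<Longrightarrow> p f g \<in> continuable"
proof -
  assume fg: "f \<in> continuable" "g \<in> continuable"
  have "stable {p f g |f g. f \<in> continuable \<and> g \<in> continuable}"
    unfolding stable_def
  proof (intro conjI ballI subsetI)
    fix h assume "h \<in> {p f g |f g. f \<in> continuable \<and> g \<in> continuable}"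
    thus "h \<in> holo" using assms(1) continuable_holo by auto
  next
    fix h s and b :: real
    assume "h \<in> {p f g |f g. f \<in> continuable \<and> g \<in> continuable}" and s: "s \<in> Sing" and b: "b \<in> {1, -1}"
    then obtain f g where fg: "f \<in> continuable" "g \<in> continuable" "h = p f g" by auto
    then obtain f' g' where "f' \<in> continuable" "g' \<in> continuable" "cross b s f f'" "cross b s g g'"
      using stable_continuable s b unfolding stable_def by meson
    thus "\<exists>h'\<in>{p f g |f g. f \<in> continuable \<and> g \<in> continuable}. cross b s h h'"
      using assms(2)[OF s] fg(3) by blast
  qed
  thus ?thesis using fg stable_subset_continuable by blast
qed

lemma continuable_add: "f \<in> continuable \<Longrightarrow> g \<in> continuable \<Longrightarrow> (\<lambda>x. f x + g x) \<in> continuable"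
  by (rule stable_binop[of "\<lambda>f g x. f x + g x"]) (auto intro: holo_add cross_add)

lemma continuable_mult: "f \<in> continuable \<Longrightarrow> g \<in> continuable \<Longrightarrow> (\<lambda>x. f x * g x) \<in> continuable"
  by (rule stable_binop[of "\<lambda>f g x. f x * g x"]) (auto intro: holo_mult cross_mult)

lemma continuable_slit_deriv: "f \<in> continuable \<Longrightarrow> slit_deriv f \<in> continuable"
  by (rule stable_binop[of "\<lambda>f g. slit_deriv f" f f]) (auto intro: slit_deriv_in_holo cross_slit_deriv)

lemma continuable_res: "R holomorphic_on - Sing \<Longrightarrow> res R \<in> continuable"
proof -
  assume R: "R holomorphic_on - Sing"
  hence "R holomorphic_on \<Omega>"
    using slit_subset_Compl holomorphic_on_subset by blast
  hence "stable {res R}"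
    using cross_res R by (auto simp: stable_def res_in_holo)
  thus ?thesis using stable_subset_continuable by blast
qed

text \<open>One counterclockwise turn around \<open>s\<close>: from \<open>c\<close> to
  \<open>half (-1) s\<close>, across the slit, and from \<open>half 1 s\<close> back to
  \<open>c\<close>.\<close>

definition continuation :: "complex \<Rightarrow> (complex \<Rightarrow> complex) \<Rightarrow> complex \<Rightarrow> complex" where
  "continuation s f = (THE g. g \<in> holo \<and> cross 1 s f g)"

lemma continuation_eq:
  assumes "s \<in> Sing" "g \<in> holo" "cross 1 s f g"
  shows "continuation s f = g"
  unfolding continuation_def using assms cross_unique[OF assms(1), of 1] by (intro the_equality) auto

lemma continuation_stable:
  assumes "stable V" "f \<in> V" "s \<in> Sing"
  shows "continuation s f \<in> V" "cross 1 s f (continuation s f)"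
proof -
  obtain g where g: "g \<in> V" "cross 1 s f g"
    using assms unfolding stable_def by blast
  hence "continuation s f = g" using assms by (intro continuation_eq) (auto simp: stable_def)
  thus "continuation s f \<in> V" "cross 1 s f (continuation s f)" using g by auto
qed

text \<open>The inverse is the crossing in the opposite direction, under which \<open>V\<close> is
  closed too.\<close>

lemma continuation_bij:
  assumes V: "stable V" and s: "s \<in> Sing"
  shows "bij_betw (continuation s) V V"
  unfolding bij_betw_def
proof
  show "inj_on (continuation s) V"
  proof (rule inj_onI)
    fix f g assume fg: "f \<in> V" "g \<in> V" "continuation s f = continuation s g"
    have "cross (-1) s (continuation s f) f" "cross (-1) s (continuation s f) g"
      using continuation_stable(2)[OF V _ s] fg cross_sym by metis+
    thus "f = g" using fg V cross_unique[OF s, of "-1"] by (auto simp: stable_def)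
  qed
  show "continuation s ` V = V"
  proof
    show "V \<subseteq> continuation s ` V"
    proof
      fix g assume g: "g \<in> V"
      then obtain f where "f \<in> V" "cross (-1) s g f" using V s unfolding stable_def by blast
      hence "cross 1 s f g" using cross_sym[of 1 s f g] by simp
      hence "continuation s f = g" using g V s by (intro continuation_eq) (auto simp: stable_def)
      thus "g \<in> continuation s ` V" using \<open>f \<in> V\<close> by blast
    qed
  qed (use continuation_stable[OF V _ s] in blast)
qed

text \<open>Differential ring automorphisms of \<open>continuable\<close> over the functions that
  are single-valued off \<open>Sing\<close>. Bijectivity on every stable set, not only on
  \<open>continuable\<close>, ensures that the inverse maps a stable set to itself; this is what
  \<open>comm_fix\<close> rests on.\<close>

definition aut :: "((complex \<Rightarrow> complex) \<Rightarrow> (complex \<Rightarrow> complex)) \<Rightarrow> bool" where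
  "aut \<phi> \<longleftrightarrow> (\<forall>V. stable V \<longrightarrow> bij_betw \<phi> V V) \<and>
     (\<forall>f\<in>continuable. \<forall>g\<in>continuable. \<phi> (\<lambda>x. f x + g x) = (\<lambda>x. \<phi> f x + \<phi> g x)) \<and>
     (\<forall>f\<in>continuable. \<forall>g\<in>continuable. \<phi> (\<lambda>x. f x * g x) = (\<lambda>x. \<phi> f x * \<phi> g x)) \<and>
     (\<forall>f\<in>continuable. \<phi> (slit_deriv f) = slit_deriv (\<phi> f)) \<and>
     (\<forall>R. R holomorphic_on - Sing \<longrightarrow> \<phi> (res R) = res R)"

lemma autD:
  assumes "aut \<phi>"
  shows "stable V \<Longrightarrow> bij_betw \<phi> V V"
    and "f \<in> continuable \<Longrightarrow> g \<in> continuable \<Longrightarrow> \<phi> (\<lambda>x. f x + g x) = (\<lambda>x. \<phi> f x + \<phi> g x)"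
    and "f \<in> continuable \<Longrightarrow> g \<in> continuable \<Longrightarrow> \<phi> (\<lambda>x. f x * g x) = (\<lambda>x. \<phi> f x * \<phi> g x)"
    and "f \<in> continuable \<Longrightarrow> \<phi> (slit_deriv f) = slit_deriv (\<phi> f)"
    and "R holomorphic_on - Sing \<Longrightarrow> \<phi> (res R) = res R"
  using assms unfolding aut_def by blast+

lemma aut_in: "aut \<phi> \<Longrightarrow> stable V \<Longrightarrow> f \<in> V \<Longrightarrow> \<phi> f \<in> V"
  using autD(1) bij_betwE by blast

lemmas aut_continuable = aut_in[OF _ stable_continuable]

lemma aut_continuation:
  assumes s: "s \<in> Sing"
  shows "aut (continuation s)"
proof -
  note g = continuation_stable[OF stable_continuable _ s]
  show ?thesis
    unfolding aut_def
    by (intro conjI allI ballI impI continuation_bij[OF _ s] continuation_eq[OF s] continuable_holo continuable_add continuable_mult continuable_slit_deriv continuable_res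
        cross_add cross_mult cross_slit_deriv[OF s] cross_res[OF s] g)
qed

lemma aut_id: "aut id"
  by (auto simp: aut_def)

lemma aut_comp: "aut \<phi> \<Longrightarrow> aut \<psi> \<Longrightarrow> aut (\<phi> \<circ> \<psi>)"
  unfolding aut_def[of "\<phi> \<circ> \<psi>"]
  by (auto simp: autD(2-5) aut_continuable intro: bij_betw_trans autD(1))

lemma aut_power: "aut \<phi> \<Longrightarrow> aut (\<phi> ^^ k)"
  by (induction k) (auto simp: aut_id[unfolded id_def] aut_comp id_def)

lemma aut_inv:
  assumes "aut \<phi>"
  shows "aut (inv_into continuable \<phi>)"
proof -
  have bij: "bij_betw \<phi> continuable continuable" using autD(1)[OF assms stable_continuable] .
  have r: "\<phi> (inv_into continuable \<phi> f) = f" "inv_into continuable \<phi> f \<in> continuable" if "f \<in> continuable" for f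
    using bij that by (auto simp: bij_betw_inv_into_right bij_betw_def intro!: inv_into_into)
  have l: "inv_into continuable \<phi> f = g" if "g \<in> continuable" "\<phi> g = f" for f g
    using bij that by (auto simp: bij_betw_inv_into_left)
  show ?thesis
    unfolding aut_def
  proof (intro conjI allI ballI impI)
    fix V assume "stable V"
    thus "bij_betw (inv_into continuable \<phi>) V V"
      using bij_betw_inv_into_subset[OF bij stable_subset_continuable] autD(1)[OF assms] by (auto simp: bij_betw_def)
  qed (use autD(2-5)[OF assms] r in \<open>auto intro!: l continuable_add continuable_mult continuable_slit_deriv continuable_res\<close>)
qed

definition comm where
  "comm \<phi> \<psi> = \<phi> \<circ> \<psi> \<circ> inv_into continuable \<phi> \<circ> inv_into continuable \<psi>"

lemma aut_comm: "aut \<phi> \<Longrightarrow> aut \<psi> \<Longrightarrow> aut (comm \<phi> \<psi>)"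
  unfolding comm_def by (intro aut_comp aut_inv)

text \<open>With \<open>u\<close> the commutator, this is the relation u \<psi> \<phi> = \<phi>
  \<psi>, in which no inverse has to be evaluated.\<close>

lemma comm_apply:
  assumes "aut \<phi>" "aut \<psi>" "f \<in> continuable"
  shows "comm \<phi> \<psi> (\<psi> (\<phi> f)) = \<phi> (\<psi> f)"
  using bij_betw_inv_into_left[OF autD(1)[OF assms(1) stable_continuable]]
    bij_betw_inv_into_left[OF autD(1)[OF assms(2) stable_continuable]] assms aut_continuable
  by (simp add: comm_def)

text \<open>If one of the two maps is trivial on \<open>V\<close>, the other one meets its own
  inverse. All intermediate values stay in \<open>V\<close>, because \<open>V\<close> is
  stable.\<close>

lemma comm_fix:
  assumes V: "stable V" and \<phi>: "aut \<phi>" "aut \<psi>"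
    and fx: "(\<forall>v\<in>V. \<phi> v = v) \<or> (\<forall>v\<in>V. \<psi> v = v)" and v: "v \<in> V"
  shows "comm \<phi> \<psi> v = v"
proof -
  have inv: "inv_into continuable \<theta> v \<in> V" "\<theta> (inv_into continuable \<theta> v) = v" if "aut \<theta>" "v \<in> V" for \<theta> v
    using aut_in[OF aut_inv[OF that(1)] V that(2)] bij_betw_inv_into_right[OF autD(1)[OF that(1) stable_continuable]]
      stable_subset_continuable[OF V] that(2) by auto
  show ?thesis
    using fx inv[OF \<phi>(1)] inv[OF \<phi>(2)] v unfolding comm_def o_def by metis
qed

end

section \<open>Finite local monodromy and the monodromy of logarithms\<close>

context slit_plane
begin

abbreviation one :: "complex \<Rightarrow> complex" where "one \<equiv> res (\<lambda>_. 1)"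

lemma one_continuable: "one \<in> continuable"
  by (intro continuable_res) auto

lemma one_nonzero: "\<exists>x. one x \<noteq> 0"
  using c_in_\<Omega> by (auto simp: res_def)

lemma holo_outside: "f \<in> holo \<Longrightarrow> x \<notin> \<Omega> \<Longrightarrow> f x = 0"
  by (auto simp: holo_def)

lemma holo_scale: "f \<in> holo \<Longrightarrow> (\<lambda>x. \<kappa> * f x) \<in> holo"
  by (auto simp: holo_def intro!: holomorphic_intros)

text \<open>Constants are single-valued functions, so an automorphism fixes them and
  multiplicativity gives linearity.\<close>

lemma continuable_scale:
  assumes "f \<in> continuable"
  shows "(\<lambda>x. \<kappa> * f x) \<in> continuable" "aut \<phi> \<Longrightarrow> \<phi> (\<lambda>x. \<kappa> * f x) = (\<lambda>x. \<kappa> * \<phi> f x)"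
proof -
  have *: "(\<lambda>x. \<kappa> * g x) = (\<lambda>x. res (\<lambda>_. \<kappa>) x * g x)" if "g \<in> continuable" for g
    using holo_outside[OF continuable_holo[OF that]] by (auto simp: res_def fun_eq_iff)
  have \<kappa>: "res (\<lambda>_. \<kappa>) \<in> continuable" by (intro continuable_res) auto
  show "(\<lambda>x. \<kappa> * f x) \<in> continuable"
    unfolding *[OF assms] by (intro continuable_mult \<kappa> assms)
  show "\<phi> (\<lambda>x. \<kappa> * f x) = (\<lambda>x. \<kappa> * \<phi> f x)" if "aut \<phi>"
    unfolding *[OF assms] *[OF aut_continuable[OF that assms]] autD(3)[OF that \<kappa> assms]
    by (subst autD(5)[OF that]) auto
qed

lemma continuable_sum:
  assumes "finite M" "\<And>m. m \<in> M \<Longrightarrow> f m \<in> continuable"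
  shows "(\<lambda>x. \<Sum>m\<in>M. f m x) \<in> continuable \<and>
    (aut \<phi> \<longrightarrow> \<phi> (\<lambda>x. \<Sum>m\<in>M. f m x) = (\<lambda>x. \<Sum>m\<in>M. \<phi> (f m) x))"
  using assms
proof (induction M)
  case empty
  have "res (\<lambda>_. 0) \<in> continuable" "res (\<lambda>_. 0) = (\<lambda>_. 0)" by (intro continuable_res) (auto simp: res_def)
  thus ?case using autD(5)[of \<phi> "\<lambda>_. 0"] by auto
next
  case (insert m M)
  thus ?case using continuable_add[of "f m" "\<lambda>x. \<Sum>m\<in>M. f m x"] autD(2)[of \<phi> "f m" "\<lambda>x. \<Sum>m\<in>M. f m x"] by simp
qed

lemma aut_lincomb:
  assumes "aut \<phi>" "finite M" "\<And>m. m \<in> M \<Longrightarrow> f m \<in> continuable"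
  shows "\<phi> (\<lambda>x. \<Sum>m\<in>M. \<kappa> m * f m x) = (\<lambda>x. \<Sum>m\<in>M. \<kappa> m * \<phi> (f m) x)"
  using continuable_sum[OF assms(2), of "\<lambda>m x. \<kappa> m * f m x" \<phi>] assms by (simp add: continuable_scale)

lemma continuable_lincomb:
  assumes "finite M" "\<And>m. m \<in> M \<Longrightarrow> f m \<in> continuable"
  shows "(\<lambda>x. \<Sum>m\<in>M. \<kappa> m * f m x) \<in> continuable"
  using continuable_sum[OF assms(1), of "\<lambda>m x. \<kappa> m * f m x" id] assms by (simp add: continuable_scale)

lemma aut_one: "aut \<phi> \<Longrightarrow> \<phi> one = one"
  by (intro autD(5)) auto

lemma holo_has_derivative:
  assumes "f \<in> holo" "x \<in> \<Omega>"
  shows "(f has_field_derivative slit_deriv f x) (at x)"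
  using assms holomorphic_derivI[OF _ open_\<Omega>] by (auto simp: slit_deriv_def res_def holo_def)

lemma same_derivative:
  assumes f: "f \<in> holo" "g \<in> holo" and d: "\<And>x. x \<in> \<Omega> \<Longrightarrow> (g has_field_derivative slit_deriv f x) (at x)"
  obtains \<kappa> where "f = (\<lambda>x. g x + \<kappa> * one x)"
proof -
  have "((\<lambda>x. f x - g x) has_field_derivative 0) (at x)" if "x \<in> \<Omega>" for x
    using DERIV_diff[OF holo_has_derivative[OF f(1) that] d[OF that]] by simp
  then obtain \<kappa> where \<kappa>: "\<And>x. x \<in> \<Omega> \<Longrightarrow> f x - g x = \<kappa>"
    using has_field_derivative_0_imp_constant_on[of \<Omega> "\<lambda>x. f x - g x"] open_\<Omega> connected_\<Omega>
    unfolding constant_on_def by meson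
  have "f = (\<lambda>x. g x + \<kappa> * one x)"
  proof
    fix x show "f x = g x + \<kappa> * one x"
      using \<kappa>[of x] holo_outside[OF f(1)] holo_outside[OF f(2)] by (cases "x \<in> \<Omega>") (auto simp: res_def algebra_simps)
  qed
  thus ?thesis by (rule that)
qed

lemma open_nonzero:
  assumes "finite F" "F \<subseteq> holo" "(\<lambda>_. 0) \<notin> F"
  shows "\<exists>U. open U \<and> U \<noteq> {} \<and> U \<subseteq> \<Omega> \<and> (\<forall>x\<in>U. \<forall>f\<in>F. f x \<noteq> 0)"
  using assms
proof (induction F)
  case empty
  thus ?case using open_\<Omega> c_in_\<Omega> by auto
next
  case (insert f F)
  then obtain U where U: "open U" "U \<noteq> {}" "U \<subseteq> \<Omega>" "\<forall>x\<in>U. \<forall>f\<in>F. f x \<noteq> 0" by auto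
  have f: "f \<in> holo" "f \<noteq> (\<lambda>_. 0)" using insert.prems by auto
  have "(\<lambda>_. 0) \<in> holo" by (auto simp: holo_def)
  then obtain x where x: "x \<in> U" "f x \<noteq> 0"
    using holo_eqI[OF f(1) _ U(1-3)] f(2) by blast
  have "open (U \<inter> f -` (- {0}))"
    using f(1) U by (intro continuous_open_preimage)
      (auto simp: holo_def intro: continuous_on_subset holomorphic_on_imp_continuous_on)
  thus ?case using U x by (intro exI[of _ "U \<inter> f -` (- {0})"]) auto
qed

text \<open>At a point where neither the leading coefficient nor any difference of two members of
  \<open>Z\<close> vanishes, the members of \<open>Z\<close> take distinct values, all roots of one
  polynomial of degree at most \<open>n\<close>.\<close>

lemma card_roots_le:
  assumes Z: "finite Z" "Z \<subseteq> holo" and a: "a n \<in> holo" "a n \<noteq> (\<lambda>_. 0)"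
    and rel: "\<And>z x. z \<in> Z \<Longrightarrow> x \<in> \<Omega> \<Longrightarrow> (\<Sum>i\<le>n. a i x * z x ^ i) = 0"
  shows "card Z \<le> n"
proof -
  let ?F = "insert (a n) ((\<lambda>(z, z') x. z x - z' x) ` {(z, z'). z \<in> Z \<and> z' \<in> Z \<and> z \<noteq> z'})"
  have fin: "finite {(z, z'). z \<in> Z \<and> z' \<in> Z \<and> z \<noteq> z'}"
    by (rule finite_subset[of _ "Z \<times> Z"]) (use Z in auto)
  have sub: "?F \<subseteq> holo" using a Z by (auto intro!: holo_diff)
  have nz: "(\<lambda>_. 0) \<notin> ?F" using a(2) by (auto simp: fun_eq_iff)
  have "finite ?F" using fin by (intro finite.insertI finite_imageI)
  then obtain U where U: "U \<noteq> {}" "U \<subseteq> \<Omega>" "\<forall>x\<in>U. \<forall>f\<in>?F. f x \<noteq> 0"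
    using open_nonzero[OF _ sub nz] by auto
  then obtain x where "x \<in> U" by auto
  hence x: "x \<in> \<Omega>" "\<And>f. f \<in> ?F \<Longrightarrow> f x \<noteq> 0" using U(2) U(3)[rule_format, of x] by blast+
  define p where "p = (\<Sum>i\<le>n. monom (a i x) i)"
  have "coeff p n = a n x" by (simp add: p_def coeff_sum if_distrib cong: if_cong)
  hence "p \<noteq> 0" using x by auto
  have "inj_on (\<lambda>z. z x) Z"
  proof (rule inj_onI, rule ccontr)
    fix z z' assume z: "z \<in> Z" "z' \<in> Z" "z x = z' x" "z \<noteq> z'"
    have "(\<lambda>x. z x - z' x) \<in> ?F" by (rule insertI2, rule image_eqI[of _ _ "(z, z')"]) (use z in auto)
    from x(2)[OF this] show False using z(3) by simp
  qed
  hence "card Z = card ((\<lambda>z. z x) ` Z)" by (simp add: card_image)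
  also have "\<dots> \<le> card {y. poly p y = 0}"
    using rel x(1) by (intro card_mono poly_roots_finite \<open>p \<noteq> 0\<close>) (auto simp: p_def poly_sum poly_monom)
  also have "\<dots> \<le> degree p" by (rule card_poly_roots_bound[OF \<open>p \<noteq> 0\<close>])
  also have "degree p \<le> n" unfolding p_def by (intro degree_sum_le) (auto intro: order_trans[OF degree_monom_le])
  finally show ?thesis .
qed

text \<open>Among the first \<open>n + 1\<close> iterates two coincide, as all of them are roots of
  the same polynomial. Injectivity gives a period of at most \<open>n\<close>, which divides
  \<open>fact n\<close>.\<close>

lemma finite_order:
  assumes \<phi>: "aut \<phi>" and h: "h \<in> continuable" and a: "a n \<in> holo" "a n \<noteq> (\<lambda>_. 0)"
    and rel: "\<And>m x. x \<in> \<Omega> \<Longrightarrow> (\<Sum>i\<le>n. a i x * (\<phi> ^^ m) h x ^ i) = 0"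
  shows "(\<phi> ^^ fact n) h = h"
proof -
  have continuable: "(\<phi> ^^ m) h \<in> continuable" for m using aut_continuable[OF aut_power[OF \<phi>] h] .
  have "\<not> inj_on (\<lambda>m. (\<phi> ^^ m) h) {..n}"
  proof
    assume "inj_on (\<lambda>m. (\<phi> ^^ m) h) {..n}"
    hence "card ((\<lambda>m. (\<phi> ^^ m) h) ` {..n}) = Suc n" by (simp add: card_image)
    moreover have "card ((\<lambda>m. (\<phi> ^^ m) h) ` {..n}) \<le> n"
      by (rule card_roots_le[where a = a]) (use a rel continuable_holo[OF continuable] in auto)
    ultimately show False by simp
  qed
  then obtain m m' where m: "m < m'" "m' \<le> n" "(\<phi> ^^ m) h = (\<phi> ^^ m') h"
    using linorder_inj_onI'[of "{..n}" "\<lambda>m. (\<phi> ^^ m) h"] by auto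
  define e where "e = m' - m"
  have "(\<phi> ^^ m) ((\<phi> ^^ e) h) = (\<phi> ^^ m) h \<Longrightarrow> (\<phi> ^^ e) h = h"
    using autD(1)[OF aut_power[OF \<phi>] stable_continuable] continuable h by (auto simp: bij_betw_def dest: inj_onD)
  moreover have "(\<phi> ^^ m) ((\<phi> ^^ e) h) = (\<phi> ^^ m) h"
    using m funpow_add[of m e \<phi>] by (simp add: e_def)
  ultimately have e: "(\<phi> ^^ e) h = h" by blast
  have "e dvd fact n" using m by (intro dvd_fact) (auto simp: e_def)
  then obtain q where q: "fact n = e * q" ..
  have "((\<phi> ^^ e) ^^ q) h = h" by (induction q) (auto simp: e)
  thus ?thesis by (simp add: q funpow_mult)
qed

text \<open>The second system is regular at \<open>s\<close>, so \<open>Z 0\<close> does not change under continuation around \<open>s\<close>.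
  Hence the continuations of \<open>Y 0\<close> are all roots of one and the same polynomial.\<close>

lemma finite_monodromy:
  assumes A: "A1 \<subseteq> Sing" "A2 \<subseteq> Sing"
    and B1: "\<And>i j. i < n1 \<Longrightarrow> j < n1 \<Longrightarrow> B1 i j holomorphic_on - A1"
    and B2: "\<And>i j. i < n2 \<Longrightarrow> j < n2 \<Longrightarrow> B2 i j holomorphic_on - A2"
    and n: "n1 > 0" "n2 > 0"
    and Y: "ode_sol n1 B1 \<Omega> Y" and Z: "ode_sol n2 B2 \<Omega> Z"
    and a: "a n \<noteq> 0"
    and rel: "\<And>x. x \<in> \<Omega> \<Longrightarrow> (\<Sum>i\<le>n. poly (a i) x * Y 0 x ^ i * Z 0 x ^ (n - i)) = 0"
    and s: "s \<in> Sing" "s \<notin> A2"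
  obtains V where "stable V" "res (Y 0) \<in> V" "\<And>v. v \<in> V \<Longrightarrow> (continuation s ^^ fact n) v = v"
proof -
  define rl where "rl = (\<lambda>f g. \<forall>x\<in>\<Omega>. (\<Sum>i\<le>n. poly (a i) x * f x ^ i * g x ^ (n - i)) = 0)"
  \<comment> \<open>The relation evaluated at the continuations \<open>h\<close> and
    \<open>k\<close> continues 0 across the slit, so by \<open>cross_unique\<close> it is 0 on the
    other side.\<close>
  have rl_cross: "rl f' g'" if *: "s \<in> Sing" "b \<in> {1, -1}" "cross b s f f'" "cross b s g g'" "rl f g"
    "f' holomorphic_on \<Omega>" "g' holomorphic_on \<Omega>" for b s f f' g g'
  proof -
    obtain h k where h: "h holomorphic_on disc s" "\<forall>x\<in>half (-b) s. h x = f x" "\<forall>x\<in>half b s. h x = f' x"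
      and k: "k holomorphic_on disc s" "\<forall>x\<in>half (-b) s. k x = g x" "\<forall>x\<in>half b s. k x = g' x"
      using *(3,4) unfolding cross_def by metis
    let ?r = "\<lambda>f g x. \<Sum>i\<le>n. poly (a i) x * f x ^ i * g x ^ (n - i)"
    have "cross b s (\<lambda>_. 0) (res (?r f' g'))"
      unfolding cross_def
    proof (intro exI[of _ "?r h k"] conjI ballI)
      show "?r h k holomorphic_on disc s" using h k by (intro holomorphic_intros)
    next
      fix x assume x: "x \<in> half (-b) s"
      hence "x \<in> \<Omega>" using half_subset_\<Omega>[OF *(1)] by blast
      thus "?r h k x = 0" using *(5) h(2) k(2) x by (simp add: rl_def)
    next
      fix x assume x: "x \<in> half b s"
      hence "x \<in> \<Omega>" using half_subset_\<Omega>[OF *(1)] by blast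
      thus "?r h k x = res (?r f' g') x" using h(3) k(3) x by (simp add: res_def)
    qed
    moreover have "cross b s (\<lambda>_. 0) (\<lambda>_. 0)" unfolding cross_def by (intro exI[of _ "\<lambda>_. 0"]) auto
    moreover have "res (?r f' g') \<in> holo" using *(6,7) by (intro res_in_holo holomorphic_intros)
    moreover have "(\<lambda>_. 0) \<in> holo" by (auto simp: holo_def)
    ultimately have "res (?r f' g') = (\<lambda>_. 0)"
      using cross_unique[OF *(1,2)] by blast
    hence "res (?r f' g') x = 0" for x by simp
    thus "rl f' g'" unfolding rl_def res_def by metis
  qed
  \<comment> \<open>\<open>VZ Z\<close> collects the functions related to one fixed solution
    \<open>Z\<close>. Continuation around \<open>s\<close> preserves it, because \<open>Z 0\<close>
    does not change there. Crossing another slit replaces \<open>Z\<close> by another solution, so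
    stability is claimed only for the union \<open>V\<close> over all \<open>Z\<close>.\<close>
  define VZ where "VZ = (\<lambda>Z :: nat \<Rightarrow> complex \<Rightarrow> complex. {res (Y 0) |Y. ode_sol n1 B1 \<Omega> Y \<and> rl (Y 0) (Z 0)})"
  define V where "V = (\<Union>Z\<in>{Z. ode_sol n2 B2 \<Omega> Z}. VZ Z)"
  note hol1 = ode_sol_holomorphic[OF _ open_\<Omega> n(1)] and hol2 = ode_sol_holomorphic[OF _ open_\<Omega> n(2)]
  have stable: "stable V"
    unfolding stable_def
  proof (intro conjI ballI subsetI)
    fix v assume "v \<in> V" thus "v \<in> holo" by (auto simp: V_def VZ_def intro!: res_in_holo hol1)
  next
    fix v s and b :: real assume v: "v \<in> V" and s: "s \<in> Sing" and b: "b \<in> {1, -1}"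
    then obtain Y Z where Y: "ode_sol n1 B1 \<Omega> Y" and Z: "ode_sol n2 B2 \<Omega> Z" and r: "rl (Y 0) (Z 0)"
      and veq: "v = res (Y 0)" by (auto simp: V_def VZ_def)
    obtain Y' where Y': "ode_sol n1 B1 \<Omega> Y'" "cross b s (Y 0) (Y' 0)"
      using ode_cross[OF A(1) B1 Y s b] n by metis
    obtain Z' where Z': "ode_sol n2 B2 \<Omega> Z'" "cross b s (Z 0) (Z' 0)"
      using ode_cross[OF A(2) B2 Z s b] n by metis
    have "rl (Y' 0) (Z' 0)"
      using rl_cross[OF s b Y'(2) Z'(2) r] hol1[OF Y'(1)] hol2[OF Z'(1)] by blast
    thus "\<exists>w\<in>V. cross b s v w"
      using Y' Z' res_cross[OF s Y'(2)] unfolding V_def VZ_def veq by blast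
  qed
  have continuation: "continuation s v \<in> VZ Z" if v: "v \<in> VZ Z" and Z: "ode_sol n2 B2 \<Omega> Z" for v Z
  proof -
    obtain Y where Y: "ode_sol n1 B1 \<Omega> Y" and r: "rl (Y 0) (Z 0)" and veq: "v = res (Y 0)"
      using v by (auto simp: VZ_def)
    obtain Y' where Y': "ode_sol n1 B1 \<Omega> Y'" "cross 1 s (Y 0) (Y' 0)"
      using ode_cross[OF A(1) B1 Y s(1), of 1] n by (metis insertI1)
    have "rl (Y' 0) (Z 0)"
      using rl_cross[OF s(1) _ Y'(2) ode_cross_trivial[OF A(2) B2 Z s n(2)] r] hol1[OF Y'(1)] hol2[OF Z] by blast
    moreover have "continuation s v = res (Y' 0)"
      unfolding veq by (intro continuation_eq s res_cross[OF s(1)] Y' res_in_holo hol1[OF Y'(1)])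
    ultimately show ?thesis using Y' by (auto simp: VZ_def)
  qed
  show ?thesis
  proof (rule that[OF stable])
    show "res (Y 0) \<in> V" using Y Z rel by (auto simp: V_def VZ_def rl_def)
  next
    fix v assume v: "v \<in> V"
    then obtain Z where Z: "ode_sol n2 B2 \<Omega> Z" "v \<in> VZ Z" by (auto simp: V_def)
    have *: "(continuation s ^^ m) v \<in> VZ Z" for m by (induction m) (auto intro: continuation Z)
    have "False" if "res (poly (a n)) = (\<lambda>_. 0)"
    proof -
      have "\<Omega> \<subseteq> {x. poly (a n) x = 0}" 
      proof
        fix x assume "x \<in> \<Omega>"
        thus "x \<in> {x. poly (a n) x = 0}" using fun_cong[OF that, of x] by (simp add: res_def)
      qed
      hence "finite \<Omega>" using poly_roots_finite[OF a] finite_subset by blast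
      thus False using open_\<Omega> c_in_\<Omega> by (metis empty_iff finite_imp_not_open)
    qed
    hence nz: "res (poly (a n)) \<noteq> (\<lambda>_. 0)" by blast
    have Hoa: "res (poly (a n)) \<in> holo" by (intro res_in_holo holomorphic_intros)
    \<comment> \<open>Only the leading coefficient has to lie in \<open>holo\<close>, so only it is
      set to 0 outside \<open>\<Omega>\<close>; its power of \<open>Z 0\<close> has exponent
      0.\<close>
    define a' where "a' = (\<lambda>i x. if i = n then res (poly (a n)) x else poly (a i) x * Z 0 x ^ (n - i))"
    show "(continuation s ^^ fact n) v = v"
    proof (rule finite_order[OF aut_continuation[OF s(1)], where a = a'])
      show "v \<in> continuable" using v stable_subset_continuable[OF stable] by auto
      show "a' n \<in> holo" "a' n \<noteq> (\<lambda>_. 0)" using Hoa nz by (simp_all add: a'_def)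
    next
      fix m x assume x: "x \<in> \<Omega>"
      obtain Y where Y: "rl (Y 0) (Z 0)" "(continuation s ^^ m) v = res (Y 0)"
        using *[of m] by (auto simp: VZ_def)
      have "(\<Sum>i\<le>n. a' i x * (continuation s ^^ m) v x ^ i) = (\<Sum>i\<le>n. poly (a i) x * Y 0 x ^ i * Z 0 x ^ (n - i))"
        unfolding Y(2) using x by (intro sum.cong) (auto simp: a'_def res_def)
      also have "\<dots> = 0" using Y(1) x by (simp add: rl_def)
      finally show "(\<Sum>i\<le>n. a' i x * (continuation s ^^ m) v x ^ i) = 0" .
    qed
  qed
qed

lemma aut_add_scaled:
  assumes "aut \<phi>" "f \<in> continuable" "g \<in> continuable"
  shows "\<phi> (\<lambda>x. f x + \<kappa> * g x) = (\<lambda>x. \<phi> f x + \<kappa> * \<phi> g x)"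
  using autD(2)[OF assms(1,2) continuable_scale(1)[OF assms(3)]] continuable_scale(2)[OF assms(3,1)] by simp

lemma continuable_add_scaled: "f \<in> continuable \<Longrightarrow> g \<in> continuable \<Longrightarrow> (\<lambda>x. f x + \<kappa> * g x) \<in> continuable"
  by (intro continuable_add continuable_scale)

text \<open>With u = (x - c) / (t - c) the quotient is 1 - u. So it meets the cut of the principal
  logarithm exactly when x lies on the slit of \<open>t\<close>.\<close>

lemma log_in_slit:
  assumes "t \<in> Sing" "t \<in> A" "A \<subseteq> Sing" "x \<in> slit A"
  shows "(x - t) / (c - t) \<notin> \<real>\<^sub>\<le>\<^sub>0"
proof
  assume *: "(x - t) / (c - t) \<in> \<real>\<^sub>\<le>\<^sub>0"
  have "t \<noteq> c" using assms c_notin by auto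
  hence "(x - c) / (t - c) = 1 - (x - t) / (c - t)" by (simp add: divide_simps) (simp add: algebra_simps)
  hence "x \<in> ray t" using * by (simp add: ray_def complex_nonpos_Reals_iff)
  thus False using assms by (auto simp: slit_def)
qed

text \<open>Up to a constant, \<open>f\<close> is the principal logarithm of (x - t) / (c - t),
  whose only cut is the slit of \<open>t\<close>.\<close>

lemma log_monodromy:
  assumes f: "f \<in> holo" and t: "t \<in> Sing"
    and d: "\<And>x. x \<in> \<Omega> \<Longrightarrow> (f has_field_derivative 1 / (x - t)) (at x)"
  shows "continuation t f = (\<lambda>x. f x + 2 * pi * \<i> * one x)"
    and "\<And>s. s \<in> Sing \<Longrightarrow> s \<noteq> t \<Longrightarrow> continuation s f = f"
proof -
  have tc: "t \<noteq> c" using t c_notin by auto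
  let ?w = "\<lambda>x. (x - t) / (c - t)"
  have dL: "((\<lambda>x. Ln (?w x)) has_field_derivative 1 / (x - t)) (at x)" if "?w x \<notin> \<real>\<^sub>\<le>\<^sub>0" for x
  proof -
    have "x \<noteq> t" using that by auto
    hence eq: "inverse (?w x) * (1 / (c - t)) = 1 / (x - t)" using tc by (simp add: divide_simps)
    have "(?w has_field_derivative 1 / (c - t)) (at x)" by (use tc in \<open>auto intro!: derivative_eq_intros\<close>)
    from DERIV_chain2[OF has_field_derivative_Ln[OF that] this] show ?thesis unfolding eq .
  qed
  have L: "res (\<lambda>x. Ln (?w x)) \<in> holo"
    using dL[OF log_in_slit[OF t t order_refl]] open_\<Omega> by (intro res_in_holo) (auto simp: holomorphic_on_open)
  obtain \<kappa> where \<kappa>: "res (\<lambda>x. Ln (?w x)) = (\<lambda>x. f x + \<kappa> * one x)"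
  proof (rule same_derivative[OF L f])
    fix x assume x: "x \<in> \<Omega>"
    have "slit_deriv (res (\<lambda>x. Ln (?w x))) x = deriv (\<lambda>x. Ln (?w x)) x"
      unfolding slit_deriv_def using x by (auto simp: res_def eventually_nhds intro!: deriv_cong_ev exI[of _ \<Omega>] open_\<Omega>)
    also have "\<dots> = 1 / (x - t)"
      using dL[OF log_in_slit[OF t t order_refl x]] by (rule DERIV_imp_deriv)
    finally show "(f has_field_derivative slit_deriv (res (\<lambda>x. Ln (?w x))) x) (at x)" using d[OF x] by simp
  qed blast
  have f_eq: "f x = Ln (?w x) - \<kappa>" if "x \<in> \<Omega>" for x
    using fun_cong[OF \<kappa>, of x] that by (simp add: res_def algebra_simps)
  show "continuation s f = f" if s: "s \<in> Sing" "s \<noteq> t" for s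
  proof (rule continuation_eq[OF s(1) f])
    have "(\<lambda>x. Ln (?w x) - \<kappa>) holomorphic_on disc s"
      using radius(3)[OF s(1)] log_in_slit[OF t, of "Sing - {s}"] s t tc by (intro holomorphic_intros) auto
    thus "cross 1 s f f"
      unfolding cross_def using subsetD[OF half_subset_\<Omega>[OF s(1)]] by (intro exI[of _ "\<lambda>x. Ln (?w x) - \<kappa>"]) (simp add: f_eq)
  qed
  let ?u = "\<lambda>x. (x - c) / (t - c)"
  have wu: "?w x = 1 - ?u x" for x using tc by (simp add: divide_simps) (simp add: algebra_simps)
  show "continuation t f = (\<lambda>x. f x + 2 * pi * \<i> * one x)"
  proof (rule continuation_eq[OF t])
    show "(\<lambda>x. f x + 2 * pi * \<i> * one x) \<in> holo"
      by (intro holo_add holo_scale f continuable_holo[OF one_continuable])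
    \<comment> \<open>On the disc, \<open>?u x - 1\<close>, which is minus \<open>?w x\<close>, has
      positive real part, so its logarithm is holomorphic there. The shift by \<i>\<pi> makes
      \<open>?h\<close> agree with \<open>f\<close> where \<open>?w\<close> has positive imaginary
      part; where it is negative, the two logarithms differ by \<i>\<pi> of the other sign, which
      gives the jump 2\<pi>\<i>.\<close>
    let ?h = "\<lambda>x. Ln (?u x - 1) + \<i> * pi - \<kappa>"
    have "?h holomorphic_on disc t"
      using disc_Re[OF t] tc
      by (intro holomorphic_intros) (fastforce simp: complex_nonpos_Reals_iff simp del: Re_divide)+
    moreover have "?h x = f x" if x: "x \<in> half (-1) t" for x
    proof -
      have "Im (?w x) > 0" using x unfolding wu by (simp add: half_def)
      hence "Ln (- ?w x) = Ln (?w x) - \<i> * pi" by (subst Ln_minus) auto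
      thus ?thesis using f_eq[OF subsetD[OF half_subset_\<Omega>[OF t] x]] unfolding wu by simp
    qed
    moreover have "?h x = f x + 2 * pi * \<i> * one x" if x: "x \<in> half 1 t" for x
    proof -
      have im: "Im (?w x) < 0" using x unfolding wu by (simp add: half_def)
      hence "Ln (- ?w x) = Ln (?w x) + \<i> * pi" by (subst Ln_minus) auto
      moreover have "x \<in> \<Omega>" using x half_subset_\<Omega>[OF t] by auto
      ultimately show ?thesis using f_eq[of x] unfolding wu by (auto simp: res_def)
    qed
    ultimately show "cross 1 t f (\<lambda>x. f x + 2 * pi * \<i> * one x)"
      unfolding cross_def by (intro exI[of _ ?h]) auto
  qed
qed

end

section \<open>Monodromy of iterated integrals\<close>

text \<open>\<open>I i n\<close> integrates the forms of \<open>t i\<close>, ...,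
  \<open>t (i + n - 1)\<close>, the last one outermost. The constants of integration are left open,
  except that \<open>I i 0\<close> is 1. The number \<open>k\<close> is the common exponent of all
  loops.\<close>

locale iterated_integrals = slit_plane +
  fixes t :: "nat \<Rightarrow> complex" and N :: nat and I :: "nat \<Rightarrow> nat \<Rightarrow> complex \<Rightarrow> complex" and k :: nat
  assumes t_Sing: "j < N \<Longrightarrow> t j \<in> Sing" and t_inj: "inj_on t {..<N}"
    and I_continuable: "i + n \<le> N \<Longrightarrow> I i n \<in> continuable"
    and I_0: "i \<le> N \<Longrightarrow> I i 0 = one"
    and I_Suc: "i + Suc n \<le> N \<Longrightarrow> x \<in> \<Omega> \<Longrightarrow>
      (I i (Suc n) has_field_derivative I i n x / (x - t (i + n))) (at x)"
    and k_pos: "k > 0" and N_pos: "N > 0"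
begin

lemma slit_deriv_I: "i + Suc n \<le> N \<Longrightarrow> slit_deriv (I i (Suc n)) = (\<lambda>x. res (\<lambda>x. 1 / (x - t (i + n))) x * I i n x)"
  using I_Suc[THEN DERIV_imp_deriv] by (auto simp: slit_deriv_def res_def fun_eq_iff)

lemma slit_deriv_aut_I:
  assumes "aut \<phi>" "i + Suc n \<le> N" "x \<in> \<Omega>"
  shows "slit_deriv (\<phi> (I i (Suc n))) x = \<phi> (I i n) x / (x - t (i + n))"
proof -
  have h: "(\<lambda>x. 1 / (x - t (i + n))) holomorphic_on - Sing"
    using t_Sing[of "i + n"] assms(2) by (intro holomorphic_intros) auto
  have "slit_deriv (\<phi> (I i (Suc n))) = \<phi> (slit_deriv (I i (Suc n)))"
    using assms by (intro autD(4)[symmetric] I_continuable)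
  also have "\<dots> = (\<lambda>x. res (\<lambda>x. 1 / (x - t (i + n))) x * \<phi> (I i n) x)"
    unfolding slit_deriv_I[OF assms(2)] using assms by (subst autD(3)) (auto simp: continuable_res[OF h] I_continuable autD(5)[OF _ h])
  finally show ?thesis using assms(3) by (simp add: res_def)
qed

text \<open>An automorphism commutes with differentiation, so the images of the \<open>I i n\<close>
  satisfy the same recursion, and each integration brings in one new constant. That constant
  multiplies \<open>I (i + n) 0\<close> and is then integrated along with the rest; therefore the
  coefficients \<open>\<kappa> m\<close> do not depend on \<open>n\<close>.\<close>

lemma aut_I_expand:
  assumes \<phi>: "aut \<phi>" and i: "i \<le> N"
  shows "\<exists>\<kappa>. \<kappa> 0 = 1 \<and> (\<forall>n. i + n \<le> N \<longrightarrow> \<phi> (I i n) = (\<lambda>x. \<Sum>m\<le>n. \<kappa> m * I (i + m) (n - m) x))"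
proof -
  have "\<exists>\<kappa>. \<kappa> 0 = 1 \<and> (\<forall>n\<le>l. \<phi> (I i n) = (\<lambda>x. \<Sum>m\<le>n. \<kappa> m * I (i + m) (n - m) x))" if "i + l \<le> N" for l
    using that
  proof (induction l)
    case 0
    show ?case using i by (intro exI[of _ "\<lambda>_. 1"]) (auto simp: I_0 aut_one[OF \<phi>])
  next
    case (Suc l)
    then obtain \<kappa> where \<kappa>: "\<kappa> 0 = 1" "\<And>n. n \<le> l \<Longrightarrow> \<phi> (I i n) = (\<lambda>x. \<Sum>m\<le>n. \<kappa> m * I (i + m) (n - m) x)"
      by auto
    let ?g = "\<lambda>x. \<Sum>m\<le>l. \<kappa> m * I (i + m) (Suc l - m) x"
    obtain q where q: "\<phi> (I i (Suc l)) = (\<lambda>x. ?g x + q * one x)"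
    proof (rule same_derivative)
      show "\<phi> (I i (Suc l)) \<in> holo" using aut_continuable[OF \<phi> I_continuable[OF Suc.prems]] continuable_holo by blast
      show "?g \<in> holo" using Suc.prems by (intro continuable_holo continuable_lincomb I_continuable) auto
      fix x assume x: "x \<in> \<Omega>"
      have "(?g has_field_derivative (\<Sum>m\<le>l. \<kappa> m * (I (i + m) (l - m) x / (x - t (i + l))))) (at x)"
      proof (intro DERIV_sum DERIV_cmult)
        fix m assume "m \<in> {..l}"
        thus "(I (i + m) (Suc l - m) has_field_derivative I (i + m) (l - m) x / (x - t (i + l))) (at x)"
          using I_Suc[of "i + m" "l - m" x] Suc.prems x by (simp add: Suc_diff_le)
      qed
      also have "(\<Sum>m\<le>l. \<kappa> m * (I (i + m) (l - m) x / (x - t (i + l)))) = slit_deriv (\<phi> (I i (Suc l))) x"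
        unfolding slit_deriv_aut_I[OF \<phi> Suc.prems x] \<kappa>(2)[OF order_refl] by (simp add: sum_divide_distrib)
      finally show "(?g has_field_derivative slit_deriv (\<phi> (I i (Suc l))) x) (at x)" .
    qed blast
    show ?case
    proof (intro exI[of _ "\<kappa>(Suc l := q)"] conjI allI impI)
      fix n assume n: "n \<le> Suc l"
      show "\<phi> (I i n) = (\<lambda>x. \<Sum>m\<le>n. (\<kappa>(Suc l := q)) m * I (i + m) (n - m) x)"
      proof (cases "n = Suc l")
        case True
        have "I (i + Suc l) 0 = one" using Suc.prems by (intro I_0) auto
        moreover have "(\<Sum>m\<le>l. (\<kappa>(Suc l := q)) m * I (i + m) (Suc l - m) x) = ?g x" for x
          by (intro sum.cong) auto
        ultimately show ?thesis by (simp add: True q fun_eq_iff)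
      next
        case False
        thus ?thesis using n \<kappa>(2)[of n] by (auto simp: fun_eq_iff intro!: sum.cong)
      qed
    qed (use \<kappa>(1) in auto)
  qed
  then obtain \<kappa> where "\<kappa> 0 = 1 \<and> (\<forall>n\<le>N - i. \<phi> (I i n) = (\<lambda>x. \<Sum>m\<le>n. \<kappa> m * I (i + m) (n - m) x))"
    using i by (metis le_add_diff_inverse order_refl)
  thus ?thesis by (intro exI[of _ \<kappa>]) auto
qed

definition loop :: "nat \<Rightarrow> (complex \<Rightarrow> complex) \<Rightarrow> complex \<Rightarrow> complex" where
  "loop j = continuation (t j) ^^ k"

lemma aut_loop: "j < N \<Longrightarrow> aut (loop j)"
  unfolding loop_def by (intro aut_power aut_continuation t_Sing)

lemma loop_letter:
  assumes "j < N" "p < N"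
  shows "loop p (I j 1) = (\<lambda>x. I j 1 x + (if j = p then 2 * pi * \<i> * k else 0) * one x)"
proof -
  have f: "I j 1 \<in> holo" using assms by (intro continuable_holo I_continuable) auto
  have d: "(I j 1 has_field_derivative 1 / (x - t j)) (at x)" if "x \<in> \<Omega>" for x
    using I_Suc[of j 0 x] that assms by (simp add: I_0 res_def)
  note a = aut_continuation[OF t_Sing[OF assms(2)]]
  have "(continuation (t p) ^^ n) (I j 1) = (\<lambda>x. I j 1 x + (if j = p then 2 * pi * \<i> * n else 0) * one x)" for n
  proof (induction n)
    case (Suc n)
    have "continuation (t p) (I j 1) = (\<lambda>x. I j 1 x + (if j = p then 2 * pi * \<i> else 0) * one x)"
      using log_monodromy[OF f t_Sing[OF assms(1)] d] assms t_Sing[OF assms(2)] t_inj by (auto simp: inj_on_def)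
    moreover have "I j 1 \<in> continuable" using assms by (intro I_continuable) auto
    ultimately show ?case
      unfolding funpow.simps o_apply Suc
      by (subst aut_add_scaled[OF a]) (simp_all add: one_continuable aut_one[OF a] fun_eq_iff algebra_simps)
  qed simp
  thus ?thesis by (simp add: loop_def)
qed

text \<open>\<open>iter_comm l\<close> is built from the loops \<open>N - 1 - l\<close>, ...,
  \<open>N - 1\<close>, the smallest index outermost; \<open>iter_comm (N - 1)\<close> involves all
  of them.\<close>

primrec iter_comm :: "nat \<Rightarrow> (complex \<Rightarrow> complex) \<Rightarrow> complex \<Rightarrow> complex" where
  "iter_comm 0 = loop (N - 1)"
| "iter_comm (Suc l) = comm (loop (N - 2 - l)) (iter_comm l)"

lemma aut_iter_comm: "l < N \<Longrightarrow> aut (iter_comm l)"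
  by (induction l) (auto intro!: aut_comm aut_loop)

text \<open>At each stage one entry of the commutator acts trivially on \<open>V\<close>: the outer
  loop if it is the one at \<open>p\<close>, otherwise the inner commutator.\<close>

lemma iter_comm_fix:
  assumes "stable V" "\<And>v. v \<in> V \<Longrightarrow> loop p v = v"
  shows "l < N \<Longrightarrow> N - 1 - l \<le> p \<Longrightarrow> p < N \<Longrightarrow> v \<in> V \<Longrightarrow> iter_comm l v = v"
proof (induction l arbitrary: v)
  case 0
  hence "p = N - 1" by auto
  thus ?case using assms 0 by simp
next
  case (Suc l)
  show ?case unfolding iter_comm.simps
  proof (rule comm_fix[OF assms(1)])
    show "(\<forall>v\<in>V. loop (N - 2 - l) v = v) \<or> (\<forall>v\<in>V. iter_comm l v = v)"
    proof (cases "N - 1 - l \<le> p")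
      case False
      hence "p = N - 2 - l" using Suc.prems by auto
      thus ?thesis using assms by auto
    qed (use Suc in auto)
  qed (use Suc.prems in \<open>auto intro: aut_loop aut_iter_comm\<close>)
qed

text \<open>In the induction step \<open>u = [\<phi>, w]\<close> is computed from \<open>u \<circ> w \<circ> \<phi> = \<phi> \<circ> w\<close>, without inverses.\<close>

lemma iter_comm_I:
  "l < N \<Longrightarrow> (\<forall>i n. n \<le> l \<longrightarrow> i + n \<le> N \<longrightarrow> iter_comm l (I i n) = I i n) \<and>
     (\<exists>e. (\<forall>i. i + Suc l \<le> N \<longrightarrow> iter_comm l (I i (Suc l)) = (\<lambda>x. I i (Suc l) x + e i * one x)) \<and> e (N - 1 - l) \<noteq> 0)"
proof (induction l)
  case 0
  have a: "aut (loop (N - 1))" using 0 by (intro aut_loop) auto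
  show ?case
  proof (intro conjI exI[of _ "\<lambda>i. if i = N - 1 then 2 * pi * \<i> * k else 0"] allI impI)
    fix i n :: nat assume "n \<le> 0" "i + n \<le> N"
    thus "iter_comm 0 (I i n) = I i n" using aut_one[OF a] by (simp add: I_0)
  next
    fix i assume "i + Suc 0 \<le> N"
    thus "iter_comm 0 (I i (Suc 0)) = (\<lambda>x. I i (Suc 0) x + (if i = N - 1 then 2 * pi * \<i> * k else 0) * one x)"
      using loop_letter[of i "N - 1"] by simp
  qed (use k_pos in auto)
next
  case (Suc l)
  then obtain e where
    w0: "\<And>i n. n \<le> l \<Longrightarrow> i + n \<le> N \<Longrightarrow> iter_comm l (I i n) = I i n" and
    w1: "\<And>i. i + Suc l \<le> N \<Longrightarrow> iter_comm l (I i (Suc l)) = (\<lambda>x. I i (Suc l) x + e i * one x)" and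
    e: "e (N - 1 - l) \<noteq> 0" by auto
  define p where "p = N - 2 - l"
  have p: "p < N" "p + Suc l < N" "N - 1 - l = Suc p" using Suc.prems by (auto simp: p_def)
  define \<phi> where "\<phi> = loop p"
  define w where "w = iter_comm l"
  define u where "u = iter_comm (Suc l)"
  have a: "aut \<phi>" "aut w" "aut u"
    using aut_loop[OF p(1)] aut_iter_comm[of l] aut_iter_comm[OF Suc.prems] Suc.prems by (auto simp: \<phi>_def w_def u_def)
  have u: "u (w (\<phi> f)) = \<phi> (w f)" if "f \<in> continuable" for f
    using comm_apply[OF a(1,2) that] by (simp add: u_def w_def \<phi>_def p_def)
  define q where "q = (\<lambda>j. if j = p then 2 * pi * \<i> * k else 0)"
  \<comment> \<open>\<open>w\<close> adds \<open>e i\<close> at length \<open>l + 1\<close> and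
    \<open>\<phi>\<close> adds \<open>q i\<close> at length 1; \<open>\<epsilon> i\<close> is the
    resulting entry of the commutator of two unipotent matrices, at length \<open>l + 2\<close>. For
    \<open>i = p\<close> only \<open>- q p * e (Suc p)\<close> survives, since \<open>q\<close>
    vanishes off \<open>p\<close>.\<close>
  define \<epsilon> where "\<epsilon> = (\<lambda>i. e i * q (i + Suc l) - q i * e (Suc i))"
  have key: "u (I i n) = (\<lambda>x. I i n x + (if n = Suc (Suc l) then \<epsilon> i else 0) * one x)"
    if "n \<le> Suc (Suc l)" "i + n \<le> N" for i n
    using that
  proof (induction n arbitrary: i rule: less_induct)
    case (less n)
    obtain \<kappa> where \<kappa>: "\<kappa> 0 = 1" "\<And>n. i + n \<le> N \<Longrightarrow> \<phi> (I i n) = (\<lambda>x. \<Sum>m\<le>n. \<kappa> m * I (i + m) (n - m) x)"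
      using aut_I_expand[OF a(1), of i] less.prems by auto
    have AA': "I (i + m) (n - m) \<in> continuable" if "m \<le> n" for m using that less.prems by (intro I_continuable) auto
    have low: "u (I (i + m) (n - m)) = I (i + m) (n - m)" if "0 < m" "m \<le> n" for m
      using less.IH[of "n - m" "i + m"] less.prems that by auto
    \<comment> \<open>The part of \<open>\<phi> (I i n)\<close> that consists of shorter integrals,
      on which \<open>u\<close> is trivial by the inner induction.\<close>
    define R where "R = (\<lambda>x. \<Sum>m\<in>{0<..n}. \<kappa> m * I (i + m) (n - m) x)"
    have RAA: "R \<in> continuable" unfolding R_def using AA' by (intro continuable_lincomb) auto
    have uR: "u R = R" unfolding R_def by (subst aut_lincomb[OF a(3)]) (auto simp: low AA' fun_eq_iff)
    have \<phi>I: "\<phi> (I i n) = (\<lambda>x. I i n x + R x)"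
      unfolding \<kappa>(2)[OF less.prems(2)] R_def
      using \<kappa>(1) by (simp add: atMost_atLeast0 sum.head fun_eq_iff flip: greaterThanAtMost_def)
    have IAA: "I i n \<in> continuable" using AA'[of 0] by simp
    \<comment> \<open>At length \<open>l + 2\<close>, \<open>w\<close> adds the constant
      \<open>e i\<close> to the inner integral \<open>I i (Suc l)\<close>, hence \<open>e i\<close>
      times the logarithm \<open>I (i + Suc l) 1\<close> to the integral, up to an undetermined
      constant \<open>\<delta>\<close>. At smaller lengths it adds at most a constant.\<close>
    define Q where "Q = (\<lambda>x. if n = Suc (Suc l) then e i * I (i + Suc l) 1 x else 0)"
    have main: "\<exists>\<delta>. w (I i n) = (\<lambda>x. I i n x + (Q x + \<delta> * one x)) \<and>
        w R = (\<lambda>x. R x + (if n = Suc (Suc l) then q i * e (Suc i) else 0) * one x)"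
    proof -
      consider "n \<le> l" | "n = Suc l" | "n = Suc (Suc l)" using less.prems by linarith
      thus ?thesis
      proof cases
        case 1
        have "w R = R" unfolding R_def
          by (subst aut_lincomb[OF a(2)]) (use less.prems 1 AA' in \<open>auto simp: w_def w0 fun_eq_iff\<close>)
        thus ?thesis using 1 w0[of n i] less.prems by (intro exI[of _ 0]) (auto simp: w_def Q_def)
      next
        case 2
        have "w R = R" unfolding R_def
          by (subst aut_lincomb[OF a(2)]) (use less.prems 2 AA' in \<open>auto simp: w_def w0 fun_eq_iff intro!: sum.cong\<close>)
        thus ?thesis using 2 w1[of i] less.prems by (intro exI[of _ "e i"]) (auto simp: w_def Q_def)
      next
        case 3
        have i: "i + Suc (Suc l) \<le> N" using less.prems 3 by simp
        have IL: "I (i + Suc l) 1 \<in> continuable" using i by (intro I_continuable) auto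
        obtain \<delta> where \<delta>: "w (I i (Suc (Suc l))) = (\<lambda>x. (I i (Suc (Suc l)) x + e i * I (i + Suc l) 1 x) + \<delta> * one x)"
        proof (rule same_derivative)
          show "w (I i (Suc (Suc l))) \<in> holo" using aut_continuable[OF a(2) I_continuable[OF i]] continuable_holo by blast
          show "(\<lambda>x. I i (Suc (Suc l)) x + e i * I (i + Suc l) 1 x) \<in> holo"
            by (intro continuable_holo continuable_add_scaled I_continuable i IL)
          fix x assume x: "x \<in> \<Omega>"
          have "(I (i + Suc l) 1 has_field_derivative 1 / (x - t (i + Suc l))) (at x)"
            using I_Suc[of "i + Suc l" 0 x] i x by (simp add: I_0 res_def)
          hence "((\<lambda>x. I i (Suc (Suc l)) x + e i * I (i + Suc l) 1 x) has_field_derivative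
              (I i (Suc l) x / (x - t (i + Suc l)) + e i * (1 / (x - t (i + Suc l))))) (at x)"
            by (intro DERIV_add DERIV_cmult I_Suc i x)
          also have "I i (Suc l) x / (x - t (i + Suc l)) + e i * (1 / (x - t (i + Suc l))) = slit_deriv (w (I i (Suc (Suc l)))) x"
            unfolding slit_deriv_aut_I[OF a(2) i x] using w1[of i] i x by (simp add: w_def res_def add_divide_distrib)
          finally show "((\<lambda>x. I i (Suc (Suc l)) x + e i * I (i + Suc l) 1 x) has_field_derivative
              slit_deriv (w (I i (Suc (Suc l)))) x) (at x)" .
        qed blast
        have \<kappa>1: "\<kappa> 1 = q i"
        proof -
          have "\<phi> (I i 1) = (\<lambda>x. I i 1 x + \<kappa> 1 * one x)"
            using \<kappa>(2)[of 1] i \<kappa>(1) I_0[of "Suc i"] by simp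
          moreover have "\<phi> (I i 1) = (\<lambda>x. I i 1 x + q i * one x)"
            using loop_letter[of i p] i p by (simp add: \<phi>_def q_def)
          ultimately have "\<And>x. \<kappa> 1 * one x = q i * one x" by (metis add_left_cancel)
          thus ?thesis using one_nonzero by (metis mult_right_cancel)
        qed
        have "w R = (\<lambda>x. \<Sum>m\<in>{0<..n}. \<kappa> m * w (I (i + m) (n - m)) x)"
          unfolding R_def by (rule aut_lincomb[OF a(2)]) (use AA' in auto)
        also have "\<dots> = (\<lambda>x. \<Sum>m\<in>{0<..n}. \<kappa> m * I (i + m) (n - m) x + (if m = 1 then q i * e (Suc i) * one x else 0))"
        proof (intro ext sum.cong refl)
          fix x m assume m: "m \<in> {0<..n}"
          show "\<kappa> m * w (I (i + m) (n - m)) x = \<kappa> m * I (i + m) (n - m) x + (if m = 1 then q i * e (Suc i) * one x else 0)"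
          proof (cases "m = 1")
            case True
            thus ?thesis using w1[of "Suc i"] i 3 \<kappa>1 by (simp add: w_def algebra_simps)
          next
            case False
            hence "n - m \<le> l" "i + m + (n - m) \<le> N" using 3 m i by auto
            thus ?thesis using w0[of "n - m" "i + m"] False by (simp add: w_def)
          qed
        qed
        also have "\<dots> = (\<lambda>x. R x + q i * e (Suc i) * one x)"
          using 3 by (simp add: R_def sum.distrib)
        finally have "w R = (\<lambda>x. R x + q i * e (Suc i) * one x)" .
        thus ?thesis using \<delta> 3 by (intro exI[of _ \<delta>]) (simp add: Q_def add.assoc)
      qed
    qed
    then obtain \<delta> where wI: "w (I i n) = (\<lambda>x. I i n x + (Q x + \<delta> * one x))"
      and wR: "w R = (\<lambda>x. R x + (if n = Suc (Suc l) then q i * e (Suc i) else 0) * one x)" by blast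
    define S where "S = (\<lambda>x. Q x + \<delta> * one x)"
    have SAA: "S \<in> continuable \<and> \<phi> S = (\<lambda>x. S x + (if n = Suc (Suc l) then e i * q (i + Suc l) else 0) * one x) \<and> u S = S"
    proof (cases "n = Suc (Suc l)")
      case True
      have i: "i + Suc (Suc l) \<le> N" using less.prems True by simp
      have IL: "I (i + Suc l) 1 \<in> continuable" using i by (intro I_continuable) auto
      have S: "S = (\<lambda>x. \<delta> * one x + e i * I (i + Suc l) 1 x)" using True by (simp add: S_def Q_def add.commute)
      have "\<phi> (I (i + Suc l) 1) = (\<lambda>x. I (i + Suc l) 1 x + q (i + Suc l) * one x)"
        using loop_letter[of "i + Suc l" p] i p by (simp add: \<phi>_def q_def)
      moreover have "u (I (i + Suc l) 1) = I (i + Suc l) 1"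
        using low[of "Suc l"] True by simp
      moreover have lin: "\<theta> S = (\<lambda>x. \<delta> * one x + e i * \<theta> (I (i + Suc l) 1) x)" if "aut \<theta>" for \<theta>
        unfolding S using aut_add_scaled[OF that continuable_scale(1)[OF one_continuable] IL, of \<delta> "e i"]
        by (simp add: continuable_scale(2)[OF one_continuable that] aut_one[OF that])
      ultimately have "\<phi> S = (\<lambda>x. S x + e i * q (i + Suc l) * one x)" "u S = S"
        unfolding lin[OF a(1)] lin[OF a(3)] by (auto simp: S fun_eq_iff algebra_simps)
      moreover have "S \<in> continuable" unfolding S by (intro continuable_add_scaled continuable_scale one_continuable IL)
      ultimately show ?thesis using True by simp
    next
      case False
      hence "S = (\<lambda>x. \<delta> * one x)" by (simp add: S_def Q_def)
      thus ?thesis using False a by (simp add: continuable_scale one_continuable aut_one)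
    qed
    define T where "T = (\<lambda>x. I i n x + R x)"
    have TAA: "T \<in> continuable" unfolding T_def by (intro continuable_add IAA RAA)
    define \<rho> where "\<rho> = (if n = Suc (Suc l) then q i * e (Suc i) else 0)"
    have wT: "w T = (\<lambda>x. (T x + S x) + \<rho> * one x)"
      unfolding T_def autD(2)[OF a(2) IAA RAA] wI wR S_def \<rho>_def by (simp add: fun_eq_iff algebra_simps)
    have SA: "S \<in> continuable" "u S = S" using SAA by auto
    have uT: "u T = (\<lambda>x. u (I i n) x + R x)" unfolding T_def autD(2)[OF a(3) IAA RAA] uR ..
    \<comment> \<open>The undetermined \<open>\<delta>\<close> is part of \<open>S\<close>. As
      \<open>u\<close> fixes \<open>S\<close>, it occurs on both sides of
      \<open>u (w T) = \<phi> (w (I i n))\<close> and cancels.\<close>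
    have 1: "u (w T) = (\<lambda>x. ((u (I i n) x + R x) + S x) + \<rho> * one x)"
      unfolding wT aut_add_scaled[OF a(3) continuable_add[OF TAA SA(1)] one_continuable] autD(2)[OF a(3) TAA SA(1)]
        aut_one[OF a(3)] SA(2) uT ..
    have "\<phi> (w (I i n)) = (\<lambda>x. T x + (S x + (if n = Suc (Suc l) then e i * q (i + Suc l) else 0) * one x))"
    proof -
      have "w (I i n) = (\<lambda>x. I i n x + S x)" by (simp add: wI S_def)
      moreover have "\<phi> S = (\<lambda>x. S x + (if n = Suc (Suc l) then e i * q (i + Suc l) else 0) * one x)"
        using SAA by blast
      ultimately show ?thesis by (simp only: autD(2)[OF a(1) IAA SA(1)] \<phi>I T_def)
    qed
    moreover have "u (w T) = \<phi> (w (I i n))"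
      using u[OF IAA] by (simp add: \<phi>I T_def)
    ultimately have "u (I i n) x = I i n x + (if n = Suc (Suc l) then \<epsilon> i else 0) * one x" for x
      using fun_cong[OF 1, of x] by (simp add: T_def \<rho>_def \<epsilon>_def algebra_simps split: if_splits)
    thus ?case by blast
  qed
  have "\<epsilon> p \<noteq> 0" using e k_pos p by (simp add: \<epsilon>_def q_def)
  moreover have "N - 1 - Suc l = p" using p by simp
  moreover have "u (I i n) = I i n" if "n \<le> Suc l" "i + n \<le> N" for i n
    using key[of n i] that by simp
  moreover have "u (I i (Suc (Suc l))) = (\<lambda>x. I i (Suc (Suc l)) x + \<epsilon> i * one x)" if "i + Suc (Suc l) \<le> N" for i
    using key[of "Suc (Suc l)" i] that by simp
  ultimately show ?case unfolding u_def[symmetric] by blast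
qed

lemma iter_comm_moves_I: "iter_comm (N - 1) (I 0 N) \<noteq> I 0 N"
proof -
  obtain e where e: "\<And>i. i + Suc (N - 1) \<le> N \<longrightarrow> iter_comm (N - 1) (I i (Suc (N - 1))) = (\<lambda>x. I i (Suc (N - 1)) x + e i * one x)"
    "e (N - 1 - (N - 1)) \<noteq> 0" using iter_comm_I[of "N - 1"] N_pos by auto
  hence "iter_comm (N - 1) (I 0 N) = (\<lambda>x. I 0 N x + e 0 * one x)" using N_pos e(1)[of 0] by simp
  thus ?thesis using e(2) one_nonzero by (auto simp: fun_eq_iff)
qed

end

section \<open>Iterated integrals as G-functions\<close>

lemma multiplicity_eq_card:
  fixes p :: nat
  assumes "prime p" "n > 0" "n \<le> K"
  shows "multiplicity p n = card {k \<in> {1..K}. p ^ k dvd n}"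
proof -
  have "multiplicity p n < p ^ multiplicity p n" using prime_gt_1_nat[OF assms(1)] by (intro power_gt_expt) simp
  also have "\<dots> \<le> n" using multiplicity_dvd assms(2) by (rule dvd_imp_le)
  finally have "multiplicity p n < n" .
  moreover have "p ^ k dvd n \<longleftrightarrow> k \<le> multiplicity p n" for k
    by (rule power_dvd_iff_le_multiplicity) (use assms prime_gt_1_nat[of p] in auto)
  ultimately have "k \<in> {k \<in> {1..K}. p ^ k dvd n} \<longleftrightarrow> k \<in> {1..multiplicity p n}" for k
    using assms(3) by auto
  hence "{k \<in> {1..K}. p ^ k dvd n} = {1..multiplicity p n}" by (rule set_eqI)
  thus ?thesis by simp
qed

text \<open>Legendre's formula: \<open>n div p ^ k\<close> grows at \<open>Suc n\<close> exactly
  when \<open>p ^ k\<close> divides \<open>Suc n\<close>. The upper limit \<open>K\<close> is free,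
  so that the sums for \<open>n\<close> and for \<open>n div 2\<close> can be compared over the same
  range.\<close>

lemma multiplicity_fact:
  fixes p :: nat
  assumes "prime p" "n \<le> K"
  shows "multiplicity p (fact n :: nat) = (\<Sum>k\<in>{1..K}. n div p ^ k)"
  using assms(2)
proof (induction n)
  case (Suc n)
  have "multiplicity p (fact (Suc n) :: nat) = multiplicity p (Suc n) + multiplicity p (fact n :: nat)"
    using assms by (simp add: prime_elem_multiplicity_mult_distrib del: mult_Suc)
  also have "multiplicity p (Suc n) = (\<Sum>k\<in>{1..K}. if p ^ k dvd Suc n then 1 else 0)"
    using multiplicity_eq_card[OF assms(1), of "Suc n" K] Suc.prems
    by (simp add: sum.If_cases Int_def conj_commute)
  also have "multiplicity p (fact n :: nat) = (\<Sum>k\<in>{1..K}. n div p ^ k)" using Suc by simp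
  also have "(\<Sum>k\<in>{1..K}. if p ^ k dvd Suc n then 1 else 0) + \<dots> = (\<Sum>k\<in>{1..K}. Suc n div p ^ k)"
    unfolding sum.distrib[symmetric] by (rule sum.cong) (simp_all add: div_Suc dvd_eq_mod_eq_0)
  finally show ?case .
qed auto

text \<open>Chebyshev's argument: by Legendre's formula a prime power \<open>p\<^sup>a\<close> with \<open>n / 2 < p\<^sup>a \<le> n\<close>
  forces \<open>p\<close> to divide \<open>n! / (\<lfloor>n / 2\<rfloor>!)\<^sup>2\<close>.\<close>

lemma Lcm_dvd_half:
  fixes n :: nat
  assumes C: "fact n = (fact (n div 2))\<^sup>2 * C"
  shows "Lcm {1..n} dvd Lcm {1..n div 2} * C"
proof (rule Lcm_least)
  fix j assume j: "j \<in> {1..n}"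
  define m where "m = n div 2"
  have "C \<noteq> 0" using C by (metis fact_nonzero mult_zero_right)
  have Lm: "Lcm {1..m} \<noteq> 0" by (auto simp: Lcm_0_iff)
  show "j dvd Lcm {1..n div 2} * C"
  proof (rule multiplicity_le_imp_dvd)
    fix p :: nat assume p: "prime p"
    define a where "a = multiplicity p j"
    have "p ^ a dvd j" by (simp add: a_def multiplicity_dvd)
    hence pa: "p ^ a \<le> n" using j by (meson atLeastAtMost_iff dvd_imp_le le_trans less_le_trans zero_less_one)
    have "p ^ a dvd Lcm {1..m} * C"
    proof (cases "p ^ a \<le> m")
      case True
      hence "p ^ a dvd Lcm {1..m}" using p by (intro dvd_Lcm) (auto simp: Suc_le_eq prime_gt_0_nat)
      thus ?thesis by simp
    next
      case False
      show ?thesis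
      proof (cases a)
        case (Suc b)
        \<comment> \<open>Here \<open>p ^ a\<close> exceeds \<open>m\<close>, but
          \<open>p ^ b\<close> with \<open>b = a - 1\<close> does not. So \<open>p ^ b\<close>
          divides the smaller \<open>Lcm\<close>, and the missing factor \<open>p\<close> has to
          come from \<open>C\<close>.\<close>
        have "2 * p ^ b \<le> p * p ^ b" using prime_ge_2_nat[OF p] by (rule mult_right_mono) simp
        hence "2 * p ^ b \<le> n" using pa unfolding Suc power_Suc by (rule order_trans)
        hence "p ^ b \<le> m" by (simp add: m_def)
        hence "p ^ b dvd Lcm {1..m}" using p by (intro dvd_Lcm) (auto simp: Suc_le_eq prime_gt_0_nat)
        moreover have "p dvd C"
        proof -
          have "2 * multiplicity p (fact m :: nat) + multiplicity p C = multiplicity p (fact n :: nat)"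
            using p \<open>C \<noteq> 0\<close> unfolding C m_def
            by (simp add: prime_elem_multiplicity_mult_distrib prime_elem_multiplicity_power_distrib)
          also have "\<dots> = (\<Sum>k\<in>{1..n}. n div p ^ k)" by (rule multiplicity_fact[OF p]) simp
          also have "\<dots> = (\<Sum>k\<in>{1..n}. 2 * (m div p ^ k) + (n div p ^ k) mod 2)"
          proof (rule sum.cong[OF refl])
            fix k
            have "m div p ^ k = (n div p ^ k) div 2" by (simp add: m_def div_mult2_eq[symmetric] mult.commute)
            thus "n div p ^ k = 2 * (m div p ^ k) + (n div p ^ k) mod 2" by simp
          qed
          also have "\<dots> = 2 * multiplicity p (fact m :: nat) + (\<Sum>k\<in>{1..n}. (n div p ^ k) mod 2)"
            using multiplicity_fact[OF p, of m n] by (simp add: sum.distrib sum_distrib_left m_def)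
          finally have "multiplicity p C = (\<Sum>k\<in>{1..n}. (n div p ^ k) mod 2)" by simp
          moreover have "1 \<le> (\<Sum>k\<in>{1..n}. (n div p ^ k) mod 2)"
          proof -
            have "a < p ^ a" using prime_gt_1_nat[OF p] by (intro power_gt_expt) simp
            hence "a \<in> {1..n}" using pa Suc by auto
            have "n div p ^ a = 1"
              using pa False by (intro div_nat_eqI) (auto simp: m_def)
            hence "1 = (n div p ^ a) mod 2" by simp
            also have "\<dots> \<le> (\<Sum>k\<in>{1..n}. (n div p ^ k) mod 2)"
              by (rule member_le_sum[OF \<open>a \<in> {1..n}\<close>]) auto
            finally show ?thesis .
          qed
          ultimately have "multiplicity p C \<ge> 1" by simp
          thus "p dvd C" using multiplicity_dvd'[of 1 p C] by simp
        qed
        ultimately show ?thesis using mult_dvd_mono[of "p ^ b" _ p C] by (simp only: Suc power_Suc2)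
      qed auto
    qed
    thus "multiplicity p j \<le> multiplicity p (Lcm {1..n div 2} * C)"
      unfolding a_def[symmetric] m_def[symmetric] using \<open>C \<noteq> 0\<close> Lm p
      by (intro multiplicity_geI) auto
  qed (use j in auto)
qed

text \<open>The base 16 closes the recursion by halving: the quotient \<open>C\<close> is at most
  4^n, and 16^m * 4^n is at most 16^n because 2m is at most n.\<close>

lemma Lcm_upto_le: "Lcm {1..n} \<le> (16 :: nat) ^ n"
proof (induction n rule: less_induct)
  case (less n)
  show ?case
  proof (cases "n = 0")
    case False
    define m where "m = n div 2"
    have m: "m < n" "m \<le> n" using False by (auto simp: m_def)
    have f: "fact n = fact m * fact (n - m) * (n choose m)" using binomial_fact_lemma[OF m(2)] by simp
    have "n - m = m \<or> n - m = Suc m" by (auto simp: m_def)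
    hence "\<exists>q\<le>Suc m. fact (n - m) = fact m * q"
      by (auto intro: exI[of _ "1::nat"] exI[of _ "Suc m"])
    then obtain q where q: "q \<le> Suc m" "fact (n - m) = fact m * q" by auto
    define C where "C = q * (n choose m)"
    have fC: "fact n = (fact (n div 2))\<^sup>2 * C"
      using f q by (simp add: C_def m_def[symmetric] power2_eq_square)
    hence "Lcm {1..n} dvd Lcm {1..m} * C" unfolding m_def by (rule Lcm_dvd_half)
    moreover have "Lcm {1..m} * C > 0"
    proof -
      have "C \<noteq> 0" using fC by (metis fact_nonzero mult_zero_right)
      thus ?thesis by (auto simp: Lcm_0_iff intro!: Nat.gr0I)
    qed
    ultimately have "Lcm {1..n} \<le> Lcm {1..m} * C" by (rule dvd_imp_le)
    also have "\<dots> \<le> 16 ^ m * (2 ^ n * 2 ^ n)"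
      unfolding C_def
    proof (intro mult_mono less.IH m binomial_le_pow2)
      have "q \<le> n" using q m by auto
      thus "q \<le> 2 ^ n" using less_exp[of n] by linarith
    qed auto
    also have "(16 :: nat) ^ m = 2 ^ (4 * m)" by (simp add: power_mult)
    also have "2 ^ (4 * m) * (2 ^ n * 2 ^ n) \<le> (2 :: nat) ^ (4 * n)"
      unfolding power_add[symmetric] by (intro power_increasing) (auto simp: m_def)
    also have "\<dots> = 16 ^ n" by (simp add: power_mult)
    finally show ?thesis .
  qed simp
qed

text \<open>The expansion at \<open>0\<close> of \<open>dx / (x - 1 / (j + 1))\<close>, and of the iterated integral of these forms
  for \<open>j = i, \<dots>, i + n - 1\<close>.\<close>

definition dlog :: "nat \<Rightarrow> complex fps" where
  "dlog j = Abs_fps (\<lambda>l. - (of_nat (Suc j) ^ Suc l))"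

primrec hyperlog :: "nat \<Rightarrow> nat \<Rightarrow> complex fps" where
  "hyperlog i 0 = 1"
| "hyperlog i (Suc n) = fps_integral0 (hyperlog i n * dlog (i + n))"

lemma dlog_mult: "dlog j * (fps_X - fps_const (1 / of_nat (Suc j))) = 1"
proof (rule fps_ext)
  fix l show "(dlog j * (fps_X - fps_const (1 / of_nat (Suc j)))) $ l = 1 $ l"
    by (cases l) (auto simp: dlog_def algebra_simps divide_simps simp del: of_nat_Suc)
qed

lemma hyperlog_Suc_nth:
  "hyperlog i (Suc n) $ 0 = 0"
  "hyperlog i (Suc n) $ Suc l =
     - (\<Sum>m\<le>l. hyperlog i n $ m * of_nat (Suc (i + n)) ^ Suc (l - m)) / of_nat (Suc l)"
  by (simp_all add: fps_integral_def fps_mult_nth dlog_def sum_negf atMost_atLeast0 divide_inverse mult.commute)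

lemma hyperlog_Rats: "hyperlog i n $ l \<in> \<rat>"
proof (induction n arbitrary: l)
  case (Suc n)
  show ?case using Suc by (cases l) (auto simp: hyperlog_Suc_nth simp del: hyperlog.simps(2) of_nat_Suc power_Suc intro!: Rats_divide Rats_sum Rats_mult Rats_power)
qed simp

text \<open>The convolution has \<open>l\<close> terms for the coefficient of index
  \<open>l\<close>, and integration divides by \<open>l\<close>; the two effects cancel, so the
  bound stays geometric.\<close>

lemma hyperlog_norm_le:
  assumes "N \<ge> 1"
  shows "i + n \<le> N \<Longrightarrow> norm (hyperlog i n $ l) \<le> (real N ^ n) ^ l"
proof (induction n arbitrary: l)
  case (Suc n)
  show ?case
  proof (cases l)
    case (Suc l')
    have "norm (\<Sum>m\<le>l'. hyperlog i n $ m * of_nat (Suc (i + n)) ^ Suc (l' - m)) \<le> (\<Sum>m\<le>l'. (real N ^ Suc n) ^ Suc l')"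
    proof (rule sum_norm_le)
      fix m assume m: "m \<in> {..l'}"
      have "norm (hyperlog i n $ m * of_nat (Suc (i + n)) ^ Suc (l' - m)) \<le> (real N ^ n) ^ m * real N ^ Suc (l' - m)"
        unfolding norm_mult norm_power norm_of_nat
        using Suc.prems Suc.IH[of m] by (intro mult_mono power_mono) auto
      also have "\<dots> = real N ^ (n * m + Suc (l' - m))" by (simp add: power_mult[symmetric] power_add)
      also have "\<dots> \<le> real N ^ (Suc n * Suc l')"
      proof (rule power_increasing)
        have "n * m \<le> n * Suc l'" using m by (intro mult_le_mono2) auto
        thus "n * m + Suc (l' - m) \<le> Suc n * Suc l'" using m by simp
      qed (use assms in auto)
      finally show "norm (hyperlog i n $ m * of_nat (Suc (i + n)) ^ Suc (l' - m)) \<le> (real N ^ Suc n) ^ Suc l'"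
        by (simp only: power_mult)
    qed
    hence "norm (hyperlog i (Suc n) $ l) \<le> (\<Sum>m\<le>l'. (real N ^ Suc n) ^ Suc l') / real (Suc l')"
      unfolding Suc hyperlog_Suc_nth(2) norm_divide norm_of_nat norm_minus_cancel
      by (intro divide_right_mono) auto
    also have "\<dots> = (real N ^ Suc n) ^ l" unfolding Suc by (simp del: power_Suc of_nat_Suc)
    finally show ?thesis .
  qed (simp add: hyperlog_Suc_nth del: hyperlog.simps(2))
qed auto

text \<open>Multiplication by the form involves only integers. Each of the \<open>n\<close>
  integrations divides by one number up to \<open>l\<close>, which costs one factor
  \<open>d\<close>.\<close>

lemma hyperlog_denominator:
  "(\<And>j. j \<in> {1..l} \<Longrightarrow> j dvd d) \<Longrightarrow> of_nat d ^ n * hyperlog i n $ l \<in> \<int>"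
proof (induction n arbitrary: l)
  case (Suc n)
  show ?case
  proof (cases l)
    case (Suc l')
    obtain q where q: "d = Suc l' * q" using Suc.prems[of "Suc l'"] Suc by auto
    have d: "of_nat d / of_nat (Suc l') = (of_nat q :: complex)" by (simp add: q del: of_nat_Suc mult_Suc)
    define S where "S = (\<Sum>m\<le>l'. hyperlog i n $ m * of_nat (Suc (i + n)) ^ Suc (l' - m))"
    have "of_nat d ^ Suc n * hyperlog i (Suc n) $ l = - (of_nat q * (of_nat d ^ n * S))"
      unfolding Suc hyperlog_Suc_nth(2) S_def[symmetric] d[symmetric]
      by (simp add: mult_ac del: of_nat_Suc)
    also have "of_nat d ^ n * S = (\<Sum>m\<le>l'. (of_nat d ^ n * hyperlog i n $ m) * of_nat (Suc (i + n)) ^ Suc (l' - m))"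
      by (simp only: S_def sum_distrib_left mult.assoc)
    also have "- (of_nat q * \<dots>) \<in> \<int>"
      using Suc.prems Suc by (intro Ints_minus Ints_mult Ints_sum Ints_power Suc.IH) auto
    finally show ?thesis .
  qed (simp add: hyperlog_Suc_nth del: hyperlog.simps(2))
qed simp

section \<open>Linear differential equations for the iterated integrals\<close>

definition rat_poly :: "complex poly \<Rightarrow> bool" where
  "rat_poly P \<longleftrightarrow> (\<forall>i. coeff P i \<in> \<rat>)"

lemma rat_poly_intros:
  "rat_poly 0" "rat_poly 1" "q \<in> \<rat> \<Longrightarrow> rat_poly [:q:]" "rat_poly P \<Longrightarrow> rat_poly Q \<Longrightarrow> rat_poly (P + Q)"
  "rat_poly P \<Longrightarrow> q \<in> \<rat> \<Longrightarrow> rat_poly (pCons q P)"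
  "rat_poly P \<Longrightarrow> rat_poly Q \<Longrightarrow> rat_poly (P * Q)" "rat_poly P \<Longrightarrow> rat_poly (pderiv P)"
  by (auto simp: rat_poly_def coeff_1 coeff_pCons coeff_mult coeff_pderiv intro!: Rats_sum Rats_mult Rats_add split: nat.splits)

lemma rat_poly_Qbar: "rat_poly P \<Longrightarrow> P \<in> Qbar_poly"
  by (auto simp: rat_poly_def Qbar_poly_def Qbar_def rat_imp_algebraic)

lemma poly_Qbar_ratfun:
  assumes "P \<in> Qbar_poly"
  shows "fls_of_poly P \<in> Qbar_ratfun"
  unfolding Qbar_ratfun_def using assms rat_poly_Qbar[OF rat_poly_intros(3)[of 1]]
  by (intro CollectI exI[of _ P] exI[of _ "[:1:]"]) auto

definition diff_op :: "nat \<Rightarrow> (nat \<Rightarrow> complex poly) \<Rightarrow> complex fps \<Rightarrow> complex fps" where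
  "diff_op r p f = (\<Sum>k\<le>r. fps_of_poly (p k) * (fps_deriv ^^ k) f)"

lemma fls_deriv_funpow: "(fls_deriv ^^ k) (fps_to_fls f) = fps_to_fls ((fps_deriv ^^ k) f)"
  by (induction k) (auto simp: fls_deriv_fps_to_fls)

lemma fps_to_fls_sum: "fps_to_fls (\<Sum>k\<in>A. f k) = (\<Sum>k\<in>A. fps_to_fls (f k))"
  by (induction A rule: infinite_finite_induct) auto

lemma fps_of_poly_eq_0_iff: "fps_of_poly p = 0 \<longleftrightarrow> p = 0"
  using fps_of_poly_eq_iff[of p 0] by simp

lemma fps_to_fls_diff_op:
  "fps_to_fls (diff_op r p f) = (\<Sum>k\<le>r. fls_of_poly (p k) * (fls_deriv ^^ k) (fps_to_fls f))"
  by (simp add: diff_op_def fls_deriv_funpow fls_times_fps_to_fls fps_to_fls_sum)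

lemma fps_of_poly_of_nat: "fps_of_poly (of_nat k) = (of_nat k :: complex fps)"
  by (induction k) (auto simp: fps_of_poly_add)

text \<open>Leibniz's rule, in which the higher derivatives of \<open>g\<close> vanish. For
  \<open>k = 0\<close> the truncated \<open>k - 1\<close> is harmless, since its factor is
  0.\<close>

lemma fps_deriv_linear_mult:
  fixes f g :: "complex fps"
  assumes "fps_deriv g = 1"
  shows "(fps_deriv ^^ k) (g * f) = g * (fps_deriv ^^ k) f + of_nat k * (fps_deriv ^^ (k - 1)) f"
proof (induction k)
  case (Suc k)
  thus ?case by (cases k) (simp_all add: assms algebra_simps)
qed simp

text \<open>The inhomogeneous equation passes from one length to the next by substituting
  \<open>hyperlog i n = (x - a) f'\<close>, where \<open>f\<close> is the next integral.\<close>

lemma hyperlog_ode: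
  "\<exists>p. (\<forall>k. rat_poly (p k)) \<and> p n \<noteq> 0 \<and> diff_op n p (hyperlog i n) = 1"
proof (induction n)
  case 0
  show ?case by (rule exI[of _ "\<lambda>_. 1"]) (auto simp: diff_op_def rat_poly_def coeff_1)
next
  case (Suc n)
  then obtain p where p: "\<And>k. rat_poly (p k)" "p n \<noteq> 0" "diff_op n p (hyperlog i n) = 1" by auto
  define a :: complex where "a = 1 / of_nat (Suc (i + n))"
  define f where "f = hyperlog i (Suc n)"
  have "(fps_X - fps_const a) * fps_deriv f = hyperlog i n * (dlog (i + n) * (fps_X - fps_const a))"
    by (simp add: f_def fps_deriv_fps_integral mult_ac)
  hence f: "hyperlog i n = (fps_X - fps_const a) * fps_deriv f"
    unfolding a_def dlog_mult by simp
  \<comment> \<open>By Leibniz's rule the k-th derivative of (x - a) f' is (x - a) f^(k+1) + k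
    f^(k); the two summands of \<open>p'\<close> collect these two kinds of terms.\<close>
  define p' where "p' = (\<lambda>k. (case k of 0 \<Rightarrow> 0 | Suc l \<Rightarrow> [:- a, 1:] * p l) + (if k \<le> n then of_nat k * p k else 0))"
  have "a \<in> \<rat>" by (simp add: a_def Rats_divide)
  have lin: "fps_of_poly [:- a, 1:] = fps_X - fps_const a"
    by (simp add: fps_of_poly_pCons fps_const_neg[symmetric] del: fps_const_neg)
  have "diff_op (Suc n) p' f =
      (\<Sum>k\<le>Suc n. fps_of_poly (case k of 0 \<Rightarrow> 0 | Suc l \<Rightarrow> [:- a, 1:] * p l) * (fps_deriv ^^ k) f) +
      (\<Sum>k\<le>Suc n. fps_of_poly (if k \<le> n then of_nat k * p k else 0) * (fps_deriv ^^ k) f)"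
    by (simp add: diff_op_def p'_def fps_of_poly_add distrib_right sum.distrib)
  also have "(\<Sum>k\<le>Suc n. fps_of_poly (case k of 0 \<Rightarrow> 0 | Suc l \<Rightarrow> [:- a, 1:] * p l) * (fps_deriv ^^ k) f)
      = (\<Sum>k\<le>n. fps_of_poly (p k) * ((fps_X - fps_const a) * (fps_deriv ^^ k) (fps_deriv f)))"
    unfolding sum.atMost_Suc_shift nat.case fps_of_poly_0 mult_zero_left add_0_left
    by (rule sum.cong) (simp_all only: fps_of_poly_mult lin funpow_Suc_right o_apply mult_ac)
  also have "(\<Sum>k\<le>Suc n. fps_of_poly (if k \<le> n then of_nat k * p k else 0) * (fps_deriv ^^ k) f)
      = (\<Sum>k\<le>n. fps_of_poly (p k) * (of_nat k * (fps_deriv ^^ (k - 1)) (fps_deriv f)))"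
  proof -
    have "(fps_deriv ^^ k) f = (fps_deriv ^^ (k - 1)) (fps_deriv f)" if "k > 0" for k
      using that by (cases k) (auto simp: funpow_swap1)
    hence "fps_of_poly (of_nat k * p k) * (fps_deriv ^^ k) f = fps_of_poly (p k) * (of_nat k * (fps_deriv ^^ (k - 1)) (fps_deriv f))" for k
      by (cases "k = 0") (auto simp: fps_of_poly_mult fps_of_poly_of_nat)
    thus ?thesis by simp
  qed
  also have "(\<Sum>k\<le>n. fps_of_poly (p k) * ((fps_X - fps_const a) * (fps_deriv ^^ k) (fps_deriv f))) +
     (\<Sum>k\<le>n. fps_of_poly (p k) * (of_nat k * (fps_deriv ^^ (k - 1)) (fps_deriv f))) = diff_op n p (hyperlog i n)"
    by (simp add: f fps_deriv_linear_mult[of "fps_X - fps_const a"] diff_op_def distrib_left sum.distrib)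
  finally have "diff_op (Suc n) p' f = 1" using p by simp
  moreover have "p' (Suc n) \<noteq> 0" using p(2) by (simp add: p'_def del: mult_pCons_left)
  moreover have "rat_poly (of_nat k)" for k by (auto simp: rat_poly_def of_nat_poly coeff_pCons split: nat.splits)
  hence "rat_poly (p' k)" for k
    unfolding p'_def using p(1) \<open>a \<in> \<rat>\<close> by (auto split: nat.splits intro!: rat_poly_intros simp del: mult_pCons_left)
  ultimately show ?case unfolding f_def by blast
qed

text \<open>Differentiating once removes the right-hand side 1.\<close>

lemma satisfies_linear_ode_hyperlog: "satisfies_linear_ode (hyperlog i n)"
proof -
  obtain p where p: "\<And>k. rat_poly (p k)" "p n \<noteq> 0" "diff_op n p (hyperlog i n) = 1"
    using hyperlog_ode by blast
  define p' where "p' = (\<lambda>k. (case k of 0 \<Rightarrow> 0 | Suc l \<Rightarrow> p l) + (if k \<le> n then pderiv (p k) else 0))"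
  let ?f = "hyperlog i n"
  have "diff_op (Suc n) p' ?f =
      (\<Sum>k\<le>Suc n. fps_of_poly (case k of 0 \<Rightarrow> 0 | Suc l \<Rightarrow> p l) * (fps_deriv ^^ k) ?f) +
      (\<Sum>k\<le>Suc n. fps_of_poly (if k \<le> n then pderiv (p k) else 0) * (fps_deriv ^^ k) ?f)"
    by (simp add: diff_op_def p'_def fps_of_poly_add distrib_right sum.distrib)
  also have "\<dots> = (\<Sum>k\<le>n. fps_of_poly (p k) * (fps_deriv ^^ Suc k) ?f) + (\<Sum>k\<le>n. fps_of_poly (pderiv (p k)) * (fps_deriv ^^ k) ?f)"
    unfolding sum.atMost_Suc_shift[of "\<lambda>k. fps_of_poly (case k of 0 \<Rightarrow> 0 | Suc l \<Rightarrow> p l) * (fps_deriv ^^ k) ?f"] by simp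
  also have "\<dots> = fps_deriv (diff_op n p ?f)"
    by (simp add: diff_op_def fps_of_poly_pderiv sum.distrib fps_deriv_sum algebra_simps)
  finally have "diff_op (Suc n) p' ?f = 0" using p by simp
  hence "(\<Sum>k\<le>Suc n. fls_of_poly (p' k) * (fls_deriv ^^ k) (fps_to_fls ?f)) = 0"
    using fps_to_fls_diff_op[of "Suc n" p' ?f] by (simp del: sum.atMost_Suc)
  moreover have "fls_of_poly (p' k) \<in> Qbar_ratfun" for k
    using p(1) by (auto simp: p'_def split: nat.splits intro!: poly_Qbar_ratfun rat_poly_Qbar rat_poly_intros)
  moreover have "fls_of_poly (p' (Suc n)) \<noteq> 0" using p(2) by (simp add: p'_def fps_of_poly_eq_0_iff)
  ultimately show ?thesis
    unfolding satisfies_linear_ode_def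
    by (intro exI[of _ "Suc n"] exI[of _ "\<lambda>k. fls_of_poly (p' k)"] conjI) auto
qed

lemma G_function_hyperlog: "G_function (hyperlog i n)"
  unfolding G_function_def
proof (intro conjI)
  show "hyperlog i n \<in> Qbar_fps"
    by (auto simp: Qbar_fps_def Qbar_def intro!: rat_imp_algebraic hyperlog_Rats)
  define N where "N = Suc (i + n)"
  show "\<exists>C>0. \<forall>\<sigma>\<in>Gal_Qbar. \<forall>l. norm (\<sigma> (hyperlog i n $ l)) \<le> C ^ (l + 1)"
  proof (intro exI[of _ "real N ^ n"] conjI ballI allI)
    fix \<sigma> l assume "\<sigma> \<in> Gal_Qbar"
    hence "\<sigma> (hyperlog i n $ l) = hyperlog i n $ l" using hyperlog_Rats by (auto simp: Gal_Qbar_def)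
    hence "norm (\<sigma> (hyperlog i n $ l)) \<le> (real N ^ n) ^ l"
      using hyperlog_norm_le[of N i n l] by (simp add: N_def)
    also have "\<dots> \<le> (real N ^ n) ^ (l + 1)" by (intro power_increasing one_le_power) (auto simp: N_def)
    finally show "norm (\<sigma> (hyperlog i n $ l)) \<le> (real N ^ n) ^ (l + 1)" .
  qed (simp add: N_def)
  show "\<exists>D>0. \<exists>d :: nat \<Rightarrow> int. \<forall>l. 1 \<le> d l \<and> real_of_int (d l) \<le> D ^ (l + 1) \<and>
        (\<forall>m\<le>l. algebraic_int (of_int (d l) * hyperlog i n $ m))"
  proof (intro exI[of _ "16 ^ n"] conjI exI[of _ "\<lambda>l. int (Lcm {1..l} ^ n)"] allI impI)
    fix l :: nat
    have pos: "Lcm {1..l} \<noteq> 0" by (auto simp: Lcm_0_iff)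
    hence "1 \<le> Lcm {1..l}" by linarith
    hence "1 \<le> Lcm {1..l} ^ n" by (rule one_le_power)
    thus "1 \<le> int (Lcm {1..l} ^ n)" by (metis of_nat_1 of_nat_le_iff)
    have "real (Lcm {1..l} ^ n) \<le> real ((16 ^ l) ^ n)"
      unfolding of_nat_le_iff by (intro power_mono Lcm_upto_le) auto
    also have "\<dots> = (16 ^ n) ^ l" by (simp add: power_mult[symmetric] mult.commute)
    also have "\<dots> \<le> (16 ^ n) ^ (l + 1)" by (intro power_increasing) auto
    finally show "real_of_int (int (Lcm {1..l} ^ n)) \<le> (16 ^ n) ^ (l + 1)" by simp
  next
    fix l m :: nat assume "m \<le> l"
    hence "of_nat (Lcm {1..l}) ^ n * hyperlog i n $ m \<in> \<int>"
      by (intro hyperlog_denominator dvd_Lcm) auto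
    thus "algebraic_int (of_int (int (Lcm {1..l} ^ n)) * hyperlog i n $ m)"
      by (intro int_imp_algebraic_int) simp
  qed simp
qed (rule satisfies_linear_ode_hyperlog)

section \<open>Differential equations for hypergeometric series\<close>

lemma fps_conv_radius_posI:
  assumes "f has_fps_expansion F"
  shows "fps_conv_radius F > 0"
  using assms by (simp add: has_fps_expansion_def)

lemmas eval_expansion = eval_fps_has_fps_expansion

lemma fps_conv_radius_pos_geometric:
  fixes F :: "complex fps"
  assumes "C > 0" "\<And>n. norm (F $ n) \<le> K * C ^ n"
  shows "fps_conv_radius F > 0"
proof -
  let ?z = "of_real (1 / (2 * C)) :: complex"
  have "summable (\<lambda>n. F $ n * ?z ^ n)"
  proof (rule summable_comparison_test[OF exI, OF allI, OF impI])
    fix n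
    have "norm (F $ n * ?z ^ n) = norm (F $ n) * (1 / (2 * C)) ^ n"
      using assms(1) by (simp add: norm_mult norm_power norm_divide)
    also have "\<dots> \<le> K * C ^ n * (1 / (2 * C)) ^ n"
      using assms by (intro mult_right_mono) auto
    also have "\<dots> = K * (1 / 2) ^ n"
      using assms(1) by (simp add: power_divide power_mult_distrib)
    finally show "norm (F $ n * ?z ^ n) \<le> K * (1 / 2) ^ n" .
    show "summable (\<lambda>n. K * (1 / 2) ^ n)" by (intro summable_mult summable_geometric) simp
  qed
  hence "norm ?z \<le> conv_radius (fps_nth F)" by (rule conv_radius_geI)
  moreover have "ereal (norm ?z) > 0" using assms(1) by simp
  ultimately show ?thesis unfolding fps_conv_radius_def by (rule less_le_trans[rotated])
qed

lemma fps_conv_radius_pos_ratio: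
  fixes F :: "complex fps"
  assumes "C > 0" "\<And>n. norm (F $ Suc n) \<le> C * norm (F $ n)"
  shows "fps_conv_radius F > 0"
proof -
  have "norm (F $ n) \<le> norm (F $ 0) * C ^ n" for n
  proof (induction n)
    case (Suc n)
    have "norm (F $ Suc n) \<le> C * (norm (F $ 0) * C ^ n)"
      using assms(2)[of n] mult_left_mono[OF Suc, of C] assms(1) by linarith
    thus ?case by (simp add: mult_ac)
  qed simp
  with assms(1) show ?thesis by (rule fps_conv_radius_pos_geometric)
qed

lemma G_function_conv_radius:
  assumes "G_function H"
  shows "fps_conv_radius H > 0"
proof -
  have "id \<in> Gal_Qbar" by (auto simp: Gal_Qbar_def)
  then obtain C where C: "C > 0" "\<And>n. norm (H $ n) \<le> C ^ (n + 1)"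
    using assms unfolding G_function_def by (metis id_apply)
  show ?thesis by (rule fps_conv_radius_pos_geometric[OF C(1), of H C]) (use C(2) in simp)
qed

section \<open>Equations with polynomial coefficients\<close>

lemma clear_denominators:
  fixes n :: nat
  assumes "\<And>i. i \<le> n \<Longrightarrow> c i \<in> Qbar_ratfun"
  shows "\<exists>D a. D \<noteq> 0 \<and> (\<forall>i\<le>n. fls_of_poly D * c i = fls_of_poly (a i))"
proof -
  have "\<exists>D a. D \<noteq> 0 \<and> (\<forall>i<m. fls_of_poly D * c i = fls_of_poly (a i))" if "m \<le> Suc n" for m
    using that
  proof (induction m)
    case (Suc m)
    then obtain D a where D: "D \<noteq> 0" "\<And>i. i < m \<Longrightarrow> fls_of_poly D * c i = fls_of_poly (a i)" by auto
    obtain P Q where PQ: "c m = fls_of_poly P / fls_of_poly Q" "Q \<noteq> 0"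
      using assms[of m] Suc.prems by (auto simp: Qbar_ratfun_def)
    have "fls_of_poly (D * Q) * c i = fls_of_poly (if i = m then D * P else Q * a i)" if "i < Suc m" for i
    proof (cases "i = m")
      case True
      thus ?thesis using PQ by (simp add: fps_of_poly_mult fls_times_fps_to_fls fps_of_poly_eq_0_iff)
    next
      case False
      hence "fls_of_poly Q * (fls_of_poly D * c i) = fls_of_poly Q * fls_of_poly (a i)" using that D(2)[of i] by simp
      thus ?thesis using False by (simp add: fps_of_poly_mult fls_times_fps_to_fls mult_ac)
    qed
    thus ?case using D(1) PQ(2)
      by (intro exI[of _ "D * Q"] exI[of _ "\<lambda>i. if i = m then D * P else Q * a i"]) auto
  qed (auto intro: exI[of _ 1])
  from this[of "Suc n"] show ?thesis by (simp add: less_Suc_eq_le)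
qed

lemma satisfies_linear_ode_polynomial:
  assumes "satisfies_linear_ode H"
  obtains r p where "r > 0" "p r \<noteq> 0" "diff_op r p H = 0"
proof -
  obtain r c where c: "\<And>i. i \<le> r \<Longrightarrow> c i \<in> Qbar_ratfun" "\<exists>i\<le>r. c i \<noteq> 0"
    "(\<Sum>i\<le>r. c i * (fls_deriv ^^ i) (fps_to_fls H)) = 0"
    using assms unfolding satisfies_linear_ode_def by blast
  obtain D p where D: "D \<noteq> 0" "\<And>i. i \<le> r \<Longrightarrow> fls_of_poly D * c i = fls_of_poly (p i)"
    using clear_denominators[of r c, OF c(1)] by auto
  have "fps_to_fls (diff_op r p H) = fls_of_poly D * (\<Sum>i\<le>r. c i * (fls_deriv ^^ i) (fps_to_fls H))"
    unfolding fps_to_fls_diff_op sum_distrib_left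
    by (rule sum.cong) (simp_all add: D(2)[symmetric] mult.assoc)
  hence p: "diff_op r p H = 0" using c(3) by simp
  define I where "I = {i. i \<le> r \<and> p i \<noteq> 0}"
  have I: "finite I" "I \<noteq> {}"
  proof -
    obtain i where i: "i \<le> r" "c i \<noteq> 0" using c(2) by blast
    hence "fls_of_poly D * c i \<noteq> 0" using D(1) by (simp add: fps_of_poly_eq_0_iff)
    hence "p i \<noteq> 0" unfolding D(2)[OF i(1)] by auto
    thus "I \<noteq> {}" using i by (auto simp: I_def)
  qed (simp add: I_def)
  define m where "m = Max I"
  have m: "m \<le> r" "p m \<noteq> 0" "\<And>i. i \<le> r \<Longrightarrow> m < i \<Longrightarrow> p i = 0"
  proof -
    have "m \<in> I" unfolding m_def using Max_in[OF I] .
    thus "m \<le> r" "p m \<noteq> 0" by (auto simp: I_def)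
    show "p i = 0" if "i \<le> r" "m < i" for i
    proof (rule ccontr)
      assume "p i \<noteq> 0"
      hence "i \<le> m" unfolding m_def using that by (intro Max_ge[OF I(1)]) (simp add: I_def)
      thus False using that by simp
    qed
  qed
  have "diff_op r p H = diff_op m p H"
    unfolding diff_op_def by (rule sum.mono_neutral_right) (use m in auto)
  hence m0: "diff_op m p H = 0" using p by simp
  show ?thesis
  proof (cases "m = 0")
    case True
    hence "H = 0" using m0 m(2) by (simp add: diff_op_def fps_of_poly_eq_0_iff)
    \<comment> \<open>An equation of order 0 forces H = 0. As a positive order is wanted, it is
      replaced by H' = 0, whose coefficients are 0 and 1.\<close>
    thus ?thesis by (intro that[of 1 "\<lambda>i. of_nat i"]) (auto simp: diff_op_def)
  qed (use m m0 that in auto)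
qed

lemma algebraic_over_ratfun_polynomial:
  assumes "algebraic_over_ratfun \<mu>"
  obtains n a where "a n \<noteq> 0" "(\<Sum>i\<le>n. fps_of_poly (a i) * \<mu> ^ i) = 0"
proof -
  obtain p where p: "p \<noteq> 0" "\<And>i. coeff p i \<in> Qbar_ratfun" "poly p (fps_to_fls \<mu>) = 0"
    using assms unfolding algebraic_over_ratfun_def by blast
  define n where "n = degree p"
  obtain D a where D: "D \<noteq> 0" "\<And>i. i \<le> n \<Longrightarrow> fls_of_poly D * coeff p i = fls_of_poly (a i)"
    using clear_denominators[of n "coeff p", OF p(2)] by auto
  have "fps_to_fls (\<Sum>i\<le>n. fps_of_poly (a i) * \<mu> ^ i) = fls_of_poly D * poly p (fps_to_fls \<mu>)"
    unfolding poly_altdef n_def[symmetric] fps_to_fls_sum sum_distrib_left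
    by (rule sum.cong) (simp_all add: D(2)[symmetric] fls_times_fps_to_fls fps_to_fls_power mult.assoc)
  hence "(\<Sum>i\<le>n. fps_of_poly (a i) * \<mu> ^ i) = 0" using p(3) by simp
  moreover have "fls_of_poly D * coeff p n \<noteq> 0" using D(1) p(1) by (auto simp: n_def fps_of_poly_eq_0_iff)
  hence "a n \<noteq> 0" using D(2)[of n] by auto
  ultimately show ?thesis using that by blast
qed

section \<open>The hypergeometric equation and the convergence of its solution\<close>

lemma foldl_mult_prod_list: "foldl (\<lambda>r a. r * f a) v xs = v * prod_list (map f xs)"
  for v :: "'a :: comm_monoid_mult"
  by (induction xs arbitrary: v) (auto simp: mult_ac)

lemma fps_XD_funpow_nth: "(fps_XD ^^ m) F $ n = of_nat n ^ m * F $ n"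
  for F :: "complex fps"
  by (induction m) (auto simp: mult_ac)

lemma linear_factors:
  fixes as :: "complex list"
  defines "p \<equiv> prod_list (map (\<lambda>a. [:a, 1:]) as)"
  shows "degree p = length as" "lead_coeff p = 1" "poly p x = prod_list (map (\<lambda>a. a + x) as)"
proof -
  show l: "lead_coeff p = 1" unfolding p_def by (induction as) (auto simp: lead_coeff_mult simp del: mult_pCons_left)
  show "poly p x = prod_list (map (\<lambda>a. a + x) as)" unfolding p_def by (induction as) (auto simp: algebra_simps)
  show "degree p = length as"
    unfolding p_def
  proof (induction as)
    case (Cons a as)
    have "prod_list (map (\<lambda>a. [:a, 1:]) as) \<noteq> 0" by (auto simp: prod_list_zero_iff)
    thus ?case using Cons by (simp add: degree_mult_eq del: mult_pCons_left)
  qed auto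
qed

lemma poly_as_sum_upto: "degree (p :: complex poly) \<le> n \<Longrightarrow> poly p x = (\<Sum>i\<le>n. coeff p i * x ^ i)"
  unfolding poly_altdef by (rule sum.mono_neutral_left) (auto simp: coeff_eq_0)

text \<open>The operator form of the hypergeometric equation:
  \<open>\<theta> \<Prod>(\<theta> + b - 1) F = x \<Prod>(\<theta> + a) F\<close> with \<open>\<theta> = x d/dx\<close>.\<close>

lemma hypergeo_equation:
  fixes as bs :: "complex list"
  assumes "length bs = length as - 1" "length as \<ge> 1" and b: "set bs \<inter> \<int>\<^sub>\<le>\<^sub>0 = {}"
  defines "F \<equiv> fps_hypergeo as bs 1"
  obtains \<alpha> \<beta> where "(1 - fps_X) * (fps_XD ^^ length as) F =
    (\<Sum>m<length as. (fps_X * fps_const (\<alpha> m) - fps_const (\<beta> m)) * (fps_XD ^^ m) F)"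
proof -
  define l where "l = length as"
  define A where "A = prod_list (map (\<lambda>a. [:a, 1:]) as)"
  \<comment> \<open>The roots 0 and \<open>1 - b\<close> make the value of \<open>B\<close> at
    \<open>n + 1\<close> the denominator in the recurrence of the coefficients. \<open>A\<close> and
    \<open>B\<close> are both monic of degree \<open>l\<close>, which produces the factor
    \<open>1 - fps_X\<close>.\<close>
  define B where "B = prod_list (map (\<lambda>a. [:a, 1:]) (0 # map (\<lambda>b. b - 1) bs))"
  note lA = linear_factors[of as, folded A_def] and lB = linear_factors[of "0 # map (\<lambda>b. b - 1) bs", folded B_def]
  have dA: "degree A = l" "coeff A l = 1" using lA by (auto simp: l_def)
  have "length (0 # map (\<lambda>b. b - 1) bs) = l" using assms by (simp add: l_def)
  hence dB: "degree B = l" "coeff B l = 1" using lB by metis+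
  have pB: "poly B (of_nat (Suc n)) = of_nat (Suc n) * prod_list (map (\<lambda>b. b + of_nat n) bs)" for n
    unfolding lB(3) by (simp add: o_def add.commute algebra_simps)
  have rec: "poly B (of_nat (Suc n)) * F $ Suc n = poly A (of_nat n) * F $ n" for n
  proof -
    have "b + of_nat n \<noteq> 0" if "b \<in> set bs" for b
    proof
      assume "b + of_nat n = 0"
      hence "b = - of_nat n" by (simp add: add_eq_0_iff2)
      hence "b \<in> \<int>\<^sub>\<le>\<^sub>0" by auto
      thus False using b that by auto
    qed
    hence "prod_list (map (\<lambda>b. b + of_nat n) bs) \<noteq> 0" by (auto simp: prod_list_zero_iff)
    thus ?thesis
      unfolding F_def fps_hypergeo_rec foldl_mult_prod_list pB lA(3) by (simp del: of_nat_Suc)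
  qed
  have "(\<Sum>m\<le>l. fps_const (coeff B m) * (fps_XD ^^ m) F) = fps_X * (\<Sum>m\<le>l. fps_const (coeff A m) * (fps_XD ^^ m) F)"
  proof (rule fps_ext)
    fix n
    have B: "(\<Sum>m\<le>l. fps_const (coeff B m) * (fps_XD ^^ m) F) $ n = poly B (of_nat n) * F $ n" for n
      using poly_as_sum_upto[of B l] dB by (simp add: fps_sum_nth fps_XD_funpow_nth sum_distrib_right mult.assoc)
    have A: "(\<Sum>m\<le>l. fps_const (coeff A m) * (fps_XD ^^ m) F) $ n = poly A (of_nat n) * F $ n" for n
      using poly_as_sum_upto[of A l] dA by (simp add: fps_sum_nth fps_XD_funpow_nth sum_distrib_right mult.assoc)
    show "(\<Sum>m\<le>l. fps_const (coeff B m) * (fps_XD ^^ m) F) $ n = (fps_X * (\<Sum>m\<le>l. fps_const (coeff A m) * (fps_XD ^^ m) F)) $ n"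
    proof (cases n)
      case 0
      thus ?thesis unfolding B 0 by (simp add: lB(3))
    next
      case (Suc k)
      thus ?thesis using rec[of k] A[of k] unfolding B by simp
    qed
  qed
  hence "(1 - fps_X) * (fps_XD ^^ l) F =
    (\<Sum>m<l. (fps_X * fps_const (coeff A m) - fps_const (coeff B m)) * (fps_XD ^^ m) F)"
    by (simp add: dA dB lessThan_Suc_atMost[symmetric] algebra_simps sum_distrib_left sum_subtractf)
  thus ?thesis using that unfolding l_def by blast
qed

text \<open>The quotient of consecutive coefficients is bounded: its denominator, with the factor
  \<open>n + 1\<close> included, has as many linear factors in \<open>n\<close> as its numerator and
  never vanishes.\<close>

lemma fps_conv_radius_hypergeo:
  fixes as bs :: "complex list"
  assumes "length bs = length as - 1" "length as \<ge> 1" and b: "set bs \<inter> \<int>\<^sub>\<le>\<^sub>0 = {}"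
  shows "fps_conv_radius (fps_hypergeo as bs 1) > 0"
proof -
  have lower: "\<exists>e>0. \<forall>n. norm (b + of_nat n) \<ge> e * real (Suc n)" if "b \<notin> \<int>\<^sub>\<le>\<^sub>0" for b :: complex
  proof -
    have "(\<lambda>n. of_nat (Suc n) / (b + of_nat n)) \<longlonglongrightarrow> 1"
    proof (rule Lim_transform_eventually)
      have "(\<lambda>n. (1 - b) / (b + of_nat n)) \<longlonglongrightarrow> 0"
        by (intro tendsto_divide_0[OF tendsto_const] tendsto_add_filterlim_at_infinity[OF tendsto_const] tendsto_of_nat)
      from tendsto_add[OF tendsto_const[of 1] this]
      show "(\<lambda>n. 1 + (1 - b) / (b + of_nat n)) \<longlonglongrightarrow> 1" by simp
      have "b + of_nat n \<noteq> 0" for n using that by (metis add_eq_0_iff2 minus_of_nat_in_nonpos_Ints)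
      thus "eventually (\<lambda>n. 1 + (1 - b) / (b + of_nat n) = of_nat (Suc n) / (b + of_nat n)) sequentially"
        by (intro always_eventually) (simp add: field_simps)
    qed
    hence "Bseq (\<lambda>n. of_nat (Suc n) / (b + of_nat n))" by (intro convergent_imp_Bseq convergentI)
    then obtain K where K: "K > 0" "\<And>n. norm (of_nat (Suc n) / (b + of_nat n)) \<le> K" by (auto simp: Bseq_def)
    have "1 / K * real (Suc n) \<le> norm (b + of_nat n)" for n
    proof -
      have "b + of_nat n \<noteq> 0" using that by (metis add_eq_0_iff2 minus_of_nat_in_nonpos_Ints)
      thus ?thesis using K(2)[of n] K(1) by (simp add: norm_divide field_simps del: of_nat_Suc)
    qed
    thus ?thesis using K(1) by (intro exI[of _ "1 / K"]) auto
  qed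
  have prod_lower: "\<exists>e>0. \<forall>n. norm (prod_list (map (\<lambda>b. b + of_nat n) bs)) \<ge> e * real (Suc n) ^ length bs"
    using b
  proof (induction bs)
    case (Cons b bs)
    then obtain e where e: "e > 0" "\<And>n. norm (prod_list (map (\<lambda>b. b + of_nat n) bs)) \<ge> e * real (Suc n) ^ length bs" by auto
    obtain e' where e': "e' > 0" "\<And>n. norm (b + of_nat n) \<ge> e' * real (Suc n)" using lower[of b] Cons.prems by auto
    have "norm (prod_list (map (\<lambda>b. b + of_nat n) (b # bs))) \<ge> (e' * real (Suc n)) * (e * real (Suc n) ^ length bs)" for n
      using e e' by (auto simp: norm_mult simp del: of_nat_Suc intro!: mult_mono)
    thus ?case using e(1) e'(1) by (intro exI[of _ "e' * e"]) (auto simp: mult_ac)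
  qed (auto intro: exI[of _ 1])
  have prod_upper: "\<exists>C>0. \<forall>n. norm (prod_list (map (\<lambda>b. b + of_nat n) as)) \<le> C * real (Suc n) ^ length as"
  proof (induction as)
    case (Cons a as)
    then obtain C where C: "C > 0" "\<And>n. norm (prod_list (map (\<lambda>b. b + of_nat n) as)) \<le> C * real (Suc n) ^ length as" by auto
    have "norm (a + of_nat n) \<le> (norm a + 1) * real (Suc n)" for n
    proof -
      have "norm (a + of_nat n) \<le> norm a + real n" by (metis norm_of_nat norm_triangle_ineq)
      also have "\<dots> \<le> (norm a + 1) * real (Suc n)" by (simp add: algebra_simps)
      finally show ?thesis .
    qed
    hence "norm (prod_list (map (\<lambda>b. b + of_nat n) (a # as))) \<le> ((norm a + 1) * real (Suc n)) * (C * real (Suc n) ^ length as)" for n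
      using C by (auto simp: norm_mult simp del: of_nat_Suc intro!: mult_mono)
    thus ?case using C(1) by (intro exI[of _ "(norm a + 1) * C"]) (auto simp: mult_ac add_nonneg_pos)
  qed (auto intro: exI[of _ 1])
  obtain e where e: "e > 0" "\<And>n. norm (prod_list (map (\<lambda>b. b + of_nat n) bs)) \<ge> e * real (Suc n) ^ length bs"
    using prod_lower by blast
  obtain C where C: "C > 0" "\<And>n. norm (prod_list (map (\<lambda>b. b + of_nat n) as)) \<le> C * real (Suc n) ^ length as"
    using prod_upper by blast
  show ?thesis
  proof (rule fps_conv_radius_pos_ratio)
    show "C / e > 0" using C e by simp
    fix n
    let ?A = "prod_list (map (\<lambda>b. b + of_nat n) as)" and ?B = "prod_list (map (\<lambda>b. b + of_nat n) bs)"
    have "norm ?A / norm (of_nat (Suc n) * ?B) \<le> (C * real (Suc n) ^ length as) / (real (Suc n) * (e * real (Suc n) ^ length bs))"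
      unfolding norm_mult norm_of_nat using C e by (intro frac_le mult_mono mult_pos_pos) auto
    also have "real (Suc n) * (e * real (Suc n) ^ length bs) = e * real (Suc n) ^ length as"
    proof -
      have "length as = Suc (length bs)" using assms(1,2) by simp
      thus ?thesis by (simp add: mult_ac del: of_nat_Suc)
    qed
    also have "(C * real (Suc n) ^ length as) / (e * real (Suc n) ^ length as) = C / e"
      by (simp del: of_nat_Suc)
    finally have "norm (?A / (of_nat (Suc n) * ?B)) \<le> C / e" by (simp add: norm_divide del: of_nat_Suc)
    thus "norm (fps_hypergeo as bs 1 $ Suc n) \<le> C / e * norm (fps_hypergeo as bs 1 $ n)"
      unfolding fps_hypergeo_rec foldl_mult_prod_list norm_mult[of _ "fps_hypergeo as bs 1 $ n"]
      by (intro mult_right_mono) auto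
  qed
qed

section \<open>From identities of power series to germs of first-order systems\<close>

lemma eventually_expansion_eq:
  assumes "f has_fps_expansion F" "g has_fps_expansion F"
  shows "eventually (\<lambda>x. f x = g x) (nhds 0)"
  using assms unfolding has_fps_expansion_def by (auto elim: eventually_elim2)

lemma has_fps_expansion_poly [fps_expansion_intros]:
  "(\<lambda>x. poly P x) has_fps_expansion fps_of_poly (P :: complex poly)"
proof (induction P)
  case (pCons a P)
  have "(\<lambda>x. a + x * poly P x) has_fps_expansion fps_const a + fps_X * fps_of_poly P"
    by (intro fps_expansion_intros pCons)
  thus ?case by (simp add: fps_of_poly_pCons mult.commute)
qed auto

lemma conv_deriv: "fps_conv_radius F > 0 \<Longrightarrow> fps_conv_radius (fps_deriv F) > 0"
  for F :: "complex fps"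
  using fps_conv_radius_deriv[of F] by order

lemma conv_deriv_funpow: "fps_conv_radius F > 0 \<Longrightarrow> fps_conv_radius ((fps_deriv ^^ k) F) > 0"
  for F :: "complex fps"
  by (induction k) (auto intro: conv_deriv)

lemma eventually_eval_deriv:
  fixes F :: "complex fps"
  assumes "fps_conv_radius F > 0"
  shows "eventually (\<lambda>x. (eval_fps F has_field_derivative eval_fps (fps_deriv F) x) (at x)) (nhds 0)"
proof -
  have "eventually (\<lambda>x. x \<in> eball 0 (fps_conv_radius F)) (nhds (0 :: complex))"
    using assms by (intro eventually_nhds_in_open) (auto simp: zero_ereal_def)
  thus ?thesis
    by eventually_elim (auto intro!: has_field_derivative_eval_fps)
qed

text \<open>Points of \<open>A\<close> are exempt because 0 itself may be a pole; for the
  pulled-back hypergeometric system it always is. Such a germ is later used at a base point near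
  0.\<close>

definition ode_germ :: "nat \<Rightarrow> (nat \<Rightarrow> nat \<Rightarrow> complex \<Rightarrow> complex) \<Rightarrow> complex set \<Rightarrow> (nat \<Rightarrow> complex \<Rightarrow> complex) \<Rightarrow> bool" where
  "ode_germ n B A y \<longleftrightarrow> eventually (\<lambda>x. x \<notin> A \<longrightarrow>
     (\<forall>i<n. (y i has_field_derivative (\<Sum>j<n. B i j x * y j x)) (at x))) (nhds 0)"

definition companion :: "nat \<Rightarrow> (nat \<Rightarrow> complex poly) \<Rightarrow> nat \<Rightarrow> nat \<Rightarrow> complex \<Rightarrow> complex" where
  "companion r p i j x = (if Suc i < r then if j = Suc i then 1 else 0 else - poly (p j) x / poly (p r) x)"

lemma ode_germ_companion:
  assumes H: "fps_conv_radius H > 0" and r: "r > 0" and 0: "diff_op r p H = 0"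
  shows "ode_germ r (companion r p) {x. poly (p r) x = 0} (\<lambda>i. eval_fps ((fps_deriv ^^ i) H))"
proof -
  let ?e = "\<lambda>i. eval_fps ((fps_deriv ^^ i) H)"
  have "(\<lambda>x. \<Sum>k\<le>r. poly (p k) x * ?e k x) has_fps_expansion diff_op r p H"
    unfolding diff_op_def by (intro fps_expansion_intros eval_expansion conv_deriv_funpow H)
  hence 1: "eventually (\<lambda>x. (\<Sum>k\<le>r. poly (p k) x * ?e k x) = 0) (nhds 0)"
    using eventually_expansion_eq[of _ 0 "\<lambda>_. 0"] 0 by simp
  have 2: "eventually (\<lambda>x. \<forall>i\<in>{..<r}. (?e i has_field_derivative ?e (Suc i) x) (at x)) (nhds 0)"
    using eventually_eval_deriv[OF conv_deriv_funpow[OF H]] by (intro eventually_ball_finite) auto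
  show ?thesis unfolding ode_germ_def
    using 1 2
  proof eventually_elim
    case (elim x)
    show ?case
    proof (intro impI allI)
      fix i assume x: "x \<notin> {x. poly (p r) x = 0}" and i: "i < r"
      have "?e (Suc i) x = (\<Sum>j<r. companion r p i j x * ?e j x)"
      proof (cases "Suc i < r")
        case True
        have "(\<Sum>j<r. companion r p i j x * ?e j x) = (\<Sum>j<r. if j = Suc i then ?e j x else 0)"
          by (rule sum.cong) (auto simp: companion_def True)
        thus ?thesis using True by simp
      next
        case False
        hence "Suc i = r" using i by simp
        have "(\<Sum>j<r. companion r p i j x * ?e j x) = - (\<Sum>j<r. poly (p j) x * ?e j x) / poly (p r) x"
          using False by (simp add: companion_def sum_divide_distrib sum_negf)
        also have "- (\<Sum>j<r. poly (p j) x * ?e j x) = poly (p r) x * ?e r x"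
          using elim(1) by (simp add: lessThan_Suc_atMost[symmetric] add_eq_0_iff)
        finally show ?thesis using x \<open>Suc i = r\<close> by simp
      qed
      thus "(?e i has_field_derivative (\<Sum>j<r. companion r p i j x * ?e j x)) (at x)"
        using elim(2) i by (metis lessThan_iff)
    qed
  qed
qed

lemma companion_holomorphic:
  "companion r p i j holomorphic_on - {x. poly (p r) x = 0}"
proof (cases "Suc i < r")
  case True
  thus ?thesis unfolding companion_def[abs_def] by (cases "j = Suc i") auto
next
  case False
  thus ?thesis unfolding companion_def[abs_def] by (auto intro!: holomorphic_intros)
qed

text \<open>The first factor is the logarithmic derivative of P / Q. The second is the companion
  matrix of the hypergeometric equation with respect to \<theta>, taken at P / Q.\<close>

definition pullback_matrix :: "nat \<Rightarrow> (nat \<Rightarrow> complex) \<Rightarrow> (nat \<Rightarrow> complex) \<Rightarrow> complex poly \<Rightarrow> complex poly \<Rightarrow>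
    nat \<Rightarrow> nat \<Rightarrow> complex \<Rightarrow> complex" where
  "pullback_matrix l \<alpha> \<beta> P Q i j x =
     (poly (pderiv P) x / poly P x - poly (pderiv Q) x / poly Q x) *
     (if Suc i < l then if j = Suc i then 1 else 0
      else (poly P x * \<alpha> j - poly Q x * \<beta> j) / (poly Q x - poly P x))"

lemma pullback_matrix_holomorphic:
  "pullback_matrix l \<alpha> \<beta> P Q i j holomorphic_on - {x. poly (P * Q * (Q - P)) x = 0}"
proof (cases "Suc i < l")
  case True
  thus ?thesis unfolding pullback_matrix_def[abs_def]
    by (cases "j = Suc i") (auto intro!: holomorphic_intros)
next
  case False
  thus ?thesis unfolding pullback_matrix_def[abs_def] by (auto intro!: holomorphic_intros)
qed

text \<open>Substituting \<open>\<lambda> = P / Q\<close> turns \<open>\<theta>\<close> into \<open>(\<lambda> / \<lambda>') d/dx\<close>, so the vector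
  \<open>(\<theta>\<^sup>m F) \<circ> \<lambda>\<close> solves a first-order system whose poles all lie in \<open>\<lambda>\<^sup>-\<^sup>1 {0, 1, \<infinity>}\<close>;
  critical points of \<open>\<lambda>\<close> are harmless.\<close>

lemma ode_germ_pullback:
  fixes f F :: "complex fps"
  assumes f: "fps_conv_radius f > 0" "f $ 0 = 0" "fps_of_poly Q * f = fps_of_poly P"
    and F: "fps_conv_radius F > 0" and l: "l > 0"
    and eq: "(1 - fps_X) * (fps_XD ^^ l) F = (\<Sum>m<l. (fps_X * fps_const (\<alpha> m) - fps_const (\<beta> m)) * (fps_XD ^^ m) F)"
  shows "ode_germ l (pullback_matrix l \<alpha> \<beta> P Q) {x. poly (P * Q * (Q - P)) x = 0}
    (\<lambda>m. eval_fps ((fps_XD ^^ m) F oo f))"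
proof -
  define T where "T = (\<lambda>m. (fps_XD ^^ m) F)"
  define G where "G = (\<lambda>m. T m oo f)"
  have T: "fps_conv_radius (T m) > 0" for m
  proof (induction m)
    case (Suc m)
    have "(\<lambda>x. x * deriv (eval_fps (T m)) x) has_fps_expansion fps_X * fps_deriv (T m)"
      by (intro fps_expansion_intros eval_expansion Suc)
    thus ?case by (auto simp: T_def fps_XD_def dest: fps_conv_radius_posI)
  qed (simp add: T_def F)
  have G: "fps_conv_radius (G m) > 0" for m
    unfolding G_def by (rule fps_conv_radius_posI[OF has_fps_expansion_compose[OF eval_expansion[OF T] eval_expansion[OF f(1)] f(2)]])
  \<comment> \<open>The chain rule for \<theta> and the two relations \<open>R2\<close> and
    \<open>R3\<close> are kept free of division. They can thus be transferred to functions near 0,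
    and division takes place pointwise, off the poles.\<close>
  have R1: "f * fps_deriv (G m) = fps_deriv f * G (Suc m)" for m
  proof -
    have "G (Suc m) = (fps_X * fps_deriv (T m)) oo f" by (simp add: G_def T_def fps_XD_def)
    also have "\<dots> = f * (fps_deriv (T m) oo f)" by (simp add: fps_compose_mult_distrib f(2))
    finally have "G (Suc m) = f * (fps_deriv (T m) oo f)" .
    moreover have "fps_deriv (G m) = (fps_deriv (T m) oo f) * fps_deriv f"
      unfolding G_def by (rule fps_compose_deriv[OF f(2)])
    ultimately show ?thesis by (simp add: mult_ac)
  qed
  have R2: "(1 - f) * G l = (\<Sum>m<l. (f * fps_const (\<alpha> m) - fps_const (\<beta> m)) * G m)"
  proof -
    have "(1 - f) * G l = ((1 - fps_X) * T l) oo f"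
      by (simp add: G_def fps_compose_mult_distrib fps_compose_sub_distrib f(2))
    also have "\<dots> = (\<Sum>m<l. (f * fps_const (\<alpha> m) - fps_const (\<beta> m)) * G m)"
      unfolding T_def eq by (simp add: G_def T_def fps_compose_sum_distrib fps_compose_mult_distrib fps_compose_sub_distrib f(2))
    finally show ?thesis .
  qed
  have R3: "fps_of_poly (pderiv Q) * f + fps_of_poly Q * fps_deriv f = fps_of_poly (pderiv P)"
    using arg_cong[OF f(3), of fps_deriv] by (simp add: fps_of_poly_pderiv add.commute)
  define \<phi> \<phi>' y y' where defs: "\<phi> = eval_fps f" "\<phi>' = eval_fps (fps_deriv f)"
    "y = (\<lambda>m. eval_fps (G m))" "y' = (\<lambda>m. eval_fps (fps_deriv (G m)))"
  note ex = eval_expansion[OF f(1), folded defs] eval_expansion[OF conv_deriv[OF f(1)], folded defs]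
    eval_expansion[OF G, folded defs] eval_expansion[OF conv_deriv[OF G]]
  have ex3: "y m has_fps_expansion G m" for m unfolding defs by (rule eval_expansion[OF G])
  have ex4: "y' m has_fps_expansion fps_deriv (G m)" for m unfolding defs by (rule eval_expansion[OF conv_deriv[OF G]])
  note ex = ex(1,2) ex3 ex4
  have E1: "eventually (\<lambda>x. \<forall>m\<in>{..<l}. \<phi> x * y' m x = \<phi>' x * y (Suc m) x) (nhds 0)"
  proof (intro eventually_ball_finite ballI)
    fix m
    have "(\<lambda>x. \<phi> x * y' m x) has_fps_expansion f * fps_deriv (G m)"
      by (intro fps_expansion_intros ex)
    moreover have "(\<lambda>x. \<phi>' x * y (Suc m) x) has_fps_expansion f * fps_deriv (G m)"
      unfolding R1 by (intro fps_expansion_intros ex)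
    ultimately show "eventually (\<lambda>x. \<phi> x * y' m x = \<phi>' x * y (Suc m) x) (nhds 0)" by (rule eventually_expansion_eq)
  qed auto
  have E2: "eventually (\<lambda>x. (1 - \<phi> x) * y l x = (\<Sum>m<l. (\<phi> x * \<alpha> m - \<beta> m) * y m x)) (nhds 0)"
  proof (rule eventually_expansion_eq)
    show "(\<lambda>x. (1 - \<phi> x) * y l x) has_fps_expansion (1 - f) * G l" by (intro fps_expansion_intros ex)
    show "(\<lambda>x. (\<Sum>m<l. (\<phi> x * \<alpha> m - \<beta> m) * y m x)) has_fps_expansion (1 - f) * G l"
      unfolding R2 by (intro fps_expansion_intros ex)
  qed
  have E3: "eventually (\<lambda>x. poly Q x * \<phi> x = poly P x) (nhds 0)"
  proof (rule eventually_expansion_eq)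
    show "(\<lambda>x. poly Q x * \<phi> x) has_fps_expansion fps_of_poly P"
      unfolding f(3)[symmetric] by (intro fps_expansion_intros ex)
  qed (intro fps_expansion_intros)
  have E4: "eventually (\<lambda>x. poly (pderiv Q) x * \<phi> x + poly Q x * \<phi>' x = poly (pderiv P) x) (nhds 0)"
  proof (rule eventually_expansion_eq)
    show "(\<lambda>x. poly (pderiv Q) x * \<phi> x + poly Q x * \<phi>' x) has_fps_expansion fps_of_poly (pderiv P)"
      unfolding R3[symmetric] by (intro fps_expansion_intros ex)
  qed (intro fps_expansion_intros)
  have E5: "eventually (\<lambda>x. \<forall>m\<in>{..<l}. (y m has_field_derivative y' m x) (at x)) (nhds 0)"
    unfolding defs by (intro eventually_ball_finite ballI eventually_eval_deriv G) auto
  have "ode_germ l (pullback_matrix l \<alpha> \<beta> P Q) {x. poly (P * Q * (Q - P)) x = 0} y"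
    unfolding ode_germ_def using E1 E2 E3 E4 E5
  proof eventually_elim
    case (elim x)
    show ?case
    proof (intro impI allI)
      fix i assume x: "x \<notin> {x. poly (P * Q * (Q - P)) x = 0}" and i: "i < l"
      define pq where "pq = poly (pderiv P) x / poly P x - poly (pderiv Q) x / poly Q x"
      have nz: "poly P x \<noteq> 0" "poly Q x \<noteq> 0" "poly Q x - poly P x \<noteq> 0" using x by auto
      have \<phi>: "\<phi> x = poly P x / poly Q x" using elim(3) nz by (simp add: field_simps)
      have "\<phi>' x = (poly (pderiv P) x - poly (pderiv Q) x * \<phi> x) / poly Q x"
        using elim(4) nz by (simp add: field_simps)
      moreover have "pq * \<phi> x = (poly (pderiv P) x - poly (pderiv Q) x * \<phi> x) / poly Q x"
        unfolding \<phi> pq_def using nz by (simp add: divide_simps)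
      ultimately have \<phi>': "\<phi>' x = pq * \<phi> x" by simp
      have "\<phi> x \<noteq> 0" using nz \<phi> by simp
      hence y': "y' i x = pq * y (Suc i) x" using elim(1) i unfolding \<phi>' by auto
      have "y' i x = (\<Sum>j<l. pullback_matrix l \<alpha> \<beta> P Q i j x * y j x)"
      proof (cases "Suc i < l")
        case True
        have "(\<Sum>j<l. pullback_matrix l \<alpha> \<beta> P Q i j x * y j x) = (\<Sum>j<l. if j = Suc i then pq * y j x else 0)"
          by (rule sum.cong) (auto simp: pullback_matrix_def pq_def True)
        thus ?thesis using True y' by simp
      next
        case False
        hence il: "Suc i = l" using i by simp
        have 1: "1 - \<phi> x = (poly Q x - poly P x) / poly Q x" unfolding \<phi> using nz by (simp add: field_simps)
        hence "1 - \<phi> x \<noteq> 0" using nz by simp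
        hence "y l x = (\<Sum>m<l. (\<phi> x * \<alpha> m - \<beta> m) * y m x) / (1 - \<phi> x)"
          unfolding elim(2)[symmetric] by simp
        also have "\<dots> = (\<Sum>m<l. (\<phi> x * \<alpha> m - \<beta> m) * y m x) * (poly Q x / (poly Q x - poly P x))"
          unfolding 1 by simp
        also have "\<dots> = (\<Sum>j<l. (poly P x * \<alpha> j - poly Q x * \<beta> j) / (poly Q x - poly P x) * y j x)"
          unfolding sum_distrib_right \<phi> using nz by (intro sum.cong) (auto simp: divide_simps)
        finally show ?thesis using y' il by (simp add: pullback_matrix_def pq_def sum_distrib_left mult.assoc)
      qed
      thus "(y i has_field_derivative (\<Sum>j<l. pullback_matrix l \<alpha> \<beta> P Q i j x * y j x)) (at x)"
        using elim(5) i by (metis lessThan_iff)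
    qed
  qed
  thus ?thesis by (simp add: defs G_def T_def)
qed

text \<open>\<open>A2\<close> is the zero set of \<open>P * Q * (Q - P)\<close>, and each of the
  three factors has degree less than \<open>M\<close>; this is where \<open>3 * M\<close> comes
  from. \<open>A1\<close>, the singular set for \<open>H\<close>, is merely finite.\<close>

lemma hypergeometric_certificate:
  assumes H: "G_function H" and form: "hypergeometric_form M H"
  obtains r A1 B1 y1 l A2 B2 y2 a n where
    "r > 0" "finite A1" "\<And>i j. i < r \<Longrightarrow> j < r \<Longrightarrow> B1 i j holomorphic_on - A1" "ode_germ r B1 A1 y1"
    "l > 0" "finite A2" "\<And>i j. i < l \<Longrightarrow> j < l \<Longrightarrow> B2 i j holomorphic_on - A2" "ode_germ l B2 A2 y2"
    "card A2 < 3 * M" "y1 0 = eval_fps H" "a n \<noteq> (0 :: complex poly)"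
    "eventually (\<lambda>x. (\<Sum>i\<le>n. poly (a i) x * y1 0 x ^ i * y2 0 x ^ (n - i)) = 0) (nhds 0)"
proof -
  obtain as bs \<mu> f where ab: "length as \<ge> 1" "length bs = length as - 1" "set bs \<subseteq> \<rat> - \<int>\<^sub>\<le>\<^sub>0"
    and \<mu>: "algebraic_over_ratfun \<mu>" and adm: "admissible_arg M f" and Heq: "H = \<mu> * (fps_hypergeo as bs 1 oo f)"
    using form unfolding hypergeometric_form_def by blast
  obtain P Q where PQ: "Q \<noteq> 0" "coprime P Q" "degree P < M" "degree Q < M"
      "fps_to_fls f = fls_of_poly P / fls_of_poly Q"
    and fc: "\<forall>c\<in>Qbar. f \<noteq> fps_const c" and f0: "f $ 0 = 0"
    using adm unfolding admissible_arg_def by blast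
  have "fps_to_fls (fps_of_poly Q * f) = fps_to_fls (fps_of_poly P)"
    using PQ(1) by (simp add: fls_times_fps_to_fls PQ(5) fps_of_poly_eq_0_iff)
  hence Qf: "fps_of_poly Q * f = fps_of_poly P" by simp
  have Q0: "poly Q 0 \<noteq> 0"
  proof
    assume "poly Q 0 = 0"
    moreover have "poly P 0 = 0" using arg_cong[OF Qf, of "\<lambda>F. fps_nth F 0"] f0 by (simp add: poly_0_coeff_0)
    ultimately have "[:0, 1:] dvd Q" "[:0, 1:] dvd P" by (simp_all add: poly_eq_0_iff_dvd)
    thus False using PQ(2) coprime_common_divisor[of P Q "[:0, 1:]"] by (auto simp: is_unit_iff_degree)
  qed
  have "f = fps_of_poly P * inverse (fps_of_poly Q)"
  proof -
    have "fps_of_poly Q $ 0 \<noteq> 0" using Q0 by (simp add: poly_0_coeff_0)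
    hence "fps_of_poly Q * inverse (fps_of_poly Q) = 1" by (rule inverse_mult_eq_1')
    thus ?thesis by (simp flip: Qf add: mult_ac)
  qed
  moreover have "(\<lambda>x. poly P x * inverse (poly Q x)) has_fps_expansion fps_of_poly P * inverse (fps_of_poly Q)"
    using Q0 by (intro fps_expansion_intros) (simp add: poly_0_coeff_0)
  ultimately have f_conv: "fps_conv_radius f > 0" by (metis fps_conv_radius_posI)
  have P0: "P \<noteq> 0"
  proof
    assume "P = 0"
    hence "f = fps_const 0" using Qf PQ(1) by (simp add: fps_of_poly_eq_0_iff)
    thus False using fc by (auto simp: Qbar_def)
  qed
  have QP: "Q - P \<noteq> 0"
  proof
    assume "Q - P = 0"
    hence "fps_of_poly Q * (f - 1) = 0" using Qf by (simp add: algebra_simps)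
    hence "f = 1" using PQ(1) by (simp add: fps_of_poly_eq_0_iff)
    thus False using f0 by simp
  qed
  define F where "F = fps_hypergeo as bs 1"
  define l where "l = length as"
  have b: "set bs \<inter> \<int>\<^sub>\<le>\<^sub>0 = {}" using ab by auto
  obtain \<alpha> \<beta> where eq: "(1 - fps_X) * (fps_XD ^^ l) F = (\<Sum>m<l. (fps_X * fps_const (\<alpha> m) - fps_const (\<beta> m)) * (fps_XD ^^ m) F)"
    using hypergeo_equation[OF ab(2,1) b] unfolding F_def l_def by blast
  have F_conv: "fps_conv_radius F > 0" unfolding F_def by (rule fps_conv_radius_hypergeo[OF ab(2,1) b])
  have l: "l > 0" using ab(1) unfolding l_def by linarith
  have H_conv: "fps_conv_radius H > 0" by (rule G_function_conv_radius[OF H])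
  obtain r p where rp: "r > 0" "p r \<noteq> 0" "diff_op r p H = 0"
    using H satisfies_linear_ode_polynomial unfolding G_function_def by metis
  obtain n a where na: "a n \<noteq> 0" "(\<Sum>i\<le>n. fps_of_poly (a i) * \<mu> ^ i) = 0"
    using algebraic_over_ratfun_polynomial[OF \<mu>] .
  define G where "G = F oo f"
  have G_conv: "fps_conv_radius G > 0"
    unfolding G_def by (rule fps_conv_radius_posI[OF has_fps_expansion_compose[OF eval_expansion[OF F_conv] eval_expansion[OF f_conv] f0]])
  have "(\<Sum>i\<le>n. fps_of_poly (a i) * H ^ i * G ^ (n - i)) = (\<Sum>i\<le>n. fps_of_poly (a i) * \<mu> ^ i) * G ^ n"
    unfolding sum_distrib_right
  proof (rule sum.cong)
    fix i assume "i \<in> {..n}"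
    hence "G ^ n = G ^ i * G ^ (n - i)" by (simp flip: power_add)
    thus "fps_of_poly (a i) * H ^ i * G ^ (n - i) = fps_of_poly (a i) * \<mu> ^ i * G ^ n"
      by (simp add: Heq F_def[symmetric] G_def[symmetric] power_mult_distrib mult_ac)
  qed simp
  hence rel0: "(\<Sum>i\<le>n. fps_of_poly (a i) * H ^ i * G ^ (n - i)) = 0" using na(2) by simp
  have "(\<lambda>x. \<Sum>i\<le>n. poly (a i) x * eval_fps H x ^ i * eval_fps G x ^ (n - i)) has_fps_expansion 0"
    unfolding rel0[symmetric] by (intro fps_expansion_intros eval_expansion H_conv G_conv)
  hence rel: "eventually (\<lambda>x. (\<Sum>i\<le>n. poly (a i) x * eval_fps H x ^ i * eval_fps G x ^ (n - i)) = 0) (nhds 0)"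
    by (rule eventually_expansion_eq) auto
  define A2 where "A2 = {x. poly (P * Q * (Q - P)) x = 0}"
  have nz: "P * Q * (Q - P) \<noteq> 0" using P0 QP PQ(1) by simp
  have "card A2 \<le> degree (P * Q * (Q - P))" unfolding A2_def by (rule card_poly_roots_bound[OF nz])
  also have "\<dots> = degree P + degree Q + degree (Q - P)" using P0 QP PQ(1) by (simp add: degree_mult_eq)
  also have "\<dots> < 3 * M" using degree_diff_le_max[of Q P] PQ(3,4) by linarith
  finally have card: "card A2 < 3 * M" .
  show ?thesis
  proof (rule that)
    show "ode_germ r (companion r p) {x. poly (p r) x = 0} (\<lambda>i. eval_fps ((fps_deriv ^^ i) H))"
      by (rule ode_germ_companion[OF H_conv rp(1,3)])
    show "ode_germ l (pullback_matrix l \<alpha> \<beta> P Q) A2 (\<lambda>m. eval_fps ((fps_XD ^^ m) F oo f))"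
      unfolding A2_def by (rule ode_germ_pullback[OF f_conv f0 Qf F_conv l eq])
  qed (use rp l nz card na(1) rel in \<open>auto simp: A2_def G_def poly_roots_finite simp del: poly_mult poly_diff
      intro!: companion_holomorphic pullback_matrix_holomorphic\<close>)
qed

section \<open>Separating iterated and hypergeometric monodromy\<close>

text \<open>The base point moves on a parabola through 0. A straight line might contain two points
  of \<open>S\<close>, whereas on the parabola collinearity with two given distinct points is a
  non-trivial quadratic condition, which excludes only finitely many parameters.\<close>

lemma exists_centre:
  fixes S :: "complex set"
  assumes S: "finite S" and \<rho>: "\<rho> > 0"
  obtains c where "slit_plane S c" "norm c < \<rho>"
proof -
  define p where "p = (\<lambda>\<delta>. Complex \<delta> (\<delta>\<^sup>2))"
  \<comment> \<open>The value at \<open>\<delta>\<close> is Im ((s' - c) cnj (s - c)) for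
    \<open>c = p \<delta>\<close>, which vanishes when s, s' and c are collinear. The two upper
    coefficients vanish together only for s = s'.\<close>
  define q where "q = (\<lambda>(s, s'). [:Im (s' * cnj s), Im s - Im s', Re s' - Re s:])"
  define bad where "bad = (\<Union>z\<in>{z \<in> S \<times> S. fst z \<noteq> snd z}. {\<delta>. poly (q z) \<delta> = 0}) \<union> Re ` S"
  have "finite {\<delta>. poly (q z) \<delta> = 0}" if "z \<in> {z \<in> S \<times> S. fst z \<noteq> snd z}" for z
    using that by (intro poly_roots_finite) (auto simp: q_def complex_eq_iff)
  hence "finite bad" using S unfolding bad_def by (intro finite_UnI finite_UN_I finite_Collect_conjI) auto
  define \<epsilon> where "\<epsilon> = min 1 (\<rho> / 2)"
  have "infinite {0<..<\<epsilon>}" using \<rho> by (intro infinite_Ioo) (auto simp: \<epsilon>_def)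
  then obtain \<delta> where \<delta>: "0 < \<delta>" "\<delta> < \<epsilon>" "\<delta> \<notin> bad"
    using \<open>finite bad\<close> finite_subset by (metis greaterThanLessThan_iff subsetI)
  show ?thesis
  proof (rule that[of "p \<delta>"])
    have "norm (p \<delta>) \<le> \<bar>\<delta>\<bar> + \<bar>\<delta>\<^sup>2\<bar>" unfolding p_def by (metis cmod_le complex.sel)
    also have "\<bar>\<delta>\<^sup>2\<bar> \<le> \<delta>" using \<delta> by (simp add: \<epsilon>_def power2_eq_square mult_left_le)
    finally show "norm (p \<delta>) < \<rho>" using \<delta> by (simp add: \<epsilon>_def)
    show "slit_plane S (p \<delta>)"
    proof
      show "p \<delta> \<notin> S" using \<delta>(3) by (force simp: bad_def p_def)
      fix s s' and r :: real
      assume s: "s \<in> S" "s' \<in> S" "r > 0" "s' - p \<delta> = of_real r * (s - p \<delta>)"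
      show "s' = s"
      proof (rule ccontr)
        assume "s' \<noteq> s"
        hence "poly (q (s, s')) \<delta> \<noteq> 0" using \<delta>(3) s by (force simp: bad_def)
        moreover have "poly (q (s, s')) \<delta> = Im ((s' - p \<delta>) * cnj (s - p \<delta>))"
          by (simp add: q_def p_def algebra_simps power2_eq_square)
        moreover have "Im ((s' - p \<delta>) * cnj (s - p \<delta>)) = 0" unfolding s(4) by (simp add: algebra_simps)
        ultimately show False by simp
      qed
    qed (rule S)
  qed
qed

context slit_plane
begin

lemma germ_extend:
  assumes A: "A \<subseteq> Sing" and B: "\<And>i j. i < n \<Longrightarrow> j < n \<Longrightarrow> B i j holomorphic_on - A"
    and y: "\<And>x i. x \<in> U \<Longrightarrow> x \<notin> A \<Longrightarrow> i < n \<Longrightarrow> (y i has_field_derivative (\<Sum>j<n. B i j x * y j x)) (at x)"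
    and d: "d > 0" "ball c d \<subseteq> \<Omega>" "ball c d \<subseteq> U"
  shows "\<exists>Y. ode_sol n B \<Omega> Y \<and> (\<forall>i<n. \<forall>x\<in>ball c d. Y i x = y i x)"
proof -
  have "\<Omega> \<subseteq> - A" using slit_subset_Compl[of Sing] A by blast
  hence sol: "ode_sol n B (ball c d) y" unfolding ode_sol_def using y d by (meson ComplD subsetD)
  show ?thesis
  proof (rule ode_extend[of A n B d y])
    show "A \<subseteq> Sing" "ode_sol n B (ball c d) y" "d > 0" "ball c d \<subseteq> \<Omega>" using A sol d by blast+
    show "B i j holomorphic_on - A" if "i < n" "j < n" for i j using that by (rule B)
  next
    fix Y assume "ode_sol n B \<Omega> Y" "\<And>i x. i < n \<Longrightarrow> x \<in> ball c d \<Longrightarrow> Y i x = y i x"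
    thus ?thesis by blast
  qed
qed

lemma ode_sol_continuable:
  assumes A: "A \<subseteq> Sing" and B: "\<And>i j. i < n \<Longrightarrow> j < n \<Longrightarrow> B i j holomorphic_on - A"
    and Y: "ode_sol n B \<Omega> Y" and i: "i < n"
  shows "res (Y i) \<in> continuable"
proof -
  have "stable {res (Y i) |Y. ode_sol n B \<Omega> Y}"
    unfolding stable_def
  proof (intro conjI ballI subsetI)
    fix v assume "v \<in> {res (Y i) |Y. ode_sol n B \<Omega> Y}"
    thus "v \<in> holo" using ode_sol_holomorphic[OF _ open_\<Omega> i] by (auto intro!: res_in_holo)
  next
    fix v s and b :: real
    assume "v \<in> {res (Y i) |Y. ode_sol n B \<Omega> Y}" and s: "s \<in> Sing" and b: "b \<in> {1, -1}"
    then obtain Y where Y: "ode_sol n B \<Omega> Y" and v: "v = res (Y i)" by auto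
    obtain Z where "ode_sol n B \<Omega> Z" "cross b s (Y i) (Z i)"
      using ode_cross[OF A B Y s b] i by metis
    thus "\<exists>g\<in>{res (Y i) |Y. ode_sol n B \<Omega> Y}. cross b s v g"
      using res_cross[OF s] v by blast
  qed
  thus ?thesis using stable_subset_continuable Y by blast
qed

lemma centre_nbhd:
  assumes "norm c < \<rho>"
  obtains d where "d > 0" "ball c d \<subseteq> \<Omega>" "ball c d \<subseteq> ball 0 \<rho>"
proof -
  have "open (\<Omega> \<inter> ball 0 \<rho>)" "c \<in> \<Omega> \<inter> ball 0 \<rho>" using open_\<Omega> c_in_\<Omega> assms by auto
  then obtain d where "d > 0" "ball c d \<subseteq> \<Omega> \<inter> ball 0 \<rho>" using openE by blast
  thus ?thesis using that by auto
qed

text \<open>The factor \<open>one\<close> makes the product vanish outside \<open>\<Omega>\<close>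
  even when it is empty, so that it lies in \<open>holo\<close>.\<close>

lemma aut_monomial:
  fixes n :: nat
  assumes \<phi>: "aut \<phi>" and h: "\<And>i. i < n \<Longrightarrow> h i \<in> continuable" "\<And>i. i < n \<Longrightarrow> \<phi> (h i) = h i"
  shows "(\<lambda>x. one x * (\<Prod>i<n. h i x ^ e i)) \<in> continuable \<and>
    \<phi> (\<lambda>x. one x * (\<Prod>i<n. h i x ^ e i)) = (\<lambda>x. one x * (\<Prod>i<n. h i x ^ e i))"
  using h
proof (induction n)
  case 0
  thus ?case using one_continuable aut_one[OF \<phi>] by simp
next
  case (Suc n)
  let ?m = "\<lambda>x. one x * (\<Prod>i<n. h i x ^ e i)"
  have m: "?m \<in> continuable" "\<phi> ?m = ?m" using Suc by auto
  have hn: "h n \<in> continuable" "\<phi> (h n) = h n" using Suc.prems by auto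
  have "(\<lambda>x. ?m x * h n x ^ k) \<in> continuable \<and> \<phi> (\<lambda>x. ?m x * h n x ^ k) = (\<lambda>x. ?m x * h n x ^ k)" for k
  proof (induction k)
    case 0
    thus ?case using m by simp
  next
    case (Suc k)
    define q where "q = (\<lambda>x. ?m x * h n x ^ k)"
    have q: "q \<in> continuable" "\<phi> q = q" using Suc by (simp_all add: q_def)
    have "(\<lambda>x. ?m x * h n x ^ Suc k) = (\<lambda>x. q x * h n x)" by (simp add: q_def mult_ac)
    thus ?case using continuable_mult[OF q(1) hn(1)] autD(3)[OF \<phi> q(1) hn(1)] q(2) hn(2) by simp
  qed
  from this[of "e n"] show ?case by (simp add: mult.assoc)
qed

end

text \<open>\<open>A\<close> and \<open>\<rho>\<close> depend on \<open>H\<close> alone and are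
  fixed before \<open>Sing\<close>, \<open>c\<close> and \<open>T\<close>, because all functions in
  a polynomial have to share one slit plane. The point \<open>s\<close> is found by counting:
  \<open>T\<close> is too large to consist of poles of the hypergeometric system.\<close>

lemma hypergeometric_monodromy:
  assumes "G_function H" "hypergeometric_form M H"
  obtains A \<rho> where "finite A" "\<rho> > 0"
    "\<And>Sing c T. slit_plane Sing c \<Longrightarrow> A \<subseteq> Sing \<Longrightarrow> norm c < \<rho> \<Longrightarrow> T \<subseteq> Sing \<Longrightarrow> card T \<ge> 3 * M \<Longrightarrow>
      \<exists>V h s e. slit_plane.stable Sing c V \<and> h \<in> V \<and> eventually (\<lambda>x. h x = eval_fps H x) (nhds c) \<and>
        s \<in> T \<and> e > 0 \<and> (\<forall>v\<in>V. (slit_plane.continuation Sing c s ^^ e) v = v)"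
proof (rule hypergeometric_certificate[OF assms])
  fix r A1 B1 y1 l A2 B2 y2 a n
  assume 1: "r > 0" "finite A1" "\<And>i j. i < r \<Longrightarrow> j < r \<Longrightarrow> B1 i j holomorphic_on - A1" "ode_germ r B1 A1 y1"
    and 2: "l > 0" "finite A2" "\<And>i j. i < l \<Longrightarrow> j < l \<Longrightarrow> B2 i j holomorphic_on - A2" "ode_germ l B2 A2 y2"
    and card: "card A2 < 3 * M" and y1: "y1 0 = eval_fps H" and a: "a n \<noteq> (0 :: complex poly)"
    and rel: "eventually (\<lambda>x. (\<Sum>i\<le>n. poly (a i) x * y1 0 x ^ i * y2 0 x ^ (n - i)) = 0) (nhds 0)"
  define good where "good = (\<lambda>x. (x \<notin> A1 \<longrightarrow> (\<forall>i<r. (y1 i has_field_derivative (\<Sum>j<r. B1 i j x * y1 j x)) (at x))) \<and>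
      (x \<notin> A2 \<longrightarrow> (\<forall>i<l. (y2 i has_field_derivative (\<Sum>j<l. B2 i j x * y2 j x)) (at x))) \<and>
      (\<Sum>i\<le>n. poly (a i) x * y1 0 x ^ i * y2 0 x ^ (n - i)) = 0)"
  have "eventually good (nhds 0)"
    unfolding good_def using 1(4) 2(4) rel unfolding ode_germ_def by (intro eventually_conj)
  then obtain \<rho> where \<rho>: "\<rho> > 0" "\<And>x. x \<in> ball 0 \<rho> \<Longrightarrow> good x"
    by (auto simp: eventually_nhds_metric dist_commute)
  show ?thesis
  proof (rule that[of "A1 \<union> A2" \<rho>])
    fix Sing c T
    assume sp: "slit_plane Sing c" and A: "A1 \<union> A2 \<subseteq> Sing" and c: "norm c < \<rho>" and T: "T \<subseteq> Sing" "card T \<ge> 3 * M"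
    interpret slit_plane Sing c by (rule sp)
    obtain d where d: "d > 0" "ball c d \<subseteq> \<Omega>" "ball c d \<subseteq> ball 0 \<rho>" using centre_nbhd[OF c] .
    have A12: "A1 \<subseteq> Sing" "A2 \<subseteq> Sing" using A by auto
    have "\<exists>Y. ode_sol r B1 \<Omega> Y \<and> (\<forall>i<r. \<forall>x\<in>ball c d. Y i x = y1 i x)"
    proof (rule germ_extend[where U = "ball 0 \<rho>" and A = A1])
      show "B1 i j holomorphic_on - A1" if "i < r" "j < r" for i j using that by (rule 1(3))
      show "(y1 i has_field_derivative (\<Sum>j<r. B1 i j x * y1 j x)) (at x)"
        if "x \<in> ball 0 \<rho>" "x \<notin> A1" "i < r" for x i using \<rho>(2)[OF that(1)] that by (simp add: good_def)
    qed (use d A12 in auto)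
    then obtain Y where Y: "ode_sol r B1 \<Omega> Y" "\<And>i x. i < r \<Longrightarrow> x \<in> ball c d \<Longrightarrow> Y i x = y1 i x"
      by blast
    have "\<exists>Y. ode_sol l B2 \<Omega> Y \<and> (\<forall>i<l. \<forall>x\<in>ball c d. Y i x = y2 i x)"
    proof (rule germ_extend[where U = "ball 0 \<rho>" and A = A2])
      show "B2 i j holomorphic_on - A2" if "i < l" "j < l" for i j using that by (rule 2(3))
      show "(y2 i has_field_derivative (\<Sum>j<l. B2 i j x * y2 j x)) (at x)"
        if "x \<in> ball 0 \<rho>" "x \<notin> A2" "i < l" for x i using \<rho>(2)[OF that(1)] that by (simp add: good_def)
    qed (use d A12 in auto)
    then obtain Z where Z: "ode_sol l B2 \<Omega> Z" "\<And>i x. i < l \<Longrightarrow> x \<in> ball c d \<Longrightarrow> Z i x = y2 i x"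
      by blast
    have "\<not> T \<subseteq> A2" using card_mono[OF 2(2)] card T(2) by (metis leD le_less_trans)
    then obtain s where s: "s \<in> T" "s \<notin> A2" by blast
    have relYZ: "(\<Sum>i\<le>n. poly (a i) x * Y 0 x ^ i * Z 0 x ^ (n - i)) = 0" if "x \<in> \<Omega>" for x
    proof (rule analytic_continuation_open[where s = "ball c d" and s' = \<Omega> and z = x and g = "\<lambda>_. 0"
          and f = "\<lambda>x. \<Sum>i\<le>n. poly (a i) x * Y 0 x ^ i * Z 0 x ^ (n - i)"])
      show "(\<lambda>x. \<Sum>i\<le>n. poly (a i) x * Y 0 x ^ i * Z 0 x ^ (n - i)) holomorphic_on \<Omega>"
        using ode_sol_holomorphic[OF Y(1) open_\<Omega> 1(1)] ode_sol_holomorphic[OF Z(1) open_\<Omega> 2(1)]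
        by (intro holomorphic_intros)
      fix z assume z: "z \<in> ball c d"
      hence "good z" using d \<rho>(2) by blast
      thus "(\<Sum>i\<le>n. poly (a i) z * Y 0 z ^ i * Z 0 z ^ (n - i)) = 0"
        using Y(2)[OF 1(1) z] Z(2)[OF 2(1) z] by (simp add: good_def)
    qed (use d that open_\<Omega> connected_\<Omega> in auto)
    obtain V where V: "stable V" "res (Y 0) \<in> V" "\<And>v. v \<in> V \<Longrightarrow> (continuation s ^^ fact n) v = v"
      using finite_monodromy[OF A12 1(3) 2(3) 1(1) 2(1) Y(1) Z(1) a relYZ] s T by blast
    have "eventually (\<lambda>x. x \<in> ball c d) (nhds c)" using d(1) by (intro eventually_nhds_in_open) auto
    hence "eventually (\<lambda>x. res (Y 0) x = eval_fps H x) (nhds c)"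
      by eventually_elim (use Y(2)[OF 1(1)] d y1 in \<open>auto simp: res_def\<close>)
    thus "\<exists>V h s e. stable V \<and> h \<in> V \<and> eventually (\<lambda>x. h x = eval_fps H x) (nhds c) \<and>
        s \<in> T \<and> e > 0 \<and> (\<forall>v\<in>V. (continuation s ^^ e) v = v)"
      using V s(1) by (intro exI[of _ V] exI[of _ "res (Y 0)"] exI[of _ s] exI[of _ "fact n"]) auto
  qed (use 1(2) 2(2) \<rho>(1) in auto)
qed

section \<open>The iterated integrals on the slit plane, and the contradiction\<close>

definition letter :: "nat \<Rightarrow> complex" where
  "letter j = 1 / of_nat (Suc j)"

lemma inj_letter: "inj letter"
  by (rule injI) (simp add: letter_def del: of_nat_Suc)

definition hyperlog_matrix :: "nat \<Rightarrow> nat \<Rightarrow> nat \<Rightarrow> complex \<Rightarrow> complex" where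
  "hyperlog_matrix i m j x = (case m of 0 \<Rightarrow> 0 | Suc m' \<Rightarrow> if j = m' then 1 / (x - letter (i + m')) else 0)"

lemma hyperlog_iterated_integrals:
  obtains \<rho> where "\<rho> > 0"
    "\<And>Sing c. slit_plane Sing c \<Longrightarrow> letter ` {..<N} \<subseteq> Sing \<Longrightarrow> norm c < \<rho> \<Longrightarrow> N > 0 \<Longrightarrow>
      \<exists>I. (\<forall>k>0. iterated_integrals Sing c letter N I k) \<and>
          eventually (\<lambda>x. I 0 N x = eval_fps (hyperlog 0 N) x) (nhds c)"
proof -
  have conv: "fps_conv_radius (hyperlog i m) > 0" for i m
    by (rule G_function_conv_radius[OF G_function_hyperlog])
  define y where "y = (\<lambda>i m. eval_fps (hyperlog i m))"
  have step: "eventually (\<lambda>x. x \<noteq> letter (i + m) \<longrightarrow> (y i (Suc m) has_field_derivative y i m x / (x - letter (i + m))) (at x)) (nhds 0)" for i m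
  proof -
    let ?D = "fps_deriv (hyperlog i (Suc m))"
    have "?D * (fps_X - fps_const (letter (i + m))) = hyperlog i m * (dlog (i + m) * (fps_X - fps_const (letter (i + m))))"
      by (simp add: fps_deriv_fps_integral mult.assoc)
    hence D: "?D * (fps_X - fps_const (letter (i + m))) = hyperlog i m" unfolding letter_def dlog_mult by simp
    have "(\<lambda>x. eval_fps ?D x * (x - letter (i + m))) has_fps_expansion ?D * (fps_X - fps_const (letter (i + m)))"
      by (intro fps_expansion_intros eval_expansion conv_deriv conv)
    hence "eventually (\<lambda>x. eval_fps ?D x * (x - letter (i + m)) = y i m x) (nhds 0)"
      unfolding D y_def by (rule eventually_expansion_eq) (rule eval_expansion[OF conv])
    with eventually_eval_deriv[OF conv[of i "Suc m"]] show ?thesis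
    proof eventually_elim
      case (elim x)
      show ?case
      proof
        assume "x \<noteq> letter (i + m)"
        hence "y i m x / (x - letter (i + m)) = eval_fps ?D x" using elim(2) by (simp add: field_simps)
        thus "(y i (Suc m) has_field_derivative y i m x / (x - letter (i + m))) (at x)"
          using elim(1) by (simp add: y_def)
      qed
    qed
  qed
  have "eventually (\<lambda>x. \<forall>(i, m)\<in>{..N} \<times> {..N}. x \<noteq> letter (i + m) \<longrightarrow>
      (y i (Suc m) has_field_derivative y i m x / (x - letter (i + m))) (at x)) (nhds 0)"
    by (rule eventually_ball_finite) (use step in auto)
  then obtain \<rho> where \<rho>: "\<rho> > 0" "\<And>x i m. x \<in> ball 0 \<rho> \<Longrightarrow> i \<le> N \<Longrightarrow> m \<le> N \<Longrightarrow> x \<noteq> letter (i + m) \<Longrightarrow>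
      (y i (Suc m) has_field_derivative y i m x / (x - letter (i + m))) (at x)"
    by (fastforce simp: eventually_nhds_metric dist_commute)
  show ?thesis
  proof (rule that[OF \<rho>(1)])
    fix Sing c
    assume sp: "slit_plane Sing c" and T: "letter ` {..<N} \<subseteq> Sing" and c: "norm c < \<rho>" and N: "N > 0"
    interpret slit_plane Sing c by (rule sp)
    obtain d where d: "d > 0" "ball c d \<subseteq> \<Omega>" "ball c d \<subseteq> ball 0 \<rho>" using centre_nbhd[OF c] .
    \<comment> \<open>For each starting index \<open>i\<close> there is one system, with components
      of length 0, ..., \<open>N - i\<close>. The bound on the length keeps its poles among the
      first \<open>N\<close> letters.\<close>
    let ?n = "\<lambda>i. Suc (N - i)"
    have B: "hyperlog_matrix i m j holomorphic_on - (letter ` {..<N})" if "i \<le> N" "m < ?n i" for i m j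
    proof (cases m)
      case 0
      thus ?thesis by (simp add: hyperlog_matrix_def[abs_def])
    next
      case (Suc m')
      hence "letter (i + m') \<in> letter ` {..<N}" using that by auto
      thus ?thesis unfolding Suc hyperlog_matrix_def[abs_def]
        by (cases "j = m'") (auto intro!: holomorphic_intros)
    qed
    have sum: "(\<Sum>j<?n i. hyperlog_matrix i (Suc m) j x * Y j x) = Y m x / (x - letter (i + m))"
      if "Suc m < ?n i" for i m x and Y :: "nat \<Rightarrow> complex \<Rightarrow> complex"
    proof -
      have "(\<Sum>j<?n i. hyperlog_matrix i (Suc m) j x * Y j x) = (\<Sum>j<?n i. if j = m then Y m x / (x - letter (i + m)) else 0)"
        by (intro sum.cong) (auto simp: hyperlog_matrix_def)
      thus ?thesis using that by simp
    qed
    have sum0: "(\<Sum>j<?n i. hyperlog_matrix i 0 j x * Y j x) = 0" for i x and Y :: "nat \<Rightarrow> complex \<Rightarrow> complex"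
      by (simp add: hyperlog_matrix_def)
    have "\<exists>Y. ode_sol (?n i) (hyperlog_matrix i) \<Omega> Y \<and> (\<forall>m<?n i. \<forall>x\<in>ball c d. Y m x = y i m x)" if i: "i \<le> N" for i
    proof (rule germ_extend[where U = "ball 0 \<rho>" and A = "letter ` {..<N}"])
      show "hyperlog_matrix i m j holomorphic_on - (letter ` {..<N})" if "m < ?n i" for m j
        using i that by (rule B)
    next
      fix x m assume x: "x \<in> ball 0 \<rho>" "x \<notin> letter ` {..<N}" "m < ?n i"
      show "(y i m has_field_derivative (\<Sum>j<?n i. hyperlog_matrix i m j x * y i j x)) (at x)"
      proof (cases m)
        case 0
        have "y i 0 = (\<lambda>_. 1)" by (auto simp: y_def)
        thus ?thesis unfolding 0 sum0 by simp
      next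
        case (Suc m')
        have "x \<noteq> letter (i + m')" using x Suc by auto
        thus ?thesis unfolding Suc sum[OF x(3)[unfolded Suc]]
          using \<rho>(2)[OF x(1) i, of m'] x(3) Suc by auto
      qed
    qed (use d T in auto)
    then obtain Y where Y: "\<And>i. i \<le> N \<Longrightarrow> ode_sol (?n i) (hyperlog_matrix i) \<Omega> (Y i)"
      "\<And>i m x. i \<le> N \<Longrightarrow> m < ?n i \<Longrightarrow> x \<in> ball c d \<Longrightarrow> Y i m x = y i m x" by metis
    define I where "I = (\<lambda>i m. res (Y i m))"
    have I_continuable: "I i m \<in> continuable" if "i + m \<le> N" for i m
      unfolding I_def using that by (intro ode_sol_continuable[OF T B Y(1)]) auto
    have "iterated_integrals Sing c letter N I k" if "k > 0" for k
    proof
      show "letter j \<in> Sing" if "j < N" for j using T that by auto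
      show "inj_on letter {..<N}" using inj_letter by (rule inj_on_subset) auto
      show "I i 0 = one" if "i \<le> N" for i
      proof (rule holo_eqI[where U = "ball c d"])
        show "I i 0 \<in> holo" "one \<in> holo" using I_continuable[of i 0] one_continuable that by (auto intro: continuable_holo)
        fix x assume x: "x \<in> ball c d"
        hence "I i 0 x = y i 0 x" using d Y(2)[OF that _ x, of 0] by (auto simp: I_def res_def)
        thus "I i 0 x = one x" using x d by (auto simp: y_def res_def)
      qed (use d in auto)
      show "(I i (Suc n) has_field_derivative I i n x / (x - letter (i + n))) (at x)"
        if "i + Suc n \<le> N" "x \<in> \<Omega>" for i n x
      proof -
        have n: "Suc n < ?n i" "i \<le> N" using that by auto
        have "(Y i (Suc n) has_field_derivative Y i n x / (x - letter (i + n))) (at x)"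
          using Y(1)[OF n(2)] n(1) that(2) unfolding ode_sol_def sum[OF n(1), symmetric] by blast
        hence "(I i (Suc n) has_field_derivative Y i n x / (x - letter (i + n))) (at x)"
          by (rule has_field_derivative_transform_within_open[OF _ open_\<Omega> that(2)]) (simp add: I_def res_def)
        thus ?thesis using that(2) by (simp add: I_def res_def)
      qed
    qed (use I_continuable N that in auto)
    moreover have "eventually (\<lambda>x. x \<in> ball c d) (nhds c)" using d(1) by (intro eventually_nhds_in_open) auto
    hence "eventually (\<lambda>x. I 0 N x = eval_fps (hyperlog 0 N) x) (nhds c)"
      by eventually_elim (use Y(2)[of 0 N] d in \<open>auto simp: I_def res_def y_def\<close>)
    ultimately show "\<exists>I. (\<forall>k>0. iterated_integrals Sing c letter N I k) \<and>
        eventually (\<lambda>x. I 0 N x = eval_fps (hyperlog 0 N) x) (nhds c)" by blast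
  qed
qed

lemma hyperlog_not_polynomial:
  assumes N: "N > 0" "N \<ge> 3 * M"
  shows "hyperlog 0 N \<notin> Qbar_polynomials_in {H. G_function H \<and> hypergeometric_form M H}"
proof
  assume "hyperlog 0 N \<in> Qbar_polynomials_in {H. G_function H \<and> hypergeometric_form M H}"
  then obtain n :: nat and P H where H': "\<forall>i<n. H i \<in> {H. G_function H \<and> hypergeometric_form M H}"
    and F: "hyperlog 0 N = (\<Sum>e\<in>Poly_Mapping.keys P. fps_const (Poly_Mapping.lookup P e) *
               (\<Prod>i<n. H i ^ Poly_Mapping.lookup e i))"
    unfolding Qbar_polynomials_in_def by blast
  have H: "G_function (H i)" "hypergeometric_form M (H i)" if "i < n" for i using H' that by auto
  define mono_at where "mono_at = (\<lambda>i Sing c T V h s e. slit_plane.stable Sing c V \<and> h \<in> V \<and>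
      eventually (\<lambda>x. h x = eval_fps (H i) x) (nhds c) \<and> s \<in> T \<and> e > 0 \<and>
      (\<forall>v\<in>V. (slit_plane.continuation Sing c s ^^ e) v = v))"
  define cert where "cert = (\<lambda>i A \<rho>. finite A \<and> \<rho> > 0 \<and> (\<forall>Sing c T. slit_plane Sing c \<longrightarrow> A \<subseteq> Sing \<longrightarrow>
      norm c < \<rho> \<longrightarrow> T \<subseteq> Sing \<longrightarrow> card T \<ge> 3 * M \<longrightarrow> (\<exists>V h s e. mono_at i Sing c T V h s e)))"
  have "\<exists>A \<rho>. cert i A \<rho>" if i: "i < n" for i
    by (rule hypergeometric_monodromy[OF H(1)[OF i] H(2)[OF i]]) (unfold cert_def mono_at_def, blast)
  then obtain A \<rho> where cert: "\<And>i. i < n \<Longrightarrow> cert i (A i) (\<rho> i)" by metis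
  have A: "finite (A i)" and \<rho>: "\<rho> i > 0" if "i < n" for i using cert[OF that] by (auto simp: cert_def)
  have mon: "\<exists>V h s e. mono_at i Sing c T V h s e"
    if "i < n" "slit_plane Sing c" "A i \<subseteq> Sing" "norm c < \<rho> i" "T \<subseteq> Sing" "card T \<ge> 3 * M" for i Sing c T
    using cert[OF that(1)] that(2-6) unfolding cert_def by blast
  obtain \<rho>I where \<rho>I: "\<rho>I > 0" and int: "\<And>Sing c. slit_plane Sing c \<Longrightarrow> letter ` {..<N} \<subseteq> Sing \<Longrightarrow> norm c < \<rho>I \<Longrightarrow> N > 0 \<Longrightarrow>
      \<exists>I. (\<forall>k>0. iterated_integrals Sing c letter N I k) \<and>
          eventually (\<lambda>x. I 0 N x = eval_fps (hyperlog 0 N) x) (nhds c)"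
    by (rule hyperlog_iterated_integrals) blast
  let ?m = "\<lambda>e x. \<Prod>i<n. eval_fps (H i) x ^ Poly_Mapping.lookup e i"
  have "(\<lambda>x. \<Sum>e\<in>Poly_Mapping.keys P. Poly_Mapping.lookup P e * ?m e x) has_fps_expansion hyperlog 0 N"
    unfolding F using H(1) by (intro fps_expansion_intros eval_expansion G_function_conv_radius) auto
  moreover have "eval_fps (hyperlog 0 N) has_fps_expansion hyperlog 0 N"
    by (intro eval_expansion G_function_conv_radius G_function_hyperlog)
  ultimately have "eventually (\<lambda>x. eval_fps (hyperlog 0 N) x = (\<Sum>e\<in>Poly_Mapping.keys P. Poly_Mapping.lookup P e * ?m e x)) (nhds 0)"
    by (rule eventually_expansion_eq[rotated])
  then obtain \<rho>E where \<rho>E: "\<rho>E > 0" "\<And>x. x \<in> ball 0 \<rho>E \<Longrightarrow>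
      eval_fps (hyperlog 0 N) x = (\<Sum>e\<in>Poly_Mapping.keys P. Poly_Mapping.lookup P e * ?m e x)"
    by (auto simp: eventually_nhds_metric dist_commute)
  define R where "R = insert \<rho>I (insert \<rho>E (\<rho> ` {..<n}))"
  have R: "finite R" "R \<noteq> {}" "\<And>r. r \<in> R \<Longrightarrow> r > 0" using \<rho> \<rho>I \<rho>E by (auto simp: R_def)
  \<comment> \<open>One slit plane for all functions at once: the singular points of every
    \<open>H i\<close> are added to the letters before the base point is chosen.\<close>
  define Sing where "Sing = letter ` {..<N} \<union> (\<Union>i<n. A i)"
  have "finite Sing" using A by (auto simp: Sing_def)
  moreover have "Min R > 0" using R by simp
  ultimately obtain c where sp: "slit_plane Sing c" and c: "norm c < Min R" by (rule exists_centre)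
  have cR: "norm c < r" if "r \<in> R" for r using c Min_le[OF R(1) that] by simp
  interpret slit_plane Sing c by (rule sp)
  have T: "letter ` {..<N} \<subseteq> Sing" "card (letter ` {..<N}) \<ge> 3 * M"
    using N(2) inj_letter by (auto simp: Sing_def card_image inj_on_subset)
  obtain I where I: "\<And>k. k > 0 \<Longrightarrow> iterated_integrals Sing c letter N I k"
      "eventually (\<lambda>x. I 0 N x = eval_fps (hyperlog 0 N) x) (nhds c)"
    using int[OF sp T(1) cR N(1)] by (auto simp: R_def)
  have "\<exists>V h s e. mono_at i Sing c (letter ` {..<N}) V h s e" if i: "i < n" for i
    using i cR T by (intro mon[OF i sp]) (auto simp: Sing_def R_def)
  then obtain V h s e where "\<And>i. i < n \<Longrightarrow> mono_at i Sing c (letter ` {..<N}) (V i) (h i) (s i) (e i)" by metis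
  hence V: "stable (V i)" "h i \<in> V i" "eventually (\<lambda>x. h i x = eval_fps (H i) x) (nhds c)"
      "s i \<in> letter ` {..<N}" "e i > (0 :: nat)" "\<And>v. v \<in> V i \<Longrightarrow> (continuation (s i) ^^ e i) v = v" if "i < n" for i
    using that unfolding mono_at_def by blast+
  \<comment> \<open>A common multiple of the orders \<open>e i\<close>, so that the k-th power of
    the turn around \<open>s i\<close> is trivial on \<open>V i\<close> for every
    \<open>i\<close>.\<close>
  define k where "k = (\<Prod>i<n. e i)"
  have "k > 0" using V(5) by (auto simp: k_def)
  interpret iterated_integrals Sing c letter N I k by (rule I(1)[OF \<open>k > 0\<close>])
  define w where "w = iter_comm (N - 1)"
  have w: "aut w" using N(1) by (simp add: w_def aut_iter_comm)
  have wh: "w (h i) = h i" if i: "i < n" for i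
  proof -
    obtain p where p: "p < N" "s i = letter p" using V(4)[OF i] by auto
    have "e i dvd k" using i unfolding k_def by (intro dvd_prodI) auto
    then obtain q where q: "k = e i * q" ..
    have "loop p v = v" if v: "v \<in> V i" for v
    proof -
      have "((continuation (s i) ^^ e i) ^^ q) v = v" by (induction q) (auto simp: V(6)[OF i v])
      hence "(continuation (s i) ^^ k) v = v" by (simp add: q funpow_mult)
      thus ?thesis by (simp only: loop_def p(2)[symmetric])
    qed
    thus ?thesis unfolding w_def
      using iter_comm_fix[OF V(1)[OF i], of p "N - 1" "h i"] N(1) p(1) V(2)[OF i] by simp
  qed
  have hAA: "h i \<in> continuable" if "i < n" for i using stable_subset_continuable[OF V(1)] V(2) that by blast
  let ?mon = "\<lambda>e x. one x * (\<Prod>i<n. h i x ^ Poly_Mapping.lookup e i)"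
  have mono: "?mon e \<in> continuable" "w (?mon e) = ?mon e" for e
    using aut_monomial[of w n h "Poly_Mapping.lookup e", OF w hAA wh] by auto
  define L where "L = (\<lambda>x. \<Sum>e\<in>Poly_Mapping.keys P. Poly_Mapping.lookup P e * ?mon e x)"
  have "I 0 N = L"
  proof -
    have "eventually (\<lambda>x. x \<in> \<Omega> \<inter> ball 0 \<rho>E) (nhds c)"
      using open_\<Omega> c_in_\<Omega> cR[of \<rho>E] by (intro eventually_nhds_in_open) (auto simp: R_def)
    moreover have "eventually (\<lambda>x. \<forall>i\<in>{..<n}. h i x = eval_fps (H i) x) (nhds c)"
      using V(3) by (intro eventually_ball_finite) auto
    ultimately have "eventually (\<lambda>x. x \<in> \<Omega> \<and> I 0 N x = L x) (nhds c)"
      using I(2)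
    proof eventually_elim
      case (elim x)
      have "I 0 N x = (\<Sum>e\<in>Poly_Mapping.keys P. Poly_Mapping.lookup P e * ?m e x)"
        using elim \<rho>E(2) by simp
      also have "\<dots> = L x"
        using elim unfolding L_def by (intro sum.cong) (auto simp: res_def intro!: prod.cong)
      finally show ?case using elim by simp
    qed
    then obtain U where U: "open U" "c \<in> U" "\<And>x. x \<in> U \<Longrightarrow> x \<in> \<Omega> \<and> I 0 N x = L x"
      unfolding eventually_nhds by blast
    show ?thesis
    proof (rule holo_eqI[OF _ _ U(1)])
      show "I 0 N \<in> holo" by (intro continuable_holo I_continuable) simp
      show "L \<in> holo" unfolding L_def by (intro continuable_holo continuable_lincomb mono) auto
    qed (use U in auto)
  qed
  moreover have "w L = L"
    unfolding L_def by (subst aut_lincomb[OF w]) (auto simp: mono)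
  ultimately have "iter_comm (N - 1) (I 0 N) = I 0 N" by (simp add: w_def)
  thus False using iter_comm_moves_I by contradiction
qed

theorem corollary2:
  fixes M :: nat
  assumes "M \<ge> 1"
  shows "\<exists>F. G_function F \<and>
           F \<notin> Qbar_polynomials_in {H. G_function H \<and> hypergeometric_form M H}"
  using G_function_hyperlog[of 0 "3 * M"] hyperlog_not_polynomial[of "3 * M" M] assms by auto

end
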